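(* Let $(\mathcal{B},\mathcal{L},\theta,\mathcal{I}_\alpha)$ be a generalized Boolean dynamical system, let $\Phi=(\{U_t\}_{t\in\mathbb{F}},\{\varphi_t\}_{t\in\mathbb{F}})$ be the associated partial action of the free group $\mathbb{F}$ on the boundary path space $\partial E$, and let $\mathbb{F}\ltimes_\varphi\partial E$ be the associated transformation groupoid. Consider the following: (1) $(\mathcal{B},\mathcal{L},\theta)$ satisfies Condition (L). (2) $\Phi$ is topologically free. (3) $\mathbb{F}\ltimes_\varphi\partial E$ is topologically principal. (4) $\mathbb{F}\ltimes_\varphi\partial E$ is effective. Then (1)$\iff$(2)$\iff$(3)$\implies$(4). Moreover, if $\mathcal{B}$ and $\mathcal{L}$ are countable, then (4)$\implies$(3).
   Context: Boolean dynamical systems. A Boolean algebra is a relatively complemented distributive lattice $\mathcal{B}$ with least element $\emptyset$ (no greatest element is required), with meet $\cap$, join $\cup$, relative complement $\setminus$ and order $A\subseteq B \iff A\cap B=A$. An ideal of $\mathcal{B}$ is a non-empty subset closed under finite unions and downward closed; it is again a Boolean algebra. A filter is a non-empty, down-directed, upward closed subset not containing $\emptyset$; an ultrafilter is a maximal filter; $\widehat{\mathcal{B}}$ is the set of ultrafilters of $\mathcal{B}$. An action on $\mathcal{B}$ is a map $\mathcal{B}\to\mathcal{B}$ preserving $\cap,\cup,\setminus$ and sending $\emptyset$ to $\emptyset$. For a set $\mathcal{L}$, $\mathcal{L}^{\geq 1}$ is the set of non-empty finite words, $\mathcal{L}^*=\mathcal{L}^{\ge1}\cup\{\emptyset\}$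 ($\emptyset$ also denotes the empty word), $|\alpha|$ is the length of $\alpha$, $\alpha_{i,j}=\alpha_i\cdots\alpha_j$. A Boolean dynamical system is a triple $(\mathcal{B},\mathcal{L},\theta)$ with $\{\theta_\alpha\}_{\alpha\in\mathcal{L}}$ a family of actions on $\mathcal{B}$; $\theta_{\alpha_1\cdots\alpha_n}=\theta_{\alpha_n}\circ\cdots\circ\theta_{\alpha_1}$, $\theta_\emptyset=\mathrm{Id}$. For $B\in\mathcal{B}$, $\Delta_B=\{\alpha\in\mathcal{L}:\theta_\alpha(B)\ne\emptyset\}$; $A$ is regular if $0<|\Delta_B|<\infty$ for every $\emptyset\neq B\subseteq A$; $\mathcal{B}_{reg}$ is the set of regular elements (including $\emptyset$). A generalized Boolean dynamical system $(\mathcal{B},\mathcal{L},\theta,\mathcal{I}_\alpha)$ is a Boolean dynamical system together with ideals $\mathcal{I}_\alpha\subseteq\mathcal{B}$ ($\alpha\in\mathcal{L}$) such that $\theta_\alpha(\mathcal{B})\subseteq\mathcal{I}_\alpha$. Put $\mathcal{I}_\emptyset=\mathcal{B}$ and, for $\alpha=\alpha_1\cdots\alpha_n$, $\mathcal{I}_\alpha=\{A\in\mathcal{B}: A\subseteq\theta_{\alpha_2\cdots\alpha_n}(B)\text{ for some }B\in\mathcal{I}_{\alpha_1}\}$. Condition (L). For $\alpha=\alpha_1\cdots\alpha_n\in\mathcal{L}^{\ge1}$ and $\emptyset\ne A\in\mathcal{B}$, the pair $(\alpha,A)$ is a cycle if $\theta_\alpha(B)=B$ for all $B\subseteq A$.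 A cycle $(\alpha,A)$ has no exits if for every $t\in\{1,\dots,n\}$ and every $\emptyset\ne B\subseteq\theta_{\alpha_{1,t}}(A)$ we have $B\in\mathcal{B}_{reg}$ and $\Delta_B=\{\alpha_{t+1}\}$ (where $\alpha_{n+1}:=\alpha_1$). $(\mathcal{B},\mathcal{L},\theta)$ satisfies Condition (L) if it has no cycle with no exits. Boundary path space. $E^0=\widehat{\mathcal{B}}$ with basis of open sets $Z(A)=\{\xi\in\widehat{\mathcal{B}}:A\in\xi\}$, $A\in\mathcal{B}$. $F^0=E^0\cup\{\emptyset\}$, where $\emptyset$ (the empty subset of $\mathcal{B}$) is an isolated point if $\mathcal{B}$ has a greatest element, and otherwise is the point at infinity of the one-point compactification of $E^0$. For $\alpha\in\mathcal{L}$, $X_\alpha=\widehat{\mathcal{I}_\alpha}$ is the set of ultrafilters of $\mathcal{I}_\alpha$. $E^1=\{e^\alpha_\eta:\alpha\in\mathcal{L},\eta\in X_\alpha\}$ with the topology generated by the sets $Z^1(\alpha,B)=\{e^\alpha_\eta:\eta\in X_\alpha,\ B\in\eta\}$, $\alpha\in\mathcal{L}$, $B\in\mathcal{I}_\alpha$. Define $d:E^1\to E^0$, $d(e^\alpha_\eta)=\{C\in\mathcal{B}: C\supseteq A\text{ for some }A\in\eta\}$, and $r:E^1\to F^0$, $r(e^\alpha_\eta)=\{A\in\mathcal{B}:\theta_\alpha(A)\in\eta\}$. $E^n$ ($n\ge2$) is the set of $e_1\cdots e_n\in\prod_{i=1}^nE^1$ with $d(e_i)=r(e_{i+1})$ for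 $1\le i<n$, with the subspace topology; $E^*=\bigsqcup_{n\ge0}E^n$ with the disjoint union topology; $E^\infty$ is the set of infinite sequences $(e_i)_{i\ge1}$ in $E^1$ with $d(e_i)=r(e_{i+1})$ for all $i$. For $\mu=e_1\cdots e_n\in E^n$, $d(\mu)=d(e_n)$, $r(\mu)=r(e_1)$; for $\xi\in E^0$, $d(\xi)=r(\xi)=\xi$; for an infinite path, $r(\mu)=r(e_1)$. $|\mu|$ is the length, and $\mu_{[i,j]}$ is the sub-path from the $i$-th to the $j$-th edge. Let $F^0_{sce}=F^0\setminus\overline{r(E^1)}$, $F^0_{fin}=\{v\in F^0: v\text{ has a neighborhood }V\text{ with }r^{-1}(V)\text{ compact}\}$, $F^0_{rg}=F^0_{fin}\setminus\overline{F^0_{sce}}$, $F^0_{sg}=F^0\setminus F^0_{rg}$, $E^0_{sg}=F^0_{sg}\cap E^0$. The boundary path space is $\partial E=E^\infty\sqcup\{\mu\in E^*:d(\mu)\in E^0_{sg}\}$. For $S\subset E^*$ let $\mathcal{Z}(S)=\{\mu\in\partial E: r(\mu)\in S\text{ or }\mu_{[1,i]}\in S\text{ for some }1\le i\le|\mu|\}$; the topology of $\partial E$ is generated by the sets $\mathcal{Z}(U)\cap\mathcal{Z}(K)^c$ with $U\subseteq E^*$ open and $K\subseteq E^*$ compact. Partial action. $\mathcal{W}^*=\{\alpha\in\mathcal{L}^*:\mathcal{I}_\alpha\neq\{\emptyset\}\}$. $\mathbb{F}$ is the free group generated by $\mathcal{L}$, with identity denoted $\emptyset$. Put $U_\emptyset=\partial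 E$. For $\alpha,\beta\in\mathcal{W}^*$ with $\alpha\beta^{-1}$ in reduced form and $\mathcal{I}_\alpha\cap\mathcal{I}_\beta\ne\{\emptyset\}$: $U_{\alpha\beta^{-1}}=\{(e^{\mu_k}_{\eta_k})_{k}\in\partial E:\mu_1\cdots\mu_{|\alpha|}=\alpha,\ \eta_{|\alpha|}\cap\mathcal{I}_\beta\ne\emptyset\}$ if $\alpha\ne\emptyset$ (so $U_\alpha$ is the set of boundary paths whose label word begins with $\alpha$), and $U_{\beta^{-1}}=\{\mu\in\partial E:r(\mu)\cap\mathcal{I}_\beta\neq\emptyset\}$. For all other $t\in\mathbb{F}$, $U_t=\emptyset$. $\varphi_\emptyset$ is the identity. For $\alpha,\beta\in\mathcal{W}^*$ with $\alpha\beta^{-1}$ reduced and $U_{\beta\alpha^{-1}}\ne\emptyset$, $\varphi_{\alpha\beta^{-1}}:U_{\beta\alpha^{-1}}\to U_{\alpha\beta^{-1}}$ is $\varphi_{\alpha\beta^{-1}}(\mu)=e^{\alpha_1}_{\eta_1}\cdots e^{\alpha_n}_{\eta_n}\mu_{[|\beta|+1,|\mu|]}$, where $n=|\alpha|$, $\eta_n=v\cap\mathcal{I}_{\alpha_n}$ with $v=d(\mu_{[1,|\beta|]})$ (and $v=r(\mu)$ if $\beta=\emptyset$), and $\eta_{i}=\{A\in\mathcal{B}:\theta_{\alpha_{i+1}}(A)\in\eta_{i+1}\}\cap\mathcal{I}_{\alpha_{i}}$ for $i=n-1,\dots,1$ (if $\alpha=\emptyset$ the edges $e^{\alpha_i}_{\eta_i}$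 are absent, and if moreover $|\mu|=|\beta|$ the result is the vertex $d(\mu)$). For all other $t$, $\varphi_t:U_{t^{-1}}\to U_t$ is the empty map. This is a partial action $\Phi$ of $\mathbb{F}$ on $\partial E$. $\Phi$ is topologically free if $\operatorname{Fix}(t)=\{\mu\in\partial E:\mu\in U_{t^{-1}},\ \varphi_t(\mu)=\mu\}$ has empty interior for all $t\in\mathbb{F}\setminus\{\emptyset\}$. Groupoid. $\mathbb{F}\ltimes_\varphi\partial E=\{(t,\mu)\in\mathbb{F}\times\partial E:\mu\in U_t\}$ (topology induced from the product with $\mathbb{F}$ discrete), with $(t,\mu)(s,\nu)=(ts,\mu)$ if $\varphi_{t^{-1}}(\mu)=\nu$, $(t,\mu)^{-1}=(t^{-1},\varphi_{t^{-1}}(\mu))$, range $r(t,\mu)=\mu$ and source $s(t,\mu)=\varphi_{t^{-1}}(\mu)$, unit space identified with $\partial E$. An étale groupoid $\mathcal{G}$ is topologically principal if the set of units $u$ with $\{\gamma\in\mathcal{G}:r(\gamma)=s(\gamma)=u\}=\{u\}$ is dense in $\mathcal{G}^{(0)}$, and effective if the interior of $\operatorname{Iso}(\mathcal{G})=\{\gamma:s(\gamma)=r(\gamma)\}$ equals $\mathcal{G}^{(0)}$. *)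

theory Defs
  imports "HOL-Analysis.Analysis" "HOL-Algebra.Group" "HOL-Library.Extended_Nat"
begin

section \<open>Boolean algebras without a greatest element\<close>

text \<open>The two axioms make \<open>a - b\<close> the complement of \<open>inf a b\<close> in the interval from
  \<open>bot\<close> to \<open>a\<close>; a distributive lattice with \<open>bot\<close> is relatively complemented iff such an
  operation exists, and the operation is then unique.\<close>

class relative_boolean_algebra = distrib_lattice + order_bot + minus +
  assumes inf_diff_bot: "inf (a - b) b = bot"
    and sup_diff_inf: "sup (a - b) (inf a b) = a"

definition ba_ideal :: "'b::relative_boolean_algebra set \<Rightarrow> bool" where
  "ba_ideal J \<longleftrightarrow> J \<noteq> {} \<and> (\<forall>A\<in>J. \<forall>B\<in>J. sup A B \<in> J) \<and> (\<forall>A\<in>J. \<forall>B. B \<le> A \<longrightarrow> B \<in> J)"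

text \<open>Filters and ultrafilters are relative to a subset \<open>J\<close>, which is \<open>UNIV\<close> or an ideal
  (regarded as a Boolean algebra in its own right).\<close>

definition ba_filter :: "'b::relative_boolean_algebra set \<Rightarrow> 'b set \<Rightarrow> bool" where
  "ba_filter J F \<longleftrightarrow> F \<subseteq> J \<and> F \<noteq> {} \<and> bot \<notin> F \<and>
     (\<forall>A\<in>F. \<forall>B\<in>F. \<exists>C\<in>F. C \<le> A \<and> C \<le> B) \<and> (\<forall>A\<in>F. \<forall>B\<in>J. A \<le> B \<longrightarrow> B \<in> F)"

definition ba_ultrafilters :: "'b::relative_boolean_algebra set \<Rightarrow> 'b set set" where
  "ba_ultrafilters J = {F. ba_filter J F \<and> (\<forall>G. ba_filter J G \<and> F \<subseteq> G \<longrightarrow> G = F)}"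

definition ba_action :: "('b::relative_boolean_algebra \<Rightarrow> 'b) \<Rightarrow> bool" where
  "ba_action f \<longleftrightarrow> f bot = bot \<and> (\<forall>A B. f (inf A B) = inf (f A) (f B) \<and>
     f (sup A B) = sup (f A) (f B) \<and> f (A - B) = f A - f B)"


section \<open>Boolean dynamical systems and Condition (L)\<close>

text \<open>The Boolean algebra is the whole type \<open>'b\<close>; the alphabet is a set \<open>L\<close>, which may be
  empty.\<close>

locale boolean_dynamical_system =
  fixes L :: "'l set"
    and \<theta> :: "'l \<Rightarrow> 'b::relative_boolean_algebra \<Rightarrow> 'b"
  assumes action: "a \<in> L \<Longrightarrow> ba_action (\<theta> a)"
begin

definition \<theta>w :: "'l list \<Rightarrow> 'b \<Rightarrow> 'b" where
  "\<theta>w \<alpha> = fold \<theta> \<alpha>"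

definition \<Delta> :: "'b \<Rightarrow> 'l set" where
  "\<Delta> B = {a\<in>L. \<theta> a B \<noteq> bot}"

definition regular :: "'b \<Rightarrow> bool" where
  "regular A \<longleftrightarrow> (\<forall>B. B \<noteq> bot \<and> B \<le> A \<longrightarrow> finite (\<Delta> B) \<and> \<Delta> B \<noteq> {})"

definition cycle :: "'l list \<Rightarrow> 'b \<Rightarrow> bool" where
  "cycle \<alpha> A \<longleftrightarrow> \<alpha> \<noteq> [] \<and> set \<alpha> \<subseteq> L \<and> A \<noteq> bot \<and> (\<forall>B\<le>A. \<theta>w \<alpha> B = B)"

text \<open>List positions start at 0, so \<open>\<alpha> ! (t mod length \<alpha>)\<close> is the letter of \<open>\<alpha>\<close> with
  index \<open>t + 1\<close>, read cyclically.\<close>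

definition no_exits :: "'l list \<Rightarrow> 'b \<Rightarrow> bool" where
  "no_exits \<alpha> A \<longleftrightarrow> (\<forall>t\<in>{1..length \<alpha>}. \<forall>B. B \<noteq> bot \<and> B \<le> \<theta>w (take t \<alpha>) A \<longrightarrow>
     regular B \<and> \<Delta> B = {\<alpha> ! (t mod length \<alpha>)})"

definition condition_L :: bool where
  "condition_L \<longleftrightarrow> \<not> (\<exists>\<alpha> A. cycle \<alpha> A \<and> no_exits \<alpha> A)"

end

locale generalized_boolean_dynamical_system = boolean_dynamical_system L \<theta>
  for L :: "'l set" and \<theta> :: "'l \<Rightarrow> 'b::relative_boolean_algebra \<Rightarrow> 'b" +
  fixes I :: "'l \<Rightarrow> 'b set"
  assumes ideal: "a \<in> L \<Longrightarrow> ba_ideal (I a)"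
    and range_subset: "a \<in> L \<Longrightarrow> range (\<theta> a) \<subseteq> I a"


section \<open>Free groups\<close>

text \<open>A reduced word is a list of signed generators: \<open>(a, True)\<close> stands for \<open>a\<close> and
  \<open>(a, False)\<close> for its inverse.\<close>

type_synonym 'a gword = "('a \<times> bool) list"

definition cancels :: "'a \<times> bool \<Rightarrow> 'a \<times> bool \<Rightarrow> bool" where
  "cancels x y \<longleftrightarrow> fst x = fst y \<and> snd x \<noteq> snd y"

definition reduced :: "'a gword \<Rightarrow> bool" where
  "reduced w \<longleftrightarrow> successively (\<lambda>x y. \<not> cancels x y) w"

fun reduced_cons :: "'a \<times> bool \<Rightarrow> 'a gword \<Rightarrow> 'a gword" where
  "reduced_cons x [] = [x]"
| "reduced_cons x (y # w) = (if cancels x y then w else x # y # w)"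

definition free_group :: "'a set \<Rightarrow> 'a gword monoid" where
  "free_group X = \<lparr>carrier = {w. reduced w \<and> fst ` set w \<subseteq> X},
     monoid.mult = (\<lambda>v w. foldr reduced_cons v w), one = []\<rparr>"

lemma reduced_reduced_cons: "reduced w \<Longrightarrow> reduced (reduced_cons x w)"
  by (cases w) (auto simp: reduced_def successively_Cons)

lemma set_reduced_cons: "set (reduced_cons x w) \<subseteq> insert x (set w)"
  by (cases w) auto

lemma reduced_foldr: "reduced w \<Longrightarrow> reduced (foldr reduced_cons v w)"
  by (induction v) (auto simp: reduced_reduced_cons)

lemma set_foldr: "set (foldr reduced_cons v w) \<subseteq> set v \<union> set w"
proof (induction v)
  case (Cons x v)
  then show ?case using set_reduced_cons[of x "foldr reduced_cons v w"] by auto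
qed simp

lemma reduced_cons_cancel:
  assumes "cancels x y" "reduced w"
  shows "reduced_cons x (reduced_cons y w) = w"
proof (cases w)
  case (Cons z u)
  have "reduced_cons x u = x # u" if "x = z"
    using assms(2) that Cons by (cases u) (auto simp: reduced_def)
  moreover have "x = z" if "cancels y z"
    using assms(1) that by (auto simp: cancels_def prod_eq_iff)
  ultimately show ?thesis
    using assms(1) Cons by auto
qed (use assms in simp)

lemma foldr_reduced_cons:
  assumes "reduced w"
  shows "foldr reduced_cons (reduced_cons x v) w = reduced_cons x (foldr reduced_cons v w)"
  using assms by (cases v) (auto simp: reduced_cons_cancel reduced_foldr)

lemma foldr_foldr:
  assumes "reduced w"
  shows "foldr reduced_cons (foldr reduced_cons u v) w = foldr reduced_cons u (foldr reduced_cons v w)"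
  using assms by (induction u) (auto simp: foldr_reduced_cons)

lemma foldr_reduced_Nil: "reduced v \<Longrightarrow> foldr reduced_cons v [] = v"
proof (induction v)
  case (Cons x v)
  then show ?case by (cases v) (auto simp: reduced_def successively_Cons)
qed simp

lemma group_free_group: "group (free_group X)"
proof (rule groupI)
  fix u v w :: "'a gword"
  assume "u \<in> carrier (free_group X)" "v \<in> carrier (free_group X)"
  then show "u \<otimes>\<^bsub>free_group X\<^esub> v \<in> carrier (free_group X)"
    using set_foldr[of u v] by (auto simp: free_group_def reduced_foldr image_subset_iff)
next
  fix u v w :: "'a gword"
  assume "w \<in> carrier (free_group X)"
  then show "u \<otimes>\<^bsub>free_group X\<^esub> v \<otimes>\<^bsub>free_group X\<^esub> w
      = u \<otimes>\<^bsub>free_group X\<^esub> (v \<otimes>\<^bsub>free_group X\<^esub> w)"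
    by (simp add: free_group_def foldr_foldr)
next
  fix w :: "'a gword"
  assume w: "w \<in> carrier (free_group X)"
  let ?f = "\<lambda>(a, b). (a, \<not> b)"
  let ?u = "rev (map ?f w)"
  have canc: "foldr reduced_cons (rev (map ?f v)) v = []" for v :: "'a gword"
    by (induction v) (auto simp: cancels_def)
  have "successively (\<lambda>x y. \<not> cancels x y) ?u"
    using w by (auto simp: free_group_def reduced_def successively_map cancels_def
        case_prod_beta eq_commute)
  then have "?u \<in> carrier (free_group X)"
    using w by (auto simp: free_group_def reduced_def)
  moreover have "?u \<otimes>\<^bsub>free_group X\<^esub> w = \<one>\<^bsub>free_group X\<^esub>"
    using canc[of w] by (simp add: free_group_def)
  ultimately show "\<exists>y\<in>carrier (free_group X). y \<otimes>\<^bsub>free_group X\<^esub> w = \<one>\<^bsub>free_group X\<^esub>"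
    by blast
qed (auto simp: free_group_def reduced_def)


section \<open>Partial actions, groupoids\<close>

text \<open>A partial action of a group \<open>G\<close> on a space \<open>X\<close> is given by the sets \<open>U t\<close> and maps
  \<open>\<phi> t\<close> from \<open>U (inv t)\<close> to \<open>U t\<close>; the values of the function \<open>\<phi> t\<close> outside \<open>U (inv t)\<close> are
  immaterial.\<close>

definition partial_action_Fix ::
    "('t, 'm) monoid_scheme \<Rightarrow> 'x topology \<Rightarrow> ('t \<Rightarrow> 'x set) \<Rightarrow> ('t \<Rightarrow> 'x \<Rightarrow> 'x) \<Rightarrow> 't \<Rightarrow> 'x set" where
  "partial_action_Fix G X U \<phi> t = {x \<in> topspace X. x \<in> U (inv\<^bsub>G\<^esub> t) \<and> \<phi> t x = x}"

definition topologically_free ::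
    "('t, 'm) monoid_scheme \<Rightarrow> 'x topology \<Rightarrow> ('t \<Rightarrow> 'x set) \<Rightarrow> ('t \<Rightarrow> 'x \<Rightarrow> 'x) \<Rightarrow> bool" where
  "topologically_free G X U \<phi> \<longleftrightarrow>
     (\<forall>t \<in> carrier G - {\<one>\<^bsub>G\<^esub>}. X interior_of (partial_action_Fix G X U \<phi> t) = {})"

record 'g top_groupoid =
  arrows_top :: "'g topology"
  composable :: "'g \<Rightarrow> 'g \<Rightarrow> bool"
  comp :: "'g \<Rightarrow> 'g \<Rightarrow> 'g"
  ginv :: "'g \<Rightarrow> 'g"

definition grange :: "'g top_groupoid \<Rightarrow> 'g \<Rightarrow> 'g" where
  "grange H g = comp H g (ginv H g)"

definition gsource :: "'g top_groupoid \<Rightarrow> 'g \<Rightarrow> 'g" where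
  "gsource H g = comp H (ginv H g) g"

definition gunits :: "'g top_groupoid \<Rightarrow> 'g set" where
  "gunits H = grange H ` topspace (arrows_top H)"

definition gIso :: "'g top_groupoid \<Rightarrow> 'g set" where
  "gIso H = {g \<in> topspace (arrows_top H). gsource H g = grange H g}"

definition topologically_principal :: "'g top_groupoid \<Rightarrow> bool" where
  "topologically_principal H \<longleftrightarrow>
     subtopology (arrows_top H) (gunits H) closure_of
       {u \<in> gunits H. {g \<in> topspace (arrows_top H). grange H g = u \<and> gsource H g = u} = {u}}
     = gunits H"

definition effective :: "'g top_groupoid \<Rightarrow> bool" where
  "effective H \<longleftrightarrow> arrows_top H interior_of gIso H = gunits H"

text \<open>Here \<open>grange\<close> and \<open>gsource\<close> of \<open>(t, x)\<close> come out as \<open>(\<one>, x)\<close> and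
  \<open>(\<one>, \<phi> (inv t) x)\<close>: a point \<open>x\<close> is identified with the unit \<open>(\<one>, x)\<close>.\<close>

definition transformation_groupoid ::
    "('t, 'm) monoid_scheme \<Rightarrow> 'x topology \<Rightarrow> ('t \<Rightarrow> 'x set) \<Rightarrow> ('t \<Rightarrow> 'x \<Rightarrow> 'x) \<Rightarrow>
      ('t \<times> 'x) top_groupoid" where
  "transformation_groupoid G X U \<phi> =
     \<lparr>arrows_top = subtopology (prod_topology (discrete_topology (carrier G)) X) {(t, x). x \<in> U t},
      composable = (\<lambda>(t, x) (s, y). \<phi> (inv\<^bsub>G\<^esub> t) x = y),
      comp = (\<lambda>(t, x) (s, y). (t \<otimes>\<^bsub>G\<^esub> s, x)),
      ginv = (\<lambda>(t, x). (inv\<^bsub>G\<^esub> t, \<phi> (inv\<^bsub>G\<^esub> t) x))\<rparr>"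


section \<open>The boundary path space\<close>

text \<open>The edge \<open>e\<^sup>\<alpha>\<^sub>\<eta>\<close> is the pair \<open>(\<alpha>, \<eta>)\<close>. \<open>Vertex \<xi>\<close> is a path of length 0,
  \<open>FinPath es\<close> (with \<open>es \<noteq> []\<close>) a finite path of positive length, and \<open>InfPath f\<close> the infinite
  path with edges \<open>f 0, f 1, \<dots>\<close>.\<close>

type_synonym ('l, 'b) edge = "'l \<times> 'b set"

datatype ('l, 'b) gpath =
    Vertex "'b set"
  | FinPath "('l, 'b) edge list"
  | InfPath "nat \<Rightarrow> ('l, 'b) edge"

fun plength :: "('l, 'b) gpath \<Rightarrow> enat" where
  "plength (Vertex v) = 0"
| "plength (FinPath es) = enat (length es)"
| "plength (InfPath f) = \<infinity>"

fun initial_edges :: "nat \<Rightarrow> ('l, 'b) gpath \<Rightarrow> ('l, 'b) edge list" where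
  "initial_edges n (Vertex v) = []"
| "initial_edges n (FinPath es) = take n es"
| "initial_edges n (InfPath f) = map f [0..<n]"

fun prepend :: "('l, 'b) edge list \<Rightarrow> ('l, 'b) gpath \<Rightarrow> ('l, 'b) gpath" where
  "prepend es (Vertex v) = (if es = [] then Vertex v else FinPath es)"
| "prepend es (FinPath fs) = FinPath (es @ fs)"
| "prepend es (InfPath f) = InfPath (\<lambda>i. if i < length es then es ! i else f (i - length es))"

context generalized_boolean_dynamical_system
begin

definition E0 :: "'b set set" where
  "E0 = ba_ultrafilters UNIV"

definition Z0 :: "'b \<Rightarrow> 'b set set" where
  "Z0 A = {\<xi> \<in> E0. A \<in> \<xi>}"

definition E0_top :: "'b set topology" where
  "E0_top = topology_generated_by (range Z0)"

definition F0 :: "'b set set" where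
  "F0 = insert {} E0"

text \<open>The second branch transports the one-point compactification, whose point at infinity is
  \<open>None\<close>, to \<open>F0\<close>, where it is \<open>{}\<close>.\<close>

definition F0_top :: "'b set topology" where
  "F0_top = (if \<exists>T::'b. \<forall>A. A \<le> T then topology_generated_by (insert {{}} (range Z0))
     else pullback_topology F0 (\<lambda>\<xi>. if \<xi> = {} then None else Some \<xi>)
            (Alexandroff_compactification E0_top))"

definition E1 :: "('l, 'b) edge set" where
  "E1 = {(a, \<eta>). a \<in> L \<and> \<eta> \<in> ba_ultrafilters (I a)}"

definition Z1 :: "'l \<Rightarrow> 'b \<Rightarrow> ('l, 'b) edge set" where
  "Z1 a B = {(a, \<eta>) | \<eta>. \<eta> \<in> ba_ultrafilters (I a) \<and> B \<in> \<eta>}"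

definition E1_top :: "('l, 'b) edge topology" where
  "E1_top = topology_generated_by {Z1 a B | a B. a \<in> L \<and> B \<in> I a}"

fun edge_d :: "('l, 'b) edge \<Rightarrow> 'b set" where
  "edge_d (a, \<eta>) = {C. \<exists>A\<in>\<eta>. A \<le> C}"

fun edge_r :: "('l, 'b) edge \<Rightarrow> 'b set" where
  "edge_r (a, \<eta>) = {A. \<theta> a A \<in> \<eta>}"

text \<open>\<open>En n\<close> is meant for \<open>n \<ge> 1\<close>; its topology is the subspace topology of the \<open>n\<close>-fold
  product.\<close>

definition En :: "nat \<Rightarrow> ('l, 'b) edge list set" where
  "En n = {es. length es = n \<and> set es \<subseteq> E1 \<and>
             (\<forall>i. Suc i < n \<longrightarrow> edge_d (es ! i) = edge_r (es ! Suc i))}"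

definition En_top :: "nat \<Rightarrow> ('l, 'b) edge list topology" where
  "En_top n = pullback_topology (En n) (\<lambda>es. restrict ((!) es) {..<n})
                (product_topology (\<lambda>_. E1_top) {..<n})"

definition Estar :: "('l, 'b) gpath set" where
  "Estar = Vertex ` E0 \<union> (\<Union>n\<in>{1..}. FinPath ` En n)"

definition Estar_open :: "('l, 'b) gpath set \<Rightarrow> bool" where
  "Estar_open S \<longleftrightarrow> S \<subseteq> Estar \<and> openin E0_top (Vertex -` S) \<and>
     (\<forall>n\<ge>1. openin (En_top n) (FinPath -` S \<inter> {es. length es = n}))"

definition Estar_top :: "('l, 'b) gpath topology" where
  "Estar_top = topology Estar_open"

lemma istopology_Estar_open: "istopology Estar_open"
  unfolding istopology_def
proof (intro conjI allI impI)
  fix S T assume "Estar_open S" "Estar_open T"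
  moreover have "FinPath -` (S \<inter> T) \<inter> {es. length es = n} =
      (FinPath -` S \<inter> {es. length es = n}) \<inter> (FinPath -` T \<inter> {es. length es = n})" for n
    by auto
  ultimately show "Estar_open (S \<inter> T)"
    by (auto simp: Estar_open_def)
next
  fix K assume "\<forall>S\<in>K. Estar_open S"
  then have K: "S \<subseteq> Estar" "openin E0_top (Vertex -` S)"
      "n \<ge> 1 \<Longrightarrow> openin (En_top n) (FinPath -` S \<inter> {es. length es = n})"
    if "S \<in> K" for S n
    using that unfolding Estar_open_def by blast+
  have "openin E0_top (Vertex -` (\<Union>K))"
    unfolding vimage_Union using K(2) by (intro openin_Union) blast
  moreover have "openin (En_top n) (FinPath -` (\<Union>K) \<inter> {es. length es = n})" if "n \<ge> 1" for n
  proof -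
    have "FinPath -` (\<Union>K) \<inter> {es. length es = n} =
        \<Union>((\<lambda>S. FinPath -` S \<inter> {es. length es = n}) ` K)"
      by blast
    then show ?thesis
      using K(3) that by (metis (no_types, lifting) imageE openin_Union)
  qed
  ultimately show "Estar_open (\<Union>K)"
    using K(1) unfolding Estar_open_def by blast
qed

lemma openin_Estar_top: "openin Estar_top S \<longleftrightarrow> Estar_open S"
  unfolding Estar_top_def by (simp add: istopology_Estar_open)

definition Einf :: "('l, 'b) gpath set" where
  "Einf = {InfPath f | f. \<forall>i. f i \<in> E1 \<and> edge_d (f i) = edge_r (f (Suc i))}"

fun path_r :: "('l, 'b) gpath \<Rightarrow> 'b set" where
  "path_r (Vertex v) = v"
| "path_r (FinPath es) = edge_r (hd es)"
| "path_r (InfPath f) = edge_r (f 0)"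

text \<open>The domain map is used for finite paths only.\<close>

fun path_d :: "('l, 'b) gpath \<Rightarrow> 'b set" where
  "path_d (Vertex v) = v"
| "path_d (FinPath es) = edge_d (last es)"
| "path_d (InfPath f) = undefined"

definition F0_sce :: "'b set set" where
  "F0_sce = F0 - F0_top closure_of (edge_r ` E1)"

definition F0_fin :: "'b set set" where
  "F0_fin = {v \<in> F0. \<exists>V \<subseteq> F0. (\<exists>W. openin F0_top W \<and> v \<in> W \<and> W \<subseteq> V) \<and>
               compactin E1_top {e \<in> E1. edge_r e \<in> V}}"

definition F0_rg :: "'b set set" where
  "F0_rg = F0_fin - F0_top closure_of F0_sce"

definition F0_sg :: "'b set set" where
  "F0_sg = F0 - F0_rg"

definition E0_sg :: "'b set set" where
  "E0_sg = F0_sg \<inter> E0"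

definition boundary :: "('l, 'b) gpath set" where
  "boundary = Einf \<union> {\<mu> \<in> Estar. path_d \<mu> \<in> E0_sg}"

definition ZZ :: "('l, 'b) gpath set \<Rightarrow> ('l, 'b) gpath set" where
  "ZZ S = {\<mu> \<in> boundary. Vertex (path_r \<mu>) \<in> S \<or>
             (\<exists>i. 1 \<le> i \<and> enat i \<le> plength \<mu> \<and> FinPath (initial_edges i \<mu>) \<in> S)}"

definition boundary_top :: "('l, 'b) gpath topology" where
  "boundary_top = topology_generated_by
     {ZZ S \<inter> (boundary - ZZ K) | S K. openin Estar_top S \<and> compactin Estar_top K}"


section \<open>The partial action of the free group\<close>

fun Iw :: "'l list \<Rightarrow> 'b set" where
  "Iw [] = UNIV"
| "Iw (a # \<alpha>) = {A. \<exists>B\<in>I a. A \<le> \<theta>w \<alpha> B}"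

definition Wstar :: "'l list set" where
  "Wstar = {\<alpha>. set \<alpha> \<subseteq> L \<and> Iw \<alpha> \<noteq> {bot}}"

text \<open>The unreduced group word for \<open>\<alpha>\<close> times the inverse of \<open>\<beta>\<close>. For a word \<open>t\<close> which is a
  reduced such product, \<open>num t\<close> and \<open>den t\<close> recover \<open>\<alpha>\<close> and \<open>\<beta>\<close>.\<close>

definition quot :: "'l list \<Rightarrow> 'l list \<Rightarrow> 'l gword" where
  "quot \<alpha> \<beta> = map (\<lambda>a. (a, True)) \<alpha> @ map (\<lambda>b. (b, False)) (rev \<beta>)"

definition num :: "'l gword \<Rightarrow> 'l list" where
  "num t = map fst (takeWhile snd t)"

definition den :: "'l gword \<Rightarrow> 'l list" where
  "den t = rev (map fst (dropWhile snd t))"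

text \<open>In the third case, \<open>map fst (initial_edges (length \<alpha>) \<mu>) = \<alpha>\<close> entails that \<open>\<mu>\<close> has
  length at least \<open>length \<alpha>\<close>.\<close>

definition U :: "'l gword \<Rightarrow> ('l, 'b) gpath set" where
  "U t = (let \<alpha> = num t; \<beta> = den t in
     if t = [] then boundary
     else if t \<in> carrier (free_group L) \<and> t = quot \<alpha> \<beta> \<and> \<alpha> \<in> Wstar \<and> \<beta> \<in> Wstar \<and>
             Iw \<alpha> \<inter> Iw \<beta> \<noteq> {bot}
     then (if \<alpha> = [] then {\<mu> \<in> boundary. path_r \<mu> \<inter> Iw \<beta> \<noteq> {}}
           else {\<mu> \<in> boundary. map fst (initial_edges (length \<alpha>) \<mu>) = \<alpha> \<and>
                   snd (last (initial_edges (length \<alpha>) \<mu>)) \<inter> Iw \<beta> \<noteq> {}})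
     else {})"

text \<open>The edges with label word \<open>\<alpha>\<close> leading to the vertex \<open>v\<close>: the last filter is
  \<open>v \<inter> I a\<close>, and each earlier one is the range of its successor intersected with the ideal.\<close>

fun edges_to :: "'l list \<Rightarrow> 'b set \<Rightarrow> ('l, 'b) edge list" where
  "edges_to [] v = []"
| "edges_to [a] v = [(a, v \<inter> I a)]"
| "edges_to (a # b # \<alpha>) v =
     (let es = edges_to (b # \<alpha>) v in (a, {A. \<theta> b A \<in> snd (hd es)} \<inter> I a) # es)"

text \<open>Removes the first \<open>n\<close> edges of a path of length at least \<open>n\<close>.\<close>

fun drop_edges :: "nat \<Rightarrow> ('l, 'b) gpath \<Rightarrow> ('l, 'b) gpath" where
  "drop_edges n (Vertex v) = Vertex v"
| "drop_edges n (FinPath es) =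
     (if n < length es then FinPath (drop n es) else Vertex (edge_d (last es)))"
| "drop_edges n (InfPath f) = InfPath (\<lambda>i. f (n + i))"

definition \<phi> :: "'l gword \<Rightarrow> ('l, 'b) gpath \<Rightarrow> ('l, 'b) gpath" where
  "\<phi> t \<mu> = (let \<alpha> = num t; \<beta> = den t;
       v = (if \<beta> = [] then path_r \<mu> else edge_d (last (initial_edges (length \<beta>) \<mu>)))
     in if t = [] then \<mu> else prepend (edges_to \<alpha> v) (drop_edges (length \<beta>) \<mu>))"

definition \<Phi>_topologically_free :: bool where
  "\<Phi>_topologically_free \<longleftrightarrow> topologically_free (free_group L) boundary_top U \<phi>"

definition \<Phi>_groupoid :: "('l gword \<times> ('l, 'b) gpath) top_groupoid" where
  "\<Phi>_groupoid = transformation_groupoid (free_group L) boundary_top U \<phi>"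

end

end

theory Submission
  imports Defs
begin

text \<open>
  Write \<open>\<sigma>\<close> for the shift that removes the first edge of a boundary path.  If a group element
  \<open>\<alpha>\<beta>\<^sup>-\<^sup>1\<close> other than the identity fixes a boundary path \<open>\<mu>\<close>, then the label word of \<open>\<mu>\<close> begins both
  with \<open>\<alpha>\<close> and with \<open>\<beta>\<close>, so the two words have different lengths and the shifts of \<open>\<mu>\<close> by these
  lengths agree (\<open>fixed_point_eventually_periodic\<close>).  Hence paths with non-trivial isotropy are
  infinite and eventually periodic, and everything is about the density of the other paths.

  The proof establishes the circle of implications from Condition (L) to topological
  principality, to topological freeness, and back to Condition (L), together with the equivalence
  of topological freeness and effectiveness.  The second implication and the equivalence hold for
  every transformation groupoid over open sets \<open>U t\<close>: the isotropy bundle restricted to \<open>{t}\<close> is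
  the fixed point set of the inverse of \<open>t\<close>, so an open set of fixed points is the same thing as
  an open set of non-unit isotropy.

  From topological freeness to Condition (L): over a cycle \<open>(\<alpha>, A)\<close> without exits a boundary path
  cannot stop, because a vertex containing a regular element is a regular vertex
  (\<open>regular_in_F0_rg\<close>), and it has no choice of labels.  Its labels are \<open>\<alpha>\<alpha>\<alpha>\<dots>\<close>, and its
  vertices recur because \<open>\<alpha>\<close> acts trivially below \<open>A\<close>.  So the inverse of \<open>\<alpha>\<close> fixes the non-empty
  open set of all boundary paths whose range contains \<open>A\<close>.

  From Condition (L) to topological principality: let \<open>P k m\<close> be the set of infinite paths with
  \<open>\<sigma>\<^sup>k\<^sup>+\<^sup>m \<mu> = \<sigma>\<^sup>k \<mu>\<close>.  No \<open>P k m\<close> contains a non-empty cylinder, since the base of the cylinder would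
  carry a cycle without exits (\<open>periodic_cylinder_gives_cycle\<close>).  In the manner of the Baire
  category theorem one therefore finds, inside an open set without finite paths, a decreasing
  sequence of cylinders that avoid the countably many sets \<open>P k m\<close> one after the other.  In place
  of a compactness theorem for the path space, an ultralimit of points of these cylinders gives a
  path in their intersection (\<open>nested_cylinders_intersect\<close>).

  Two facts connect the topology with the algebra.  Every vertex is the range of a boundary path
  (\<open>boundary_path_from\<close>), because regular vertices receive edges; and the cylinders around an
  infinite path form a neighbourhood base at it (\<open>boundary_top_neighborhood\<close>).
\<close>


section \<open>Filters and ultrafilters relative to an ideal\<close>

subclass (in relative_boolean_algebra) bounded_lattice_bot ..

context relative_boolean_algebra
begin

lemma diff_le: "a - b \<le> a"
  by (metis sup_diff_inf sup.cobounded1)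

lemma le_diff_iff: "x \<le> a - b \<longleftrightarrow> x \<le> a \<and> inf x b = bot"
proof
  assume "x \<le> a - b"
  then show "x \<le> a \<and> inf x b = bot"
    by (metis bot_unique diff_le inf_diff_bot inf_mono order.refl order.trans)
next
  assume x: "x \<le> a \<and> inf x b = bot"
  have "x = inf x (sup (a - b) (inf a b))"
    using x by (simp add: sup_diff_inf inf_absorb1)
  also have "\<dots> = sup (inf x (a - b)) (inf x (inf a b))"
    by (rule inf_sup_distrib1)
  also have "inf x (inf a b) = bot"
    using x by (metis inf_absorb1 inf_assoc)
  finally show "x \<le> a - b"
    by (metis inf.cobounded2 sup_bot_right)
qed

lemma diff_mono_left: "a \<le> c \<Longrightarrow> a - b \<le> c - b"
  using diff_le[of a b] inf_diff_bot[of a b] by (auto simp: le_diff_iff)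

lemma diff_eq_bot_iff: "a - b = bot \<longleftrightarrow> a \<le> b"
proof
  assume "a - b = bot"
  then show "a \<le> b" by (metis sup_diff_inf sup_bot_left inf.cobounded2)
next
  assume "a \<le> b"
  then show "a - b = bot" by (metis diff_le inf.absorb1 inf_diff_bot order.trans)
qed

lemma diff_diff_eq_inf: "a - (a - b) = inf a b"
proof (rule order.antisym)
  let ?x = "a - (a - b)"
  have "?x = inf ?x (sup (a - b) (inf a b))"
    using diff_le by (simp add: sup_diff_inf inf_absorb1)
  also have "\<dots> = sup (inf ?x (a - b)) (inf ?x (inf a b))"
    by (rule inf_sup_distrib1)
  finally show "?x \<le> inf a b"
    by (metis inf.cobounded2 inf_diff_bot sup_bot_left)
  have "inf (inf a b) (a - b) \<le> inf (a - b) b"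
    by (simp add: le_infI1)
  then show "inf a b \<le> a - (a - b)"
    by (simp add: le_diff_iff inf_diff_bot bot_unique)
qed

end

lemma ba_ideal_UNIV: "ba_ideal UNIV"
  by (auto simp: ba_ideal_def)

lemma ba_ideal_downward: "ba_ideal J \<Longrightarrow> A \<in> J \<Longrightarrow> B \<le> A \<Longrightarrow> B \<in> J"
  unfolding ba_ideal_def by blast

lemma ba_ideal_diff: "ba_ideal J \<Longrightarrow> A \<in> J \<Longrightarrow> A - B \<in> J"
  using ba_ideal_downward diff_le by blast

lemma ba_ideal_inf: "ba_ideal J \<Longrightarrow> A \<in> J \<Longrightarrow> inf A B \<in> J"
  using ba_ideal_downward inf.cobounded1 by blast

lemma ba_filterD:
  assumes "ba_filter J F"
  shows "F \<subseteq> J" "F \<noteq> {}" "bot \<notin> F" "A \<in> F \<Longrightarrow> B \<in> J \<Longrightarrow> A \<le> B \<Longrightarrow> B \<in> F"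
proof -
  have "F \<subseteq> J \<and> F \<noteq> {} \<and> bot \<notin> F \<and> (\<forall>A\<in>F. \<forall>B\<in>J. A \<le> B \<longrightarrow> B \<in> F)"
    using assms by (simp add: ba_filter_def)
  then show "F \<subseteq> J" "F \<noteq> {}" "bot \<notin> F" "A \<in> F \<Longrightarrow> B \<in> J \<Longrightarrow> A \<le> B \<Longrightarrow> B \<in> F"
    by simp_all
qed

lemma ba_filter_inf:
  assumes "ba_ideal J" "ba_filter J F" "A \<in> F" "B \<in> F"
  shows "inf A B \<in> F"
proof -
  obtain C where "C \<in> F" "C \<le> A" "C \<le> B" using assms unfolding ba_filter_def by blast
  moreover have "inf A B \<in> J" using assms ba_filterD(1) ba_ideal_inf by blast
  ultimately show ?thesis using ba_filterD(4)[OF assms(2)] by simp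
qed

text \<open>If \<open>inf X A\<close> is not in \<open>F\<close>, then the differences \<open>C - A\<close> with \<open>C \<in> F\<close> are non-zero and
  generate a filter that contains both \<open>F\<close> and \<open>X - A\<close>.\<close>

lemma ultrafilter_inf_or_diff:
  assumes J: "ba_ideal J" and F: "F \<in> ba_ultrafilters J" and X: "X \<in> F"
  shows "inf X A \<in> F \<or> X - A \<in> F"
proof (rule ccontr)
  assume neg: "\<not> (inf X A \<in> F \<or> X - A \<in> F)"
  have f: "ba_filter J F" using F unfolding ba_ultrafilters_def by blast
  define G where "G = {B \<in> J. \<exists>C\<in>F. C - A \<le> B}"
  have "C - A \<noteq> bot" if "C \<in> F" for C
  proof
    assume "C - A = bot"
    then have "C \<le> A" by (simp add: diff_eq_bot_iff)
    then have "inf X C \<le> inf X A" by (simp add: le_infI2)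
    moreover have "inf X C \<in> F" using ba_filter_inf[OF J f X that] .
    moreover have "inf X A \<in> J" using f X J ba_filterD(1) ba_ideal_inf by blast
    ultimately show False using neg ba_filterD(4)[OF f] by blast
  qed
  then have nb: "bot \<notin> G" by (auto simp: G_def bot_unique)
  have sub: "F \<subseteq> G" using ba_filterD(1)[OF f] diff_le by (auto simp: G_def)
  have dir: "\<exists>C\<in>G. C \<le> B \<and> C \<le> B'" if "B \<in> G" "B' \<in> G" for B B'
  proof -
    obtain C C' where C: "C \<in> F" "C - A \<le> B" "C' \<in> F" "C' - A \<le> B'"
      using \<open>B \<in> G\<close> \<open>B' \<in> G\<close> by (auto simp: G_def)
    have i: "inf C C' \<in> F" using C ba_filter_inf[OF J f] by blast
    have 1: "inf C C' - A \<le> C - A" by (simp add: diff_mono_left)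
    have 2: "inf C C' - A \<le> C' - A" by (simp add: diff_mono_left)
    have "inf C C' - A \<in> G" using i ba_filterD(1)[OF f] J by (auto simp: G_def ba_ideal_diff)
    then show ?thesis using 1 2 C order.trans by blast
  qed
  have "ba_filter J G"
    unfolding ba_filter_def
  proof (intro conjI)
    show "G \<subseteq> J" "\<forall>A\<in>G. \<forall>B\<in>J. A \<le> B \<longrightarrow> B \<in> G" by (auto simp: G_def intro: order.trans)
    show "G \<noteq> {}" using sub X by auto
  qed (use nb dir in auto)
  then have "G = F" using F sub unfolding ba_ultrafilters_def by blast
  moreover have "X - A \<in> G" using X ba_filterD(1)[OF f] J by (auto simp: G_def ba_ideal_diff)
  ultimately show False using neg by simp
qed

text \<open>Restrictions, upward extensions, preimages and limits of ultrafilters are recognised as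
  ultrafilters by this criterion.\<close>

lemma prime_filter_ultrafilter:
  assumes J: "ba_ideal J" and f: "ba_filter J F"
    and prime: "\<And>X A. X \<in> F \<Longrightarrow> A \<in> J \<Longrightarrow> inf X A \<in> F \<or> X - A \<in> F"
  shows "F \<in> ba_ultrafilters J"
  unfolding ba_ultrafilters_def
proof (intro CollectI conjI allI impI f)
  fix G assume "ba_filter J G \<and> F \<subseteq> G"
  then have G: "ba_filter J G" "F \<subseteq> G" by blast+
  obtain X where X: "X \<in> F" using ba_filterD(2)[OF f] by blast
  have "A \<in> F" if A: "A \<in> G" for A
  proof (rule ccontr)
    assume "A \<notin> F"
    have AJ: "A \<in> J" using A ba_filterD(1)[OF G(1)] by blast
    have "inf X A \<notin> F" using \<open>A \<notin> F\<close> ba_filterD(4)[OF f _ AJ inf.cobounded2] by blast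
    then have "X - A \<in> G" using prime[OF X AJ] G(2) by blast
    then have "inf (X - A) A \<in> G" using ba_filter_inf[OF J G(1)] A by blast
    then show False using ba_filterD(3)[OF G(1)] by (simp add: inf_diff_bot)
  qed
  then show "G = F" using G(2) by blast
qed

lemma filter_extends_to_ultrafilter:
  assumes J: "ba_ideal J" and f: "ba_filter J F"
  shows "\<exists>G\<in>ba_ultrafilters J. F \<subseteq> G"
proof -
  define S where "S = {G. ba_filter J G \<and> F \<subseteq> G}"
  have "\<exists>M\<in>S. \<forall>X\<in>S. M \<subseteq> X \<longrightarrow> X = M"
  proof (rule subset_Zorn_nonempty)
    show "S \<noteq> {}" using f by (auto simp: S_def)
    fix C assume C: "C \<noteq> {}" "subset.chain S C"
    have fil: "ba_filter J G" "F \<subseteq> G" if "G \<in> C" for G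
      using C that by (auto simp: subset.chain_def S_def)
    have dir: "\<exists>D\<in>\<Union>C. D \<le> A \<and> D \<le> B" if A: "A \<in> \<Union>C" and B: "B \<in> \<Union>C" for A B
    proof -
      obtain G H where GH: "G \<in> C" "H \<in> C" "A \<in> G" "B \<in> H" using A B by blast
      then have "G \<subseteq> H \<or> H \<subseteq> G" using C by (auto simp: subset.chain_def)
      then have "inf A B \<in> G \<or> inf A B \<in> H"
        using ba_filter_inf[OF J fil(1)[OF GH(1)], of A B] ba_filter_inf[OF J fil(1)[OF GH(2)], of A B]
          GH(3,4) by blast
      then have "inf A B \<in> \<Union>C" using GH(1,2) by blast
      then show ?thesis by (intro bexI[of _ "inf A B"]) simp_all
    qed
    have up: "B \<in> \<Union>C" if AB: "A \<in> \<Union>C" "B \<in> J" "A \<le> B" for A B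
    proof -
      obtain G where G: "G \<in> C" "A \<in> G" using AB(1) by blast
      then show ?thesis using ba_filterD(4)[OF fil(1)[OF G(1)] G(2) AB(2,3)] by blast
    qed
    have "\<Union>C \<subseteq> J" "bot \<notin> \<Union>C"
      using ba_filterD(1,3)[OF fil(1)] by blast+
    moreover have "F \<subseteq> \<Union>C" using fil(2) C(1) by blast
    moreover from this have "\<Union>C \<noteq> {}" using ba_filterD(2)[OF f] by blast
    ultimately
    show "\<Union>C \<in> S" unfolding S_def ba_filter_def using dir up by blast
  qed
  then obtain M where M: "M \<in> S" "\<And>X. X \<in> S \<Longrightarrow> M \<subseteq> X \<Longrightarrow> X = M" by blast
  have "G = M" if "ba_filter J G" "M \<subseteq> G" for G
  proof (rule M(2))
    show "G \<in> S" using M(1) that unfolding S_def by fast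
  qed (rule that(2))
  then have "M \<in> ba_ultrafilters J" using M(1) unfolding ba_ultrafilters_def S_def by fast
  then show ?thesis using M(1) by (intro bexI[of _ M]) (simp_all add: S_def)
qed

lemma ultrafilter_filter: "F \<in> ba_ultrafilters J \<Longrightarrow> ba_filter J F"
  unfolding ba_ultrafilters_def by blast

lemmas ultrafilter_subset = ba_filterD(1)[OF ultrafilter_filter]
  and ultrafilter_nonempty = ba_filterD(2)[OF ultrafilter_filter]
  and ultrafilter_bot = ba_filterD(3)[OF ultrafilter_filter]
  and ultrafilter_up = ba_filterD(4)[OF ultrafilter_filter]
  and ultrafilter_inf = ba_filter_inf[OF _ ultrafilter_filter]

lemma ultrafilter_diff:
  assumes "ba_ideal J" "F \<in> ba_ultrafilters J" "X \<in> F" "A \<in> J" "A \<notin> F"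
  shows "X - A \<in> F"
  using assms ultrafilter_inf_or_diff ultrafilter_up inf.cobounded2 by metis

lemma ultrafilter_eq_of_subset:
  "F \<in> ba_ultrafilters J \<Longrightarrow> G \<in> ba_ultrafilters J \<Longrightarrow> F \<subseteq> G \<Longrightarrow> F = G"
  unfolding ba_ultrafilters_def by blast

lemma ultrafilter_disjoint:
  assumes "ba_ideal J" "F \<in> ba_ultrafilters J" "A \<in> F" "B \<in> F"
  shows "inf A B \<noteq> bot"
  using ultrafilter_inf[OF assms] ultrafilter_bot[OF assms(2)] by metis

lemma filter_base_extends_to_ultrafilter:
  assumes J: "ba_ideal J" and S: "S \<subseteq> J" "S \<noteq> {}" "bot \<notin> S"
    and dir: "\<And>A B. A \<in> S \<Longrightarrow> B \<in> S \<Longrightarrow> \<exists>C\<in>S. C \<le> A \<and> C \<le> B"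
  shows "\<exists>F\<in>ba_ultrafilters J. S \<subseteq> F"
proof -
  define F where "F = {B \<in> J. \<exists>A\<in>S. A \<le> B}"
  have "ba_filter J F"
    unfolding ba_filter_def
  proof (intro conjI)
    show "F \<subseteq> J" "\<forall>A\<in>F. \<forall>B\<in>J. A \<le> B \<longrightarrow> B \<in> F" by (auto simp: F_def intro: order.trans)
    show "bot \<notin> F" using S(3) by (auto simp: F_def bot_unique)
    show "F \<noteq> {}" using S by (auto simp: F_def)
    show "\<forall>A\<in>F. \<forall>B\<in>F. \<exists>C\<in>F. C \<le> A \<and> C \<le> B"
    proof (intro ballI)
      fix A B assume "A \<in> F" "B \<in> F"
      then obtain A' B' where "A' \<in> S" "B' \<in> S" "A' \<le> A" "B' \<le> B" by (auto simp: F_def)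
      moreover obtain C where "C \<in> S" "C \<le> A'" "C \<le> B'" using dir calculation by blast
      ultimately show "\<exists>C\<in>F. C \<le> A \<and> C \<le> B" using S(1) by (auto simp: F_def intro: order.trans)
    qed
  qed
  then obtain G where "G \<in> ba_ultrafilters J" "F \<subseteq> G"
    using filter_extends_to_ultrafilter[OF J] by blast
  moreover have "S \<subseteq> F" using S(1) by (auto simp: F_def)
  ultimately show ?thesis by blast
qed

lemma ultrafilter_containing:
  assumes "ba_ideal J" "A \<in> J" "A \<noteq> bot"
  shows "\<exists>F\<in>ba_ultrafilters J. A \<in> F"
  using filter_base_extends_to_ultrafilter[OF assms(1), of "{A}"] assms by auto

text \<open>Restriction to an ideal and generation of an upper set are mutually inverse between the
  ultrafilters of the whole algebra that meet the ideal and the ultrafilters of the ideal.  This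
  is why an edge is determined by its label and its domain vertex.\<close>

lemma ultrafilter_restrict:
  assumes J: "ba_ideal J" and F: "F \<in> ba_ultrafilters UNIV" and ne: "F \<inter> J \<noteq> {}"
  shows "F \<inter> J \<in> ba_ultrafilters J"
proof (rule prime_filter_ultrafilter[OF J])
  note U = ba_ideal_UNIV
  show "ba_filter J (F \<inter> J)"
    unfolding ba_filter_def
  proof (intro conjI)
    show "\<forall>A\<in>F \<inter> J. \<forall>B\<in>F \<inter> J. \<exists>C\<in>F \<inter> J. C \<le> A \<and> C \<le> B"
    proof (intro ballI)
      fix A B assume "A \<in> F \<inter> J" "B \<in> F \<inter> J"
      then have "inf A B \<in> F \<inter> J" using ultrafilter_inf[OF U F] ba_ideal_inf[OF J] by blast
      then show "\<exists>C\<in>F \<inter> J. C \<le> A \<and> C \<le> B" by (intro bexI[of _ "inf A B"]) simp_all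
    qed
  qed (use ne ultrafilter_bot[OF F] ultrafilter_up[OF F] in auto)
  show "inf X A \<in> F \<inter> J \<or> X - A \<in> F \<inter> J" if "X \<in> F \<inter> J" for X A
    using ultrafilter_inf_or_diff[OF U F, of X A] that ba_ideal_inf[OF J] ba_ideal_diff[OF J] by blast
qed

lemma ultrafilter_extend:
  assumes J: "ba_ideal J" and F: "F \<in> ba_ultrafilters J"
  shows "{C. \<exists>A\<in>F. A \<le> C} \<in> ba_ultrafilters UNIV"
proof (rule prime_filter_ultrafilter[OF ba_ideal_UNIV])
  let ?E = "{C. \<exists>A\<in>F. A \<le> C}"
  have dir: "inf A B \<in> ?E" if "A \<in> ?E" "B \<in> ?E" for A B
  proof -
    obtain A' B' where "A' \<in> F" "A' \<le> A" "B' \<in> F" "B' \<le> B" using \<open>A \<in> ?E\<close> \<open>B \<in> ?E\<close> by blast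
    then show ?thesis using ultrafilter_inf[OF J F] inf_mono by blast
  qed
  show "ba_filter UNIV ?E"
    unfolding ba_filter_def
  proof (intro conjI)
    show "\<forall>A\<in>?E. \<forall>B\<in>?E. \<exists>C\<in>?E. C \<le> A \<and> C \<le> B"
    proof (intro ballI)
      fix A B assume "A \<in> ?E" "B \<in> ?E"
      then show "\<exists>C\<in>?E. C \<le> A \<and> C \<le> B" using dir by (intro bexI[of _ "inf A B"]) simp_all
    qed
    show "?E \<noteq> {}" using ultrafilter_nonempty[OF F] by auto
    show "bot \<notin> ?E" using ultrafilter_bot[OF F] by (auto simp: bot_unique)
  qed (auto intro: order.trans)
  fix X A assume "X \<in> ?E"
  then obtain B where B: "B \<in> F" "B \<le> X" by blast
  have "inf B A \<le> inf X A" "B - A \<le> X - A"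
    using B(2) by (auto simp: le_infI1 diff_mono_left)
  then show "inf X A \<in> ?E \<or> X - A \<in> ?E"
    using ultrafilter_inf_or_diff[OF J F B(1), of A] by blast
qed

lemma ultrafilter_extend_restrict:
  assumes "ba_ideal J" "F \<in> ba_ultrafilters J"
  shows "{C. \<exists>A\<in>F. A \<le> C} \<inter> J = F"
  using ultrafilter_up[OF assms(2)] ultrafilter_subset[OF assms(2)] by blast

text \<open>The preimage may be empty, as an action need not reach the ultrafilter; this is the case
  of an edge whose range is the extra point of \<open>F0\<close>.\<close>

lemma ultrafilter_preimage:
  assumes J: "ba_ideal J" and F: "F \<in> ba_ultrafilters J" and act: "ba_action h"
    and h: "range h \<subseteq> J" and ne: "{A. h A \<in> F} \<noteq> {}"
  shows "{A. h A \<in> F} \<in> ba_ultrafilters UNIV"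
proof (rule prime_filter_ultrafilter[OF ba_ideal_UNIV])
  have hom: "h bot = bot" "h (inf A B) = inf (h A) (h B)" "h (A - B) = h A - h B" for A B
    using act by (auto simp: ba_action_def)
  have mono: "h A \<le> h B" if "A \<le> B" for A B
    using hom(2)[of A B] that by (metis inf.orderE inf.orderI)
  show "ba_filter UNIV {A. h A \<in> F}"
    unfolding ba_filter_def
  proof (intro conjI)
    show "\<forall>A\<in>{A. h A \<in> F}. \<forall>B\<in>{A. h A \<in> F}. \<exists>C\<in>{A. h A \<in> F}. C \<le> A \<and> C \<le> B"
    proof (intro ballI)
      fix A B assume "A \<in> {A. h A \<in> F}" "B \<in> {A. h A \<in> F}"
      then have "inf A B \<in> {A. h A \<in> F}" using ultrafilter_inf[OF J F] hom(2) by simp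
      then show "\<exists>C\<in>{A. h A \<in> F}. C \<le> A \<and> C \<le> B" by (intro bexI[of _ "inf A B"]) simp_all
    qed
    show "\<forall>A\<in>{A. h A \<in> F}. \<forall>B\<in>UNIV. A \<le> B \<longrightarrow> B \<in> {A. h A \<in> F}"
      using ultrafilter_up[OF F] mono h by blast
  qed (use ne ultrafilter_bot[OF F] hom(1) in auto)
  show "inf X A \<in> {A. h A \<in> F} \<or> X - A \<in> {A. h A \<in> F}" if "X \<in> {A. h A \<in> F}" for X A
    using ultrafilter_inf_or_diff[OF J F, of "h X" "h A"] that by (simp add: hom)
qed

section \<open>Actions, edges and their end vertices\<close>

context boolean_dynamical_system
begin

lemma \<theta>w_Nil [simp]: "\<theta>w [] A = A"
  and \<theta>w_Cons [simp]: "\<theta>w (a # \<alpha>) A = \<theta>w \<alpha> (\<theta> a A)"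
  and \<theta>w_append: "\<theta>w (\<alpha> @ \<beta>) A = \<theta>w \<beta> (\<theta>w \<alpha> A)"
  by (simp_all add: \<theta>w_def)

lemma \<theta>_hom:
  assumes "a \<in> L"
  shows "\<theta> a bot = bot" "\<theta> a (inf A B) = inf (\<theta> a A) (\<theta> a B)"
    "\<theta> a (sup A B) = sup (\<theta> a A) (\<theta> a B)" "\<theta> a (A - B) = \<theta> a A - \<theta> a B"
  using action[OF assms] by (simp_all add: ba_action_def)

lemma \<theta>_mono: "a \<in> L \<Longrightarrow> A \<le> B \<Longrightarrow> \<theta> a A \<le> \<theta> a B"
  using \<theta>_hom(2)[of a A B] by (simp add: inf.order_iff)

lemma \<theta>w_mono: "set \<alpha> \<subseteq> L \<Longrightarrow> A \<le> B \<Longrightarrow> \<theta>w \<alpha> A \<le> \<theta>w \<alpha> B"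
  by (induction \<alpha> arbitrary: A B) (simp_all add: \<theta>_mono)

end

text \<open>A family of sets that is directed downwards and refines the generators through a point
  refines every open set through that point.\<close>

lemma generated_topology_neighborhood_base:
  assumes "generate_topology_on S W" "x \<in> W"
    and base: "\<And>T. T \<in> S \<Longrightarrow> x \<in> T \<Longrightarrow> \<exists>B\<in>\<B>. B \<subseteq> T"
    and inter: "\<And>A B. A \<in> \<B> \<Longrightarrow> B \<in> \<B> \<Longrightarrow> \<exists>C\<in>\<B>. C \<subseteq> A \<and> C \<subseteq> B"
  shows "\<exists>B\<in>\<B>. B \<subseteq> W"
  using assms(1,2)
proof (induction)
  case (Int a b)
  then obtain A B where AB: "A \<in> \<B>" "A \<subseteq> a" "B \<in> \<B>" "B \<subseteq> b" by auto
  then obtain C where "C \<in> \<B>" "C \<subseteq> A" "C \<subseteq> B" using inter by metis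
  then show ?case using AB by (intro bexI[of _ C]) auto
next
  case (UN K)
  then obtain k where k: "k \<in> K" "x \<in> k" by auto
  then obtain B where "B \<in> \<B>" "B \<subseteq> k" using UN.IH by auto
  then show ?case using k by (intro bexI[of _ B]) auto
qed (auto intro: base)

context generalized_boolean_dynamical_system
begin

lemma \<theta>_in_I: "a \<in> L \<Longrightarrow> \<theta> a A \<in> I a"
  using range_subset by blast

lemma E1_iff: "e \<in> E1 \<longleftrightarrow> fst e \<in> L \<and> snd e \<in> ba_ultrafilters (I (fst e))"
  by (cases e) (simp add: E1_def)

lemma edge_d_alt: "edge_d e = {C. \<exists>A\<in>snd e. A \<le> C}"
  and edge_r_alt: "edge_r e = {A. \<theta> (fst e) A \<in> snd e}"
  by (cases e; simp)+

lemma edge_d_in_E0: "e \<in> E1 \<Longrightarrow> edge_d e \<in> E0"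
  unfolding edge_d_alt E0_def E1_iff using ultrafilter_extend ideal by blast

lemma edge_r_in_E0: "e \<in> E1 \<Longrightarrow> edge_r e \<noteq> {} \<Longrightarrow> edge_r e \<in> E0"
  unfolding edge_r_alt E0_def E1_iff
  using ultrafilter_preimage[OF ideal _ action range_subset] by blast

lemma edge_d_Int_I: "e \<in> E1 \<Longrightarrow> edge_d e \<inter> I (fst e) = snd e"
  unfolding edge_d_alt E1_iff using ultrafilter_extend_restrict ideal by blast

lemma snd_subset_edge_d: "A \<in> snd e \<Longrightarrow> A \<in> edge_d e"
  unfolding edge_d_alt by auto

lemma snd_edge_inf: "e \<in> E1 \<Longrightarrow> A \<in> snd e \<Longrightarrow> B \<in> snd e \<Longrightarrow> inf A B \<in> snd e"
  unfolding E1_iff using ultrafilter_inf ideal by blast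

lemma snd_edge_up: "e \<in> E1 \<Longrightarrow> A \<in> snd e \<Longrightarrow> A \<le> B \<Longrightarrow> B \<in> I (fst e) \<Longrightarrow> B \<in> snd e"
  unfolding E1_iff using ultrafilter_up by blast

lemma snd_edge_in_I: "e \<in> E1 \<Longrightarrow> A \<in> snd e \<Longrightarrow> A \<in> I (fst e)"
  unfolding E1_iff using ultrafilter_subset by blast

lemma snd_edge_diff: "e \<in> E1 \<Longrightarrow> X \<in> snd e \<Longrightarrow> A \<in> I (fst e) \<Longrightarrow> A \<notin> snd e \<Longrightarrow> X - A \<in> snd e"
  unfolding E1_iff using ultrafilter_diff[OF ideal] by blast

lemma edge_r_iff: "A \<in> edge_r e \<longleftrightarrow> \<theta> (fst e) A \<in> snd e"
  by (simp add: edge_r_alt)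

lemma E0_inf: "\<xi> \<in> E0 \<Longrightarrow> A \<in> \<xi> \<Longrightarrow> B \<in> \<xi> \<Longrightarrow> inf A B \<in> \<xi>"
  unfolding E0_def using ultrafilter_inf[OF ba_ideal_UNIV] by blast

lemma E0_up: "\<xi> \<in> E0 \<Longrightarrow> A \<in> \<xi> \<Longrightarrow> A \<le> B \<Longrightarrow> B \<in> \<xi>"
  unfolding E0_def using ultrafilter_up[of \<xi> UNIV A B] by blast

lemma E0_inf_iff: "\<xi> \<in> E0 \<Longrightarrow> inf A B \<in> \<xi> \<longleftrightarrow> A \<in> \<xi> \<and> B \<in> \<xi>"
  using E0_inf E0_up[of \<xi> "inf A B"] by (metis inf.cobounded1 inf.cobounded2)

lemma E0_bot: "\<xi> \<in> E0 \<Longrightarrow> A \<in> \<xi> \<Longrightarrow> A \<noteq> bot"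
  unfolding E0_def using ultrafilter_bot by blast

lemma E0_nonempty: "\<xi> \<in> E0 \<Longrightarrow> \<xi> \<noteq> {}"
  unfolding E0_def using ultrafilter_nonempty by blast

lemma E0_eq_of_subset: "\<xi> \<in> E0 \<Longrightarrow> \<zeta> \<in> E0 \<Longrightarrow> \<xi> \<subseteq> \<zeta> \<Longrightarrow> \<xi> = \<zeta>"
  unfolding E0_def by (rule ultrafilter_eq_of_subset)

lemma E0_containing: "A \<noteq> bot \<Longrightarrow> \<exists>\<xi>\<in>E0. A \<in> \<xi>"
  unfolding E0_def using ultrafilter_containing[OF ba_ideal_UNIV, of A] by blast

lemma edge_with_domain:
  assumes "\<xi> \<in> E0" "a \<in> L" "\<xi> \<inter> I a \<noteq> {}"
  shows "(a, \<xi> \<inter> I a) \<in> E1" "edge_d (a, \<xi> \<inter> I a) = \<xi>"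
proof -
  show e: "(a, \<xi> \<inter> I a) \<in> E1"
    using assms ultrafilter_restrict[OF ideal] by (auto simp: E1_iff E0_def)
  have "edge_d (a, \<xi> \<inter> I a) \<subseteq> \<xi>" using E0_up[OF assms(1)] by auto
  then show "edge_d (a, \<xi> \<inter> I a) = \<xi>"
    using E0_eq_of_subset edge_d_in_E0[OF e] assms(1) by blast
qed


section \<open>Vertices and regular elements\<close>

lemma Z0_inf: "Z0 (inf A B) = Z0 A \<inter> Z0 B"
  unfolding Z0_def using E0_inf_iff by auto

lemma Z1_iff: "a \<in> L \<Longrightarrow> e \<in> Z1 a B \<longleftrightarrow> e \<in> E1 \<and> fst e = a \<and> B \<in> snd e"
  by (cases e) (auto simp: Z1_def E1_iff)

lemma Z1_inf:
  assumes a: "a \<in> L" "B \<in> I a" "C \<in> I a"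
  shows "Z1 a (inf B C) = Z1 a B \<inter> Z1 a C"
proof (rule Set.set_eqI)
  fix e
  have "inf B C \<in> snd e \<longleftrightarrow> B \<in> snd e \<and> C \<in> snd e" if "e \<in> E1" "fst e = a"
    using that a(2,3) snd_edge_inf[OF that(1)] snd_edge_up[OF that(1), of "inf B C"]
    by (metis inf.cobounded1 inf.cobounded2)
  then show "e \<in> Z1 a (inf B C) \<longleftrightarrow> e \<in> Z1 a B \<inter> Z1 a C" using Z1_iff[OF a(1)] by auto
qed

lemma openin_E0_top_Z0: "openin E0_top (Z0 A)"
  unfolding E0_top_def by (rule topology_generated_by_Basis) simp

lemma Z0_neighborhood:
  assumes "\<xi> \<in> E0" "generate_topology_on S W" "\<xi> \<in> W"
    and base: "\<And>T. T \<in> S \<Longrightarrow> \<xi> \<in> T \<Longrightarrow> \<exists>A\<in>\<xi>. Z0 A \<subseteq> T"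
  shows "\<exists>A\<in>\<xi>. Z0 A \<subseteq> W"
proof -
  have "\<exists>B\<in>Z0 ` \<xi>. B \<subseteq> W"
    using assms(2,3)
  proof (rule generated_topology_neighborhood_base)
    show "\<exists>B\<in>Z0 ` \<xi>. B \<subseteq> T" if "T \<in> S" "\<xi> \<in> T" for T
      using base[OF that] by blast
    show "\<exists>C\<in>Z0 ` \<xi>. C \<subseteq> A \<and> C \<subseteq> B" if AB: "A \<in> Z0 ` \<xi>" "B \<in> Z0 ` \<xi>" for A B
    proof -
      obtain A' B' where "A' \<in> \<xi>" "B' \<in> \<xi>" "A = Z0 A'" "B = Z0 B'" using AB by blast
      then show ?thesis using E0_inf[OF assms(1)]
        by (intro bexI[of _ "Z0 (inf A' B')"] imageI) (auto simp: Z0_inf)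
    qed
  qed
  then show ?thesis by blast
qed

lemma E0_top_neighborhood:
  assumes "openin E0_top W" "\<xi> \<in> W"
  shows "\<exists>A\<in>\<xi>. Z0 A \<subseteq> W"
proof -
  have "\<xi> \<in> topspace E0_top" using assms openin_subset by blast
  then have "\<xi> \<in> E0" by (auto simp: E0_top_def Z0_def)
  moreover have "generate_topology_on (range Z0) W"
    using assms(1) unfolding E0_top_def by (rule openin_topology_generated_by)
  moreover have "\<exists>A\<in>\<xi>. Z0 A \<subseteq> T" if "T \<in> range Z0" "\<xi> \<in> T" for T
    using that by (auto simp: Z0_def)
  ultimately show ?thesis using Z0_neighborhood assms(2) by blast
qed

lemma E1_top_neighborhood:
  assumes "openin E1_top W" "e \<in> W"
  shows "e \<in> E1" "\<exists>B\<in>snd e. Z1 (fst e) B \<subseteq> W"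
proof -
  have "e \<in> topspace E1_top" using assms openin_subset by blast
  then show e: "e \<in> E1" by (auto simp: E1_top_def Z1_iff)
  have aL: "fst e \<in> L" using e by (simp add: E1_iff)
  have "\<exists>B\<in>Z1 (fst e) ` snd e. B \<subseteq> W"
    using openin_topology_generated_by[OF assms(1)[unfolded E1_top_def]] assms(2)
  proof (rule generated_topology_neighborhood_base)
    show "\<exists>B\<in>Z1 (fst e) ` snd e. B \<subseteq> T"
      if "T \<in> {Z1 a B | a B. a \<in> L \<and> B \<in> I a}" "e \<in> T" for T
      using that by (auto simp: Z1_iff)
    show "\<exists>C\<in>Z1 (fst e) ` snd e. C \<subseteq> A \<and> C \<subseteq> B"
      if AB: "A \<in> Z1 (fst e) ` snd e" "B \<in> Z1 (fst e) ` snd e" for A B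
    proof -
      obtain A' B' where *: "A' \<in> snd e" "B' \<in> snd e" "A = Z1 (fst e) A'" "B = Z1 (fst e) B'"
        using AB by blast
      then have "Z1 (fst e) (inf A' B') = A \<inter> B" using Z1_inf[OF aL] snd_edge_in_I[OF e] by blast
      then show ?thesis using snd_edge_inf[OF e *(1,2)] by blast
    qed
  qed
  then show "\<exists>B\<in>snd e. Z1 (fst e) B \<subseteq> W" by blast
qed

lemma topspace_E1_top: "topspace E1_top = E1"
proof
  show "topspace E1_top \<subseteq> E1" by (auto simp: E1_top_def Z1_iff)
  show "E1 \<subseteq> topspace E1_top"
  proof
    fix e assume e: "e \<in> E1"
    then obtain B where "B \<in> snd e" using ultrafilter_nonempty E1_iff by blast
    then have "e \<in> Z1 (fst e) B" "fst e \<in> L" "B \<in> I (fst e)"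
      using e snd_edge_in_I by (auto simp: E1_iff Z1_iff)
    then show "e \<in> topspace E1_top" by (auto simp: E1_top_def)
  qed
qed

lemma openin_E1_top_Z1: "a \<in> L \<Longrightarrow> B \<in> I a \<Longrightarrow> openin E1_top (Z1 a B)"
  unfolding E1_top_def by (rule topology_generated_by_Basis) blast

text \<open>The extra point of \<open>F0\<close> does not affect the topology near an element of \<open>E0\<close>, whichever of
  its two descriptions applies.\<close>

lemma F0_top_neighborhood:
  assumes W: "openin F0_top W" and \<xi>: "\<xi> \<in> W" "\<xi> \<in> E0"
  shows "\<exists>A\<in>\<xi>. Z0 A \<subseteq> W"
proof (cases "\<exists>T::'b. \<forall>A. A \<le> T")
  case True
  then have "generate_topology_on (insert {{}} (range Z0)) W"
    using W openin_topology_generated_by by (simp add: F0_top_def)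
  moreover have "\<exists>A\<in>\<xi>. Z0 A \<subseteq> T" if "T \<in> insert {{}} (range Z0)" "\<xi> \<in> T" for T
    using that E0_nonempty[OF \<xi>(2)] by (auto simp: Z0_def)
  ultimately show ?thesis using Z0_neighborhood[OF \<xi>(2) _ \<xi>(1)] by metis
next
  case False
  let ?f = "\<lambda>\<xi>::'b set. if \<xi> = {} then None else Some \<xi>"
  obtain O' where O': "openin (Alexandroff_compactification E0_top) O'" "W = ?f -` O' \<inter> F0"
    using W False by (auto simp: F0_top_def openin_pullback_topology)
  then have "Alexandroff_open E0_top O'"
    by (simp add: Alexandroff_compactification_def istopology_Alexandroff_open)
  then have op: "openin E0_top (Some -` O')"
  proof cases
    case (base U)
    then show ?thesis by (simp add: inj_vimage_image_eq)
  next
    case (ext C)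
    have "Some -` O' = topspace E0_top - C" using ext by auto
    then show ?thesis using ext by (simp add: closedin_def)
  qed
  have "\<xi> \<in> Some -` O'" using O'(2) \<xi> E0_nonempty by auto
  then obtain A where A: "A \<in> \<xi>" "Z0 A \<subseteq> Some -` O'" using E0_top_neighborhood[OF op] by blast
  have "Z0 A \<subseteq> W"
    using A(2) E0_nonempty unfolding O'(2) F0_def Z0_def by auto
  then show ?thesis using A(1) by blast
qed

lemma openin_F0_top_Z0: "openin F0_top (Z0 A)"
proof (cases "\<exists>T::'b. \<forall>A. A \<le> T")
  case True
  then have "F0_top = topology_generated_by (insert {{}} (range Z0))" by (simp add: F0_top_def)
  then show ?thesis using topology_generated_by_Basis[of "Z0 A" "insert {{}} (range Z0)"] by simp
next
  case False
  let ?f = "\<lambda>\<xi>::'b set. if \<xi> = {} then None else Some \<xi>"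
  have op: "openin (Alexandroff_compactification E0_top) (Some ` Z0 A)"
    using openin_E0_top_Z0
    by (simp add: Alexandroff_compactification_def istopology_Alexandroff_open Alexandroff_open.base)
  have eq: "Z0 A = ?f -` (Some ` Z0 A) \<inter> F0"
    using E0_nonempty by (auto simp: Z0_def F0_def)
  have top: "F0_top = pullback_topology F0 ?f (Alexandroff_compactification E0_top)"
    unfolding F0_top_def using False by (rule if_not_P)
  show ?thesis
    unfolding top openin_pullback_topology by (rule exI, rule conjI[OF op eq])
qed

lemma E0_subset_topspace_F0: "E0 \<subseteq> topspace F0_top"
proof
  fix \<xi> assume "\<xi> \<in> E0"
  then obtain A where "\<xi> \<in> Z0 A" using E0_nonempty by (auto simp: Z0_def)
  then show "\<xi> \<in> topspace F0_top" using openin_F0_top_Z0 openin_subset by blast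
qed

text \<open>If \<open>\<xi>\<close> were not a range, compactness of the preimage of a neighbourhood of \<open>\<xi>\<close> would give
  one \<open>A \<in> \<xi>\<close> that belongs to no range at all, and \<open>\<xi>\<close> would be outside the closure of the
  ranges.\<close>

lemma F0_rg_receives_edge:
  assumes \<xi>: "\<xi> \<in> E0" "\<xi> \<in> F0_rg"
  shows "\<exists>e\<in>E1. edge_r e = \<xi>"
proof (rule ccontr)
  assume no: "\<not> (\<exists>e\<in>E1. edge_r e = \<xi>)"
  obtain V W where VW: "openin F0_top W" "\<xi> \<in> W" "W \<subseteq> V"
    and comp: "compactin E1_top {e \<in> E1. edge_r e \<in> V}"
    using \<xi>(2) unfolding F0_rg_def F0_fin_def by blast
  let ?C = "{e \<in> E1. edge_r e \<in> V}"
  obtain A0 where A0: "A0 \<in> \<xi>" "Z0 A0 \<subseteq> W" using F0_top_neighborhood[OF VW(1,2) \<xi>(1)] by blast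
  define S where "S A = {e \<in> E1. A \<notin> edge_r e}" for A
  have op: "openin E1_top (S A)" for A
  proof (subst openin_subopen, intro ballI)
    fix e assume "e \<in> S A"
    then have e: "e \<in> E1" "\<theta> (fst e) A \<notin> snd e" by (auto simp: S_def edge_r_iff)
    have aL: "fst e \<in> L" using e(1) by (simp add: E1_iff)
    obtain X where X: "X \<in> snd e" using e(1) ultrafilter_nonempty E1_iff by blast
    let ?B = "X - \<theta> (fst e) A"
    have B: "?B \<in> snd e" using snd_edge_diff[OF e(1) X \<theta>_in_I[OF aL] e(2)] .
    have "Z1 (fst e) ?B \<subseteq> S A"
    proof
      fix e' assume e': "e' \<in> Z1 (fst e) ?B"
      then have e1: "e' \<in> E1" "fst e' = fst e" "?B \<in> snd e'" using Z1_iff[OF aL] by auto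
      have "\<theta> (fst e) A \<notin> snd e'"
      proof
        assume "\<theta> (fst e) A \<in> snd e'"
        then have "inf ?B (\<theta> (fst e) A) \<noteq> bot"
          using ultrafilter_disjoint[OF ideal[OF aL] _ e1(3)] e1(1,2) unfolding E1_iff by metis
        then show False by (simp add: inf_diff_bot)
      qed
      then show "e' \<in> S A" using e1 by (simp add: S_def edge_r_iff)
    qed
    moreover have "openin E1_top (Z1 (fst e) ?B)"
      using openin_E1_top_Z1[OF aL snd_edge_in_I[OF e(1) B]] .
    moreover have "e \<in> Z1 (fst e) ?B" using Z1_iff[OF aL] e(1) B by blast
    ultimately show "\<exists>T. openin E1_top T \<and> e \<in> T \<and> T \<subseteq> S A" by blast
  qed
  have cov: "?C \<subseteq> \<Union>(S ` \<xi>)"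
  proof
    fix e assume e: "e \<in> ?C"
    have "\<not> \<xi> \<subseteq> edge_r e"
    proof
      assume sub: "\<xi> \<subseteq> edge_r e"
      then have "edge_r e \<in> E0" using e edge_r_in_E0 E0_nonempty[OF \<xi>(1)] by blast
      then have "\<xi> = edge_r e" using E0_eq_of_subset[OF \<xi>(1) _ sub] by blast
      then show False using no e by blast
    qed
    then show "e \<in> \<Union>(S ` \<xi>)" using e by (auto simp: S_def)
  qed
  obtain \<F> where F: "finite \<F>" "\<F> \<subseteq> S ` \<xi>" "?C \<subseteq> \<Union>\<F>"
  proof -
    have "\<forall>U\<in>S ` \<xi>. openin E1_top U" using op by blast
    then show thesis using comp cov that unfolding compactin_def by meson
  qed
  obtain T where T: "finite T" "T \<subseteq> \<xi>" "\<F> = S ` T" using finite_subset_image[OF F(1,2)] by blast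
  have "\<exists>A\<in>\<xi>. \<forall>B\<in>insert A0 T. A \<le> B"
    using T(1,2)
  proof (induction T)
    case empty
    then show ?case using A0(1) by blast
  next
    case (insert B T)
    then obtain A where "A \<in> \<xi>" "\<forall>B\<in>insert A0 T. A \<le> B" by auto
    then show ?case using E0_inf[OF \<xi>(1), of A B] insert.prems
      by (intro bexI[of _ "inf A B"]) (auto simp: le_infI1)
  qed
  then obtain A where A: "A \<in> \<xi>" "A \<le> A0" "\<And>B. B \<in> T \<Longrightarrow> A \<le> B" by auto
  have notr: "A \<notin> edge_r e" if e: "e \<in> E1" for e
  proof
    assume Ar: "A \<in> edge_r e"
    then have r: "edge_r e \<in> E0" using edge_r_in_E0[OF e] by blast
    then have "edge_r e \<in> Z0 A0" using E0_up[OF r Ar A(2)] by (simp add: Z0_def)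
    then have "e \<in> ?C" using A0(2) VW(3) e by blast
    then obtain B where B: "B \<in> T" "e \<in> S B" using F(3) T(3) by blast
    then have "B \<in> edge_r e" using E0_up[OF r Ar A(3)] by blast
    then show False using B(2) by (simp add: S_def)
  qed
  have "\<xi> \<notin> F0_top closure_of (edge_r ` E1)"
  proof
    assume "\<xi> \<in> F0_top closure_of (edge_r ` E1)"
    moreover have "\<xi> \<in> Z0 A" using A(1) \<xi>(1) by (simp add: Z0_def)
    ultimately obtain y where "y \<in> edge_r ` E1" "y \<in> Z0 A"
      using openin_F0_top_Z0 unfolding in_closure_of by blast
    then show False using notr by (auto simp: Z0_def)
  qed
  then have sce: "\<xi> \<in> F0_sce" using \<xi>(1) by (simp add: F0_sce_def F0_def)
  then have "\<xi> \<in> F0_top closure_of F0_sce"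
    using E0_subset_topspace_F0 \<xi>(1) unfolding in_closure_of by blast
  then show False using \<xi>(2) by (simp add: F0_rg_def)
qed

text \<open>If \<open>Z1 a B\<close> had a cover without finite subcover, the elements \<open>D\<close> of \<open>I a\<close> for which
  \<open>Z1 a (B - D)\<close> is finitely covered would form a filter base.  An ultrafilter containing this
  base lies in no member of the cover.\<close>

lemma compactin_Z1:
  assumes a: "a \<in> L" and B: "B \<in> I a"
  shows "compactin E1_top (Z1 a B)"
  unfolding compactin_def
proof (intro conjI allI impI)
  show "Z1 a B \<subseteq> topspace E1_top" using Z1_iff[OF a] by (auto simp: topspace_E1_top)
  fix \<U> assume U: "(\<forall>U\<in>\<U>. openin E1_top U) \<and> Z1 a B \<subseteq> \<Union>\<U>"
  define fc where "fc D \<longleftrightarrow> (\<exists>\<F>. finite \<F> \<and> \<F> \<subseteq> \<U> \<and> Z1 a D \<subseteq> \<Union>\<F>)" for D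
  note Ia = ideal[OF a]
  show "\<exists>\<F>. finite \<F> \<and> \<F> \<subseteq> \<U> \<and> Z1 a B \<subseteq> \<Union>\<F>"
  proof (rule ccontr)
    assume "\<not> ?thesis"
    then have nB: "\<not> fc B" by (simp add: fc_def)
    have Z1_mono: "Z1 a C \<subseteq> Z1 a D" if "C \<le> D" "D \<in> I a" for C D
      unfolding Z1_def using that ultrafilter_up by blast
    have fc_mono: "fc C" if "fc D" "C \<le> D" "D \<in> I a" for C D
      using that Z1_mono[OF that(2,3)] unfolding fc_def by (meson order.trans)
    have fc_cover: "fc D" if D: "fc (inf D C)" "fc (D - C)" "D \<in> I a" for C D
    proof -
      obtain F1 F2 where "finite F1" "F1 \<subseteq> \<U>" "Z1 a (inf D C) \<subseteq> \<Union>F1"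
        "finite F2" "F2 \<subseteq> \<U>" "Z1 a (D - C) \<subseteq> \<Union>F2" using D(1,2) unfolding fc_def by blast
      moreover have "Z1 a D \<subseteq> Z1 a (inf D C) \<union> Z1 a (D - C)"
        unfolding Z1_def using ultrafilter_inf_or_diff[OF Ia, of _ D C] by blast
      ultimately show ?thesis unfolding fc_def by (intro exI[of _ "F1 \<union> F2"]) blast
    qed
    define S where "S = {D \<in> I a. fc (B - D)}"
    have "\<exists>F\<in>ba_ultrafilters (I a). S \<subseteq> F"
    proof (rule filter_base_extends_to_ultrafilter[OF Ia])
      show "S \<subseteq> I a" by (auto simp: S_def)
      have fb: "fc bot"
      proof -
        have "Z1 a bot = {}" unfolding Z1_def using ultrafilter_bot by blast
        then show ?thesis unfolding fc_def by (intro exI[of _ "{}"]) simp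
      qed
      moreover have "B - B = bot" by (simp add: diff_eq_bot_iff)
      ultimately show "S \<noteq> {}" using B by (auto simp: S_def)
      show "bot \<notin> S"
      proof
        assume "bot \<in> S"
        then have "fc (B - bot)" by (simp add: S_def)
        moreover have "B \<le> B - bot" by (simp add: le_diff_iff)
        ultimately show False using nB fc_mono ba_ideal_diff[OF Ia B] by blast
      qed
      fix C D assume CD: "C \<in> S" "D \<in> S"
      let ?E = "B - inf C D"
      have "fc (inf ?E C)"
      proof (rule fc_mono)
        show "fc (B - D)" using CD by (simp add: S_def)
        have "inf (inf ?E C) D = inf ?E (inf C D)" by (simp add: inf_assoc)
        moreover have "inf ?E C \<le> B" using diff_le le_infI1 by blast
        ultimately show "inf ?E C \<le> B - D" by (simp add: le_diff_iff inf_diff_bot)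
      qed (rule ba_ideal_diff[OF Ia B])
      moreover have "fc (?E - C)"
      proof (rule fc_mono)
        show "fc (B - C)" using CD by (simp add: S_def)
        show "?E - C \<le> B - C" by (rule diff_mono_left[OF diff_le])
      qed (rule ba_ideal_diff[OF Ia B])
      ultimately have "fc ?E" using fc_cover ba_ideal_diff[OF Ia B] by blast
      then have "inf C D \<in> S" using CD ba_ideal_inf[OF Ia] by (simp add: S_def)
      then show "\<exists>E\<in>S. E \<le> C \<and> E \<le> D" by (intro bexI[of _ "inf C D"]) simp_all
    qed
    then obtain F where F: "F \<in> ba_ultrafilters (I a)" "S \<subseteq> F" by blast
    have "B - B = bot" by (simp add: diff_eq_bot_iff)
    then have "fc (B - B)"
    proof -
      have "Z1 a bot = {}" unfolding Z1_def using ultrafilter_bot by blast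
      then show ?thesis unfolding fc_def \<open>B - B = bot\<close> by (intro exI[of _ "{}"]) simp
    qed
    then have BF: "B \<in> F" using F(2) B by (auto simp: S_def)
    then have "(a, F) \<in> Z1 a B" using F(1) by (simp add: Z1_def)
    then obtain U' where U': "U' \<in> \<U>" "(a, F) \<in> U'" using U by blast
    then obtain D where D: "D \<in> F" "Z1 a D \<subseteq> U'" using E1_top_neighborhood(2) U by fastforce
    have DI: "D \<in> I a" using ultrafilter_subset[OF F(1)] D(1) by blast
    have "fc D" unfolding fc_def using U'(1) D(2) by (intro exI[of _ "{U'}"]) simp
    then have "fc (inf B D)" using fc_mono DI inf.cobounded2 by blast
    then have "B - D \<in> S" using ba_ideal_diff[OF Ia B] by (simp add: S_def diff_diff_eq_inf)
    then have "inf (B - D) D \<noteq> bot" using ultrafilter_disjoint[OF Ia F(1) _ D(1)] F(2) by blast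
    then show False by (simp add: inf_diff_bot)
  qed
qed

lemma edge_with_range_containing:
  assumes "a \<in> L" "\<theta> a D \<noteq> bot"
  shows "\<exists>e\<in>E1. fst e = a \<and> D \<in> edge_r e"
proof -
  obtain F where "F \<in> ba_ultrafilters (I a)" "\<theta> a D \<in> F"
    using ultrafilter_containing[OF ideal[OF assms(1)] \<theta>_in_I[OF assms(1)] assms(2)] by blast
  then show ?thesis using assms(1) by (intro bexI[of _ "(a, F)"]) (simp_all add: E1_iff)
qed

lemma edge_r_\<Delta>: "e \<in> E1 \<Longrightarrow> A \<in> edge_r e \<Longrightarrow> fst e \<in> \<Delta> A"
  unfolding \<Delta>_def edge_r_iff E1_iff using ultrafilter_bot by force

text \<open>Finitely many labels act non-trivially on a regular element \<open>A\<close>, and each contributes a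
  compact set of edges with range in \<open>Z0 A\<close>; moreover every vertex in \<open>Z0 A\<close> is a limit of ranges,
  because some label acts non-trivially on each non-zero element below \<open>A\<close>.\<close>

lemma regular_in_F0_rg:
  assumes A: "regular A" "A \<in> \<xi>" and \<xi>: "\<xi> \<in> E0"
  shows "\<xi> \<in> F0_rg"
proof -
  have A0: "A \<noteq> bot" using E0_bot[OF \<xi> A(2)] .
  have fin: "finite (\<Delta> A)" using A(1) A0 unfolding regular_def by blast
  have \<xi>Z: "\<xi> \<in> Z0 A" using \<xi> A(2) by (simp add: Z0_def)
  have "{e \<in> E1. edge_r e \<in> Z0 A} = (\<Union>a\<in>\<Delta> A. Z1 a (\<theta> a A))" (is "?l = ?r")
  proof (intro equalityI subsetI)
    fix e assume e: "e \<in> ?l"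
    then have "A \<in> edge_r e" "e \<in> E1" by (auto simp: Z0_def)
    moreover from this have "fst e \<in> \<Delta> A" by (simp add: edge_r_\<Delta>)
    moreover from this have "fst e \<in> L" by (simp add: \<Delta>_def)
    ultimately show "e \<in> ?r" using Z1_iff edge_r_iff by blast
  next
    fix e assume "e \<in> ?r"
    then obtain a where a: "a \<in> L" "e \<in> Z1 a (\<theta> a A)" by (auto simp: \<Delta>_def)
    then have e: "e \<in> E1" "A \<in> edge_r e" using Z1_iff edge_r_iff by auto
    moreover from this have "edge_r e \<in> E0" using edge_r_in_E0 by blast
    ultimately show "e \<in> ?l" by (simp add: Z0_def)
  qed
  moreover have "compactin E1_top ?r"
    using fin compactin_Z1 \<theta>_in_I by (intro compactin_Union) (auto simp: \<Delta>_def)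
  ultimately have "compactin E1_top ?l" by simp
  then have "\<xi> \<in> F0_fin"
    unfolding F0_fin_def using \<xi> \<xi>Z openin_F0_top_Z0[of A]
    by (auto simp: F0_def Z0_def intro!: exI[of _ "Z0 A"])
  moreover have "\<xi> \<notin> F0_top closure_of F0_sce"
  proof
    assume "\<xi> \<in> F0_top closure_of F0_sce"
    then obtain \<zeta> where \<zeta>: "\<zeta> \<in> F0_sce" "\<zeta> \<in> Z0 A"
      using \<xi>Z openin_F0_top_Z0 unfolding in_closure_of by blast
    have \<zeta>E: "\<zeta> \<in> E0" "A \<in> \<zeta>" using \<zeta>(2) by (auto simp: Z0_def)
    have "\<zeta> \<in> F0_top closure_of (edge_r ` E1)"
      unfolding in_closure_of
    proof (intro conjI allI impI)
      show "\<zeta> \<in> topspace F0_top" using E0_subset_topspace_F0 \<zeta>E by blast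
      fix T assume T: "\<zeta> \<in> T \<and> openin F0_top T"
      then obtain D where D: "D \<in> \<zeta>" "Z0 D \<subseteq> T" using F0_top_neighborhood \<zeta>E by blast
      let ?D = "inf A D"
      have "?D \<noteq> bot" using E0_bot[OF \<zeta>E(1)] E0_inf[OF \<zeta>E D(1)] by blast
      then have "\<Delta> ?D \<noteq> {}" using A(1) unfolding regular_def by simp
      then obtain a where "a \<in> L" "\<theta> a ?D \<noteq> bot" by (auto simp: \<Delta>_def)
      then obtain e where e: "e \<in> E1" "?D \<in> edge_r e" using edge_with_range_containing by blast
      then have r: "edge_r e \<in> E0" using edge_r_in_E0 by blast
      then have "edge_r e \<in> Z0 D" using E0_up[OF r e(2)] by (simp add: Z0_def)
      then show "\<exists>y. y \<in> edge_r ` E1 \<and> y \<in> T" using e(1) D(2) by blast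
    qed
    then show False using \<zeta>(1) by (simp add: F0_sce_def)
  qed
  ultimately show ?thesis by (simp add: F0_rg_def)
qed


section \<open>Edge sequences and words\<close>

text \<open>The values of \<open>g\<close> at \<open>0, \<dots>, n\<close> form a path; its length is \<open>n + 1\<close>.\<close>

definition chain :: "(nat \<Rightarrow> ('l, 'b) edge) \<Rightarrow> nat \<Rightarrow> bool" where
  "chain g n \<longleftrightarrow> (\<forall>i\<le>n. g i \<in> E1) \<and> (\<forall>i<n. edge_d (g i) = edge_r (g (Suc i)))"

definition labels :: "(nat \<Rightarrow> ('l, 'b) edge) \<Rightarrow> nat \<Rightarrow> nat \<Rightarrow> 'l list" where
  "labels g i j = map (\<lambda>k. fst (g k)) [i..<j]"

lemma chainD:
  assumes "chain g n"
  shows "i \<le> n \<Longrightarrow> g i \<in> E1" "i < n \<Longrightarrow> edge_d (g i) = edge_r (g (Suc i))"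
  using assms unfolding chain_def by simp_all

lemma chain_mono: "chain g n \<Longrightarrow> m \<le> n \<Longrightarrow> chain g m"
  unfolding chain_def by simp

lemma length_labels [simp]: "length (labels g i j) = j - i"
  by (simp add: labels_def)

lemma nth_labels: "k < j - i \<Longrightarrow> labels g i j ! k = fst (g (i + k))"
  by (simp add: labels_def)

lemma labels_self [simp]: "labels g i i = []"
  by (simp add: labels_def)

lemma labels_Suc: "i \<le> j \<Longrightarrow> labels g i (Suc j) = labels g i j @ [fst (g j)]"
  by (simp add: labels_def)

lemma labels_Cons: "i < j \<Longrightarrow> labels g i j = fst (g i) # labels g (Suc i) j"
  by (simp add: labels_def upt_conv_Cons)

lemma labels_append: "i \<le> j \<Longrightarrow> j \<le> k \<Longrightarrow> labels g i k = labels g i j @ labels g j k"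
  unfolding labels_def by (metis le_add_diff_inverse map_append upt_add_eq_append)

lemma labels_eq_iff: "labels g i j = labels h i j \<longleftrightarrow> (\<forall>k. i \<le> k \<and> k < j \<longrightarrow> fst (g k) = fst (h k))"
  by (auto simp: labels_def)

lemma set_labels_subset_L: "chain g n \<Longrightarrow> j \<le> Suc n \<Longrightarrow> set (labels g i j) \<subseteq> L"
  unfolding chain_def labels_def by (auto simp: E1_iff)

lemma snd_edge_step:
  assumes "e \<in> E1" "e' \<in> E1" "edge_d e = edge_r e'" "X \<in> I (fst e)"
  shows "X \<in> snd e \<longleftrightarrow> \<theta> (fst e') X \<in> snd e'"
  using edge_d_Int_I[OF assms(1)] assms(3,4) edge_r_iff[of X e'] by blast

lemma \<theta>w_labels_in_I:
  assumes "chain g n" "i \<le> j" "j \<le> n" "X \<in> I (fst (g i))"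
  shows "\<theta>w (labels g (Suc i) (Suc j)) X \<in> I (fst (g j))"
proof (cases "i = j")
  case False
  then have "labels g (Suc i) (Suc j) = labels g (Suc i) j @ [fst (g j)]"
    using assms(2) by (intro labels_Suc) simp
  moreover have "fst (g j) \<in> L" using chainD(1)[OF assms(1,3)] by (simp add: E1_iff)
  ultimately show ?thesis by (simp add: \<theta>w_append \<theta>_in_I)
qed (use assms in simp)

text \<open>Along a chain of edges, membership in the ultrafilter of one edge is decided at any later
  edge.  Finitely many conditions on the ultrafilters of a path can therefore be imposed through a
  single element at a single position.\<close>

lemma snd_edge_transport:
  assumes c: "chain g n" and ij: "i \<le> j" "j \<le> n" and X: "X \<in> I (fst (g i))"
  shows "X \<in> snd (g i) \<longleftrightarrow> \<theta>w (labels g (Suc i) (Suc j)) X \<in> snd (g j)"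
  using ij
proof (induction j rule: dec_induct)
  case (step j)
  let ?Y = "\<theta>w (labels g (Suc i) (Suc j)) X"
  have "?Y \<in> I (fst (g j))" using \<theta>w_labels_in_I[OF c _ _ X] step by simp
  then have "?Y \<in> snd (g j) \<longleftrightarrow> \<theta> (fst (g (Suc j))) ?Y \<in> snd (g (Suc j))"
    using chainD[OF c] step.prems by (intro snd_edge_step) simp_all
  moreover have "labels g (Suc i) (Suc (Suc j)) = labels g (Suc i) (Suc j) @ [fst (g (Suc j))]"
    using step.hyps by (intro labels_Suc) simp
  ultimately show ?case using step by (simp add: \<theta>w_append)
qed simp

lemma edge_r_transport:
  assumes c: "chain g n"
  shows "A \<in> edge_r (g 0) \<longleftrightarrow> \<theta>w (labels g 0 (Suc n)) A \<in> snd (g n)"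
proof -
  have "fst (g 0) \<in> L" using chainD(1)[OF c, of 0] by (simp add: E1_iff)
  then have "\<theta> (fst (g 0)) A \<in> I (fst (g 0))" by (rule \<theta>_in_I)
  then show ?thesis
    using snd_edge_transport[OF c, of 0 n] by (simp add: edge_r_iff labels_Cons)
qed

lemma Iw_labels_iff:
  "B \<in> Iw (labels g 0 (Suc n)) \<longleftrightarrow> (\<exists>X\<in>I (fst (g 0)). B \<le> \<theta>w (labels g (Suc 0) (Suc n)) X)"
  by (simp add: labels_Cons)

lemma Iw_downward: "B \<in> Iw w \<Longrightarrow> C \<le> B \<Longrightarrow> C \<in> Iw w"
  by (cases w) (auto intro: order.trans)

lemma Iw_\<theta>w_append:
  assumes "B \<in> Iw w" "w \<noteq> []" "set v \<subseteq> L"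
  shows "\<theta>w v B \<in> Iw (w @ v)"
  using assms \<theta>w_mono[OF assms(3)] by (cases w) (auto simp: \<theta>w_append)

lemma Iw_subset_I_last:
  assumes "w \<noteq> []" "set w \<subseteq> L" "B \<in> Iw w"
  shows "B \<in> I (last w)"
proof (cases w rule: rev_cases)
  case (snoc u b)
  have b: "b \<in> L" using assms(2) snoc by simp
  have "\<exists>X\<in>I b. B \<le> X"
  proof (cases u)
    case Nil
    then show ?thesis using assms(3) snoc by simp
  next
    case (Cons a v)
    then obtain C where "B \<le> \<theta> b (\<theta>w v C)" using assms(3) snoc by (auto simp: \<theta>w_append)
    then show ?thesis using \<theta>_in_I[OF b] by blast
  qed
  then show ?thesis using ba_ideal_downward[OF ideal[OF b]] snoc by auto
qed (use assms in simp)

text \<open>Over an element of \<open>Iw w\<close> paths extend backwards along \<open>w\<close>.  Every ultrafilter at the end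
  of a chain of edges has such a member, so cylinders may always be based on one.\<close>

lemma ex_Iw_member:
  assumes c: "chain g n"
  shows "\<exists>Y\<in>snd (g n). Y \<in> Iw (labels g 0 (Suc n))"
proof -
  have e: "g 0 \<in> E1" using chainD(1)[OF c] by simp
  then obtain X where X: "X \<in> snd (g 0)" using ultrafilter_nonempty E1_iff by blast
  then have XI: "X \<in> I (fst (g 0))" using snd_edge_in_I[OF e] by blast
  then have "\<theta>w (labels g (Suc 0) (Suc n)) X \<in> snd (g n)"
    using snd_edge_transport[OF c, of 0 n X] X by simp
  moreover have "\<theta>w (labels g (Suc 0) (Suc n)) X \<in> Iw (labels g 0 (Suc n))"
    using XI by (auto simp: Iw_labels_iff)
  ultimately show ?thesis by blast
qed


section \<open>Boundary paths\<close>

text \<open>Reading a path edge by edge treats finite and infinite paths alike; the value beyond the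
  length of a finite path is immaterial.\<close>

fun edge_at :: "('l, 'b) gpath \<Rightarrow> nat \<Rightarrow> ('l, 'b) edge" where
  "edge_at (Vertex v) i = undefined"
| "edge_at (FinPath es) i = es ! i"
| "edge_at (InfPath f) i = f i"

lemma initial_edges_edge_at:
  "enat n \<le> plength \<mu> \<Longrightarrow> initial_edges n \<mu> = map (edge_at \<mu>) [0..<n]"
  by (cases \<mu>) (auto intro!: nth_equalityI simp: enat_0_iff)

lemma length_initial_edges: "length (initial_edges n \<mu>) = n \<Longrightarrow> enat n \<le> plength \<mu>"
  by (cases \<mu>) (auto simp: enat_0_iff)

lemma last_initial_edges: "enat (Suc n) \<le> plength \<mu> \<Longrightarrow> last (initial_edges (Suc n) \<mu>) = edge_at \<mu> n"
  by (simp add: initial_edges_edge_at)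

lemma chain_cong: "(\<And>i. i \<le> n \<Longrightarrow> g i = h i) \<Longrightarrow> chain g n \<longleftrightarrow> chain h n"
  unfolding chain_def by simp

lemma En_Suc_iff: "es \<in> En (Suc n) \<longleftrightarrow> length es = Suc n \<and> chain ((!) es) n"
proof -
  have "set es \<subseteq> E1 \<longleftrightarrow> (\<forall>i\<le>n. es ! i \<in> E1)" if "length es = Suc n"
    using that unfolding subset_eq all_set_conv_all_nth by (simp add: less_Suc_eq_le)
  then show ?thesis unfolding En_def chain_def by auto
qed

lemma E0_sg_iff: "\<xi> \<in> E0_sg \<longleftrightarrow> \<xi> \<in> E0 \<and> \<xi> \<notin> F0_rg"
  by (auto simp: E0_sg_def F0_sg_def F0_def)

lemma boundary_Vertex: "Vertex \<xi> \<in> boundary \<longleftrightarrow> \<xi> \<in> E0_sg"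
  by (auto simp: boundary_def Einf_def Estar_def E0_sg_iff)

lemma boundary_FinPath:
  "FinPath es \<in> boundary \<longleftrightarrow> es \<noteq> [] \<and> chain ((!) es) (length es - 1) \<and> edge_d (last es) \<in> E0_sg"
proof (cases "length es")
  case 0
  then show ?thesis by (auto simp: boundary_def Einf_def Estar_def En_def)
next
  case (Suc n)
  have "(\<exists>m\<in>{1..}. es \<in> En m) \<longleftrightarrow> es \<in> En (Suc n)"
    using Suc by (auto simp: En_def)
  then have "FinPath es \<in> Estar \<longleftrightarrow> es \<in> En (Suc n)" by (auto simp: Estar_def)
  then show ?thesis using Suc by (auto simp: boundary_def Einf_def En_Suc_iff)
qed

lemma boundary_InfPath: "InfPath f \<in> boundary \<longleftrightarrow> (\<forall>n. chain f n)"
proof -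
  have "InfPath f \<in> boundary \<longleftrightarrow> (\<forall>i. f i \<in> E1 \<and> edge_d (f i) = edge_r (f (Suc i)))"
    by (auto simp: boundary_def Einf_def Estar_def)
  also have "\<dots> \<longleftrightarrow> (\<forall>n. chain f n)"
    unfolding chain_def by blast
  finally show ?thesis .
qed

lemma boundary_chain:
  assumes "\<mu> \<in> boundary" "enat n < plength \<mu>"
  shows "chain (edge_at \<mu>) n"
proof (cases \<mu>)
  case (FinPath es)
  then have "chain ((!) es) n"
    using assms chain_mono[of "(!) es" "length es - 1" n] by (auto simp: boundary_FinPath)
  then show ?thesis using FinPath by (simp add: chain_def)
next
  case (InfPath f)
  then have "chain f n" using assms by (auto simp: boundary_InfPath)
  then show ?thesis using InfPath by (simp add: chain_def)
qed (use assms in \<open>auto simp: zero_enat_def\<close>)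

lemma path_r_edge_at: "\<mu> \<in> boundary \<Longrightarrow> 0 < plength \<mu> \<Longrightarrow> path_r \<mu> = edge_r (edge_at \<mu> 0)"
  by (cases \<mu>) (auto simp: boundary_FinPath hd_conv_nth)

lemma plength_eq_0: "\<mu> \<in> boundary \<Longrightarrow> \<not> 0 < plength \<mu> \<Longrightarrow> \<exists>\<xi>. \<mu> = Vertex \<xi>"
  by (cases \<mu>) (auto simp: boundary_FinPath zero_enat_def)

lemma path_r_in_E0:
  assumes \<mu>: "\<mu> \<in> boundary" and ne: "path_r \<mu> \<noteq> {}"
  shows "path_r \<mu> \<in> E0"
proof (cases "0 < plength \<mu>")
  case True
  then have "edge_at \<mu> 0 \<in> E1" using boundary_chain[OF \<mu>, of 0] chainD(1) by (simp add: zero_enat_def)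
  then show ?thesis using edge_r_in_E0 path_r_edge_at[OF \<mu> True] ne by simp
next
  case False
  then show ?thesis using \<mu> plength_eq_0[OF \<mu>] by (auto simp: boundary_Vertex E0_sg_iff)
qed

lemma prepend_Nil [simp]: "prepend [] \<mu> = \<mu>"
  by (cases \<mu>) simp_all

lemma prepend_Cons: "prepend (e # es) \<mu> = prepend [e] (prepend es \<mu>)"
  by (cases \<mu>) (auto simp: fun_eq_iff nth_Cons' less_Suc_eq_0_disj)

lemma path_r_prepend: "path_r (prepend (e # es) \<mu>) = edge_r e"
  by (cases \<mu>) simp_all

lemma plength_prepend: "plength (prepend es \<mu>) = enat (length es) + plength \<mu>"
  by (cases \<mu>) (auto simp: zero_enat_def)

lemma edge_at_prepend:
  "i < length es \<Longrightarrow> edge_at (prepend es \<mu>) i = es ! i"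
  "enat i < plength \<mu> \<Longrightarrow> edge_at (prepend es \<mu>) (length es + i) = edge_at \<mu> i"
  by (cases \<mu>; auto simp: nth_append enat_0_iff)+

lemma prepend_edge_in_boundary:
  assumes \<mu>: "\<mu> \<in> boundary" and e: "e \<in> E1" "edge_d e = path_r \<mu>"
  shows "prepend [e] \<mu> \<in> boundary"
proof (cases \<mu>)
  case (Vertex v)
  then show ?thesis using assms by (simp add: boundary_FinPath boundary_Vertex chain_def)
next
  case (FinPath fs)
  then have fs: "fs \<noteq> []" "chain ((!) fs) (length fs - 1)" "edge_d (last fs) \<in> E0_sg"
    using \<mu> by (auto simp: boundary_FinPath)
  have "chain ((!) (e # fs)) (length fs)"
    unfolding chain_def
  proof (intro conjI allI impI)
    show "(e # fs) ! i \<in> E1" if "i \<le> length fs" for i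
      using e(1) chainD(1)[OF fs(2)] that by (cases i) auto
    show "edge_d ((e # fs) ! i) = edge_r ((e # fs) ! Suc i)" if "i < length fs" for i
      using e(2) FinPath fs(1) chainD(2)[OF fs(2)] that by (cases i) (auto simp: hd_conv_nth)
  qed
  then show ?thesis using fs FinPath by (simp add: boundary_FinPath)
next
  case (InfPath f)
  then have f: "\<And>n. chain f n" using \<mu> by (simp add: boundary_InfPath)
  have "chain (\<lambda>i. if i < length [e] then [e] ! i else f (i - length [e])) n" for n
    unfolding chain_def
  proof (intro conjI allI impI)
    show "(if i < length [e] then [e] ! i else f (i - length [e])) \<in> E1" for i
      using e(1) chainD(1)[OF f[of i]] by auto
    show "edge_d (if i < length [e] then [e] ! i else f (i - length [e])) =
        edge_r (if Suc i < length [e] then [e] ! Suc i else f (Suc i - length [e]))" for i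
      using e(2) InfPath chainD(2)[OF f[of i]] by (cases i) auto
  qed
  then show ?thesis using InfPath by (simp add: boundary_InfPath)
qed

text \<open>The new edges are forced: each is the restriction of the range of the path built so far to
  the ideal of the next letter, counted from the end of \<open>w\<close>.  The restriction is not empty
  because the range contains a value of the action, which lies in the ideal.\<close>

lemma prepend_word:
  assumes \<mu>: "\<mu> \<in> boundary" and D: "D \<in> path_r \<mu>" and w: "set w \<subseteq> L" "D \<le> \<theta>w w C"
  shows "\<exists>es. map fst es = w \<and> prepend es \<mu> \<in> boundary \<and> C \<in> path_r (prepend es \<mu>) \<and>
    (w \<noteq> [] \<longrightarrow> snd (last es) = path_r \<mu> \<inter> I (last w))"
  using w
proof (induction w arbitrary: C)
  case Nil
  have "C \<in> path_r \<mu>" using E0_up[OF path_r_in_E0[OF \<mu>] D] D Nil by auto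
  then show ?case using \<mu> by (intro exI[of _ "[]"]) simp
next
  case (Cons a w)
  have "\<exists>es. map fst es = w \<and> prepend es \<mu> \<in> boundary \<and> \<theta> a C \<in> path_r (prepend es \<mu>) \<and>
      (w \<noteq> [] \<longrightarrow> snd (last es) = path_r \<mu> \<inter> I (last w))"
    by (rule Cons.IH) (use Cons.prems in simp_all)
  then obtain es where es: "map fst es = w" "prepend es \<mu> \<in> boundary" "\<theta> a C \<in> path_r (prepend es \<mu>)"
    "w \<noteq> [] \<longrightarrow> snd (last es) = path_r \<mu> \<inter> I (last w)"
    by blast
  let ?\<xi> = "path_r (prepend es \<mu>)"
  have aL: "a \<in> L" using Cons by simp
  have "?\<xi> \<in> E0" using path_r_in_E0[OF es(2)] es(3) by blast
  moreover have ai: "\<theta> a C \<in> ?\<xi> \<inter> I a" using es(3) \<theta>_in_I[OF aL] by simp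
  ultimately have e: "(a, ?\<xi> \<inter> I a) \<in> E1" "edge_d (a, ?\<xi> \<inter> I a) = ?\<xi>"
    using edge_with_domain[of ?\<xi> a] aL by blast+
  have "prepend ((a, ?\<xi> \<inter> I a) # es) \<mu> \<in> boundary"
    using prepend_edge_in_boundary[OF es(2) e] by (subst prepend_Cons)
  moreover have "C \<in> path_r (prepend ((a, ?\<xi> \<inter> I a) # es) \<mu>)"
    using ai by (simp add: path_r_prepend)
  ultimately show ?case
    using es(1,4) by (intro exI[of _ "(a, ?\<xi> \<inter> I a) # es"]) (auto simp: path_r_prepend)
qed

text \<open>Here the range of the extended path may be empty.  The definition of \<open>Iw w\<close> gives an element
  of the ideal of the first letter in the range of the rest of the path, which is enough for an
  edge with that letter.\<close>

lemma prepend_Iw_word: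
  assumes \<mu>: "\<mu> \<in> boundary" and B: "B \<in> path_r \<mu>" and w: "set w \<subseteq> L" "w \<noteq> []" "B \<in> Iw w"
  shows "\<exists>es. map fst es = w \<and> prepend es \<mu> \<in> boundary \<and> B \<in> snd (last es)"
proof -
  obtain a v where av: "w = a # v" using w(2) by (cases w) auto
  then obtain C where C: "C \<in> I a" "B \<le> \<theta>w v C" using w(3) by auto
  obtain es where es: "map fst es = v" "prepend es \<mu> \<in> boundary" "C \<in> path_r (prepend es \<mu>)"
    "v \<noteq> [] \<longrightarrow> snd (last es) = path_r \<mu> \<inter> I (last v)"
    using prepend_word[OF \<mu> B _ C(2)] w(1) av by auto
  let ?\<xi> = "path_r (prepend es \<mu>)"
  have "?\<xi> \<in> E0" using path_r_in_E0[OF es(2)] es(3) by blast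
  moreover have "?\<xi> \<inter> I a \<noteq> {}" using es(3) C(1) by blast
  ultimately have e: "(a, ?\<xi> \<inter> I a) \<in> E1" "edge_d (a, ?\<xi> \<inter> I a) = ?\<xi>"
    using edge_with_domain[of ?\<xi> a] w(1) av by auto
  have "prepend ((a, ?\<xi> \<inter> I a) # es) \<mu> \<in> boundary"
    using prepend_edge_in_boundary[OF es(2) e] by (subst prepend_Cons)
  moreover have "B \<in> I (last w)" using Iw_subset_I_last w by blast
  then have "B \<in> snd (last ((a, ?\<xi> \<inter> I a) # es))"
    using es(1,4) B av by (auto split: if_splits)
  ultimately show ?thesis using es(1) av by (intro exI[of _ "(a, ?\<xi> \<inter> I a) # es"]) simp
qed

text \<open>Follow edges from range to domain, starting in \<open>\<xi>\<close>, for as long as the vertex reached is regular.  If this never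
  ends, the result is an infinite path; otherwise it ends in a singular vertex, and the path is a
  boundary path for that reason.\<close>

lemma boundary_path_from:
  assumes \<xi>: "\<xi> \<in> E0"
  shows "\<exists>\<mu>\<in>boundary. path_r \<mu> = \<xi>"
proof -
  define g where "g \<zeta> = (SOME e. e \<in> E1 \<and> edge_r e = \<zeta>)" for \<zeta>
  have g: "g \<zeta> \<in> E1 \<and> edge_r (g \<zeta>) = \<zeta>" if "\<zeta> \<in> E0" "\<zeta> \<in> F0_rg" for \<zeta>
  proof -
    have "\<exists>e. e \<in> E1 \<and> edge_r e = \<zeta>" using F0_rg_receives_edge[OF that] by blast
    then show ?thesis unfolding g_def by (rule someI_ex)
  qed
  define s where "s n = ((\<lambda>\<zeta>. edge_d (g \<zeta>)) ^^ n) \<xi>" for n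
  have s_Suc: "s (Suc n) = edge_d (g (s n))" for n by (simp add: s_def)
  have s0: "s 0 = \<xi>" by (simp add: s_def)
  have E0: "s n \<in> E0" if "\<And>i. i < n \<Longrightarrow> s i \<in> F0_rg" for n
    using that
  proof (induction n)
    case (Suc n)
    then have "g (s n) \<in> E1" using g by simp
    then show ?case by (simp add: s_Suc edge_d_in_E0)
  qed (simp add: s0 \<xi>)
  show ?thesis
  proof (cases "\<forall>n. s n \<in> F0_rg")
    case True
    then have "chain (\<lambda>n. g (s n)) n" for n
      using g[OF E0] by (simp add: chain_def s_Suc[symmetric])
    then have "InfPath (\<lambda>n. g (s n)) \<in> boundary" by (simp add: boundary_InfPath)
    moreover have "path_r (InfPath (\<lambda>n. g (s n))) = \<xi>" using g[OF E0, of 0] True[rule_format, of 0] s0 by simp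
    ultimately show ?thesis by blast
  next
    case False
    define n where "n = (LEAST n. s n \<notin> F0_rg)"
    have n: "s n \<notin> F0_rg" using False unfolding n_def by (metis LeastI)
    have lt: "s i \<in> F0_rg" if "i < n" for i using not_less_Least that unfolding n_def by blast
    have sg: "s n \<in> E0_sg" using E0[OF lt] n by (simp add: E0_sg_iff)
    have gi: "g (s i) \<in> E1" "edge_r (g (s i)) = s i" if "i < n" for i
    proof -
      have "s i \<in> E0" by (rule E0) (use lt that in simp)
      then show "g (s i) \<in> E1" "edge_r (g (s i)) = s i" using g lt[OF that] by auto
    qed
    show ?thesis
    proof (cases n)
      case 0
      then show ?thesis using sg s0 by (intro bexI[of _ "Vertex \<xi>"]) (simp_all add: boundary_Vertex)
    next
      case (Suc m)
      let ?es = "map (\<lambda>i. g (s i)) [0..<n]"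
      have "chain ((!) ?es) m" using gi Suc by (simp add: chain_def s_Suc[symmetric] del: upt_Suc)
      moreover have "last ?es = g (s m)" using Suc by simp
      ultimately have "FinPath ?es \<in> boundary"
        using sg Suc by (simp add: boundary_FinPath s_Suc del: upt_Suc)
      moreover have "path_r (FinPath ?es) = \<xi>"
        using gi(2)[of 0] Suc s0 by (simp add: upt_conv_Cons del: upt_Suc)
      ultimately show ?thesis by blast
    qed
  qed
qed


section \<open>Cylinders and neighbourhoods of infinite paths\<close>

definition cylinder :: "'l list \<Rightarrow> 'b \<Rightarrow> ('l, 'b) gpath set" where
  "cylinder w B = {\<mu> \<in> boundary. enat (length w) \<le> plength \<mu> \<and> labels (edge_at \<mu>) 0 (length w) = w \<and>
     B \<in> snd (edge_at \<mu> (length w - 1))}"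

lemma cylinder_labels_iff:
  "\<nu> \<in> cylinder (labels f 0 (Suc n)) B \<longleftrightarrow> \<nu> \<in> boundary \<and> enat n < plength \<nu> \<and>
     (\<forall>i\<le>n. fst (edge_at \<nu> i) = fst (f i)) \<and> B \<in> snd (edge_at \<nu> n)"
proof -
  have "enat (Suc n) \<le> plength \<nu> \<longleftrightarrow> enat n < plength \<nu>"
    by (simp add: Suc_ile_eq)
  then show ?thesis by (auto simp: cylinder_def labels_eq_iff less_Suc_eq_le)
qed

text \<open>A path in a cylinder shares its labels with \<open>f\<close>, so an element that the base \<open>B\<close> forces at an
  earlier position of \<open>f\<close> is forced at that position of the path as well.\<close>

lemma cylinder_transport:
  assumes \<nu>: "\<nu> \<in> cylinder (labels f 0 (Suc n)) B" and i: "i \<le> n" and X: "X \<in> I (fst (f i))"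
    and le: "B \<le> \<theta>w (labels f (Suc i) (Suc n)) X"
  shows "X \<in> snd (edge_at \<nu> i)"
proof -
  have \<nu>': "\<nu> \<in> boundary" "enat n < plength \<nu>" "\<And>i. i \<le> n \<Longrightarrow> fst (edge_at \<nu> i) = fst (f i)"
    "B \<in> snd (edge_at \<nu> n)" using \<nu> by (auto simp: cylinder_labels_iff)
  have c: "chain (edge_at \<nu>) n" using boundary_chain \<nu>' by blast
  have XI: "X \<in> I (fst (edge_at \<nu> i))" using X \<nu>'(3)[OF i] by simp
  have labels: "labels (edge_at \<nu>) (Suc i) (Suc n) = labels f (Suc i) (Suc n)"
    using \<nu>'(3) by (simp add: labels_eq_iff)
  have "\<theta>w (labels (edge_at \<nu>) (Suc i) (Suc n)) X \<in> snd (edge_at \<nu> n)"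
    using snd_edge_up[OF chainD(1)[OF c order.refl] \<nu>'(4)] le \<theta>w_labels_in_I[OF c i _ XI]
    by (simp add: labels)
  then show ?thesis using snd_edge_transport[OF c i order.refl XI] by simp
qed

text \<open>\<open>nhd f Q\<close> means that \<open>Q\<close> holds on some cylinder around the infinite path \<open>f\<close>.  Like an
  eventuality it is stable under finite conjunctions, which is how neighbourhoods are assembled
  from conditions on single edges.\<close>

definition nhd :: "(nat \<Rightarrow> ('l, 'b) edge) \<Rightarrow> (('l, 'b) gpath \<Rightarrow> bool) \<Rightarrow> bool" where
  "nhd f Q \<longleftrightarrow> (\<exists>n. \<exists>B\<in>snd (f n). B \<in> Iw (labels f 0 (Suc n)) \<and> (\<forall>\<nu>\<in>cylinder (labels f 0 (Suc n)) B. Q \<nu>))"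

lemma nhd_mono: "nhd f P \<Longrightarrow> (\<And>\<nu>. \<nu> \<in> boundary \<Longrightarrow> P \<nu> \<Longrightarrow> Q \<nu>) \<Longrightarrow> nhd f Q"
  unfolding nhd_def cylinder_def by fastforce

text \<open>A cylinder around \<open>f\<close> can be based at any later position, by transporting its base element
  along \<open>f\<close>.\<close>

lemma nhd_later:
  assumes f: "\<And>n. chain f n" and Q: "nhd f Q"
  shows "\<exists>N. \<forall>n\<ge>N. \<exists>B\<in>snd (f n). B \<in> Iw (labels f 0 (Suc n)) \<and> (\<forall>\<nu>\<in>cylinder (labels f 0 (Suc n)) B. Q \<nu>)"
proof -
  obtain N B where B: "B \<in> snd (f N)" "B \<in> Iw (labels f 0 (Suc N))"
    "\<forall>\<nu>\<in>cylinder (labels f 0 (Suc N)) B. Q \<nu>" using Q unfolding nhd_def by blast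
  have BI: "B \<in> I (fst (f N))" using snd_edge_in_I[OF chainD(1)[OF f order.refl] B(1)] .
  show ?thesis
  proof (intro exI allI impI)
    fix n assume n: "N \<le> n"
    let ?B = "\<theta>w (labels f (Suc N) (Suc n)) B"
    have "?B \<in> snd (f n)" using snd_edge_transport[OF f n order.refl BI] B(1) by simp
    moreover have "?B \<in> Iw (labels f 0 (Suc N) @ labels f (Suc N) (Suc n))"
      using B(2) set_labels_subset_L[OF f[of n]] by (intro Iw_\<theta>w_append) (simp_all add: labels_Cons)
    moreover have "labels f 0 (Suc n) = labels f 0 (Suc N) @ labels f (Suc N) (Suc n)"
      using n by (intro labels_append) simp_all
    moreover have "\<nu> \<in> cylinder (labels f 0 (Suc N)) B" if \<nu>: "\<nu> \<in> cylinder (labels f 0 (Suc n)) ?B" for \<nu>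
    proof -
      have "B \<in> snd (edge_at \<nu> N)" by (rule cylinder_transport[OF \<nu> n BI order.refl])
      moreover have "enat N < plength \<nu>"
        using \<nu> n by (auto simp: cylinder_labels_iff intro: le_less_trans[of "enat N" "enat n"])
      ultimately show ?thesis using \<nu> n by (auto simp: cylinder_labels_iff)
    qed
    ultimately show "\<exists>B\<in>snd (f n). B \<in> Iw (labels f 0 (Suc n)) \<and> (\<forall>\<nu>\<in>cylinder (labels f 0 (Suc n)) B. Q \<nu>)"
      using B(3) by (intro bexI[of _ ?B]) auto
  qed
qed

lemma nhd_conj:
  assumes f: "\<And>n. chain f n" and P: "nhd f P" and Q: "nhd f Q"
  shows "nhd f (\<lambda>\<nu>. P \<nu> \<and> Q \<nu>)"
proof -
  obtain N where N: "\<And>n. n \<ge> N \<Longrightarrow>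
      \<exists>B\<in>snd (f n). B \<in> Iw (labels f 0 (Suc n)) \<and> (\<forall>\<nu>\<in>cylinder (labels f 0 (Suc n)) B. P \<nu>)"
    using nhd_later[OF f P] by auto
  obtain M where M: "\<And>n. n \<ge> M \<Longrightarrow>
      \<exists>B\<in>snd (f n). B \<in> Iw (labels f 0 (Suc n)) \<and> (\<forall>\<nu>\<in>cylinder (labels f 0 (Suc n)) B. Q \<nu>)"
    using nhd_later[OF f Q] by auto
  define n where "n = max N M"
  obtain B C where B: "B \<in> snd (f n)" "B \<in> Iw (labels f 0 (Suc n))" "\<forall>\<nu>\<in>cylinder (labels f 0 (Suc n)) B. P \<nu>"
    and C: "C \<in> snd (f n)" "C \<in> Iw (labels f 0 (Suc n))" "\<forall>\<nu>\<in>cylinder (labels f 0 (Suc n)) C. Q \<nu>"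
    using N[of n] M[of n] by (auto simp: n_def)
  note e = chainD(1)[OF f order.refl, of n]
  have sub: "cylinder (labels f 0 (Suc n)) (inf B C) \<subseteq> cylinder (labels f 0 (Suc n)) D"
    if "D \<in> snd (f n)" "inf B C \<le> D" for D
  proof
    fix \<nu> assume \<nu>: "\<nu> \<in> cylinder (labels f 0 (Suc n)) (inf B C)"
    have "D \<in> snd (edge_at \<nu> n)"
      using cylinder_transport[OF \<nu> order.refl] snd_edge_in_I[OF e that(1)] that(2) by simp
    then show "\<nu> \<in> cylinder (labels f 0 (Suc n)) D" using \<nu> by (auto simp: cylinder_labels_iff)
  qed
  have "inf B C \<in> snd (f n)" using snd_edge_inf[OF e B(1) C(1)] .
  moreover have "inf B C \<in> Iw (labels f 0 (Suc n))" using Iw_downward[OF B(2)] by simp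
  ultimately show ?thesis
    unfolding nhd_def using B(3) C(3) sub[OF B(1)] sub[OF C(1)]
    by (intro exI[of _ n] bexI[of _ "inf B C"]) auto
qed

lemma nhd_edge:
  assumes f: "\<And>n. chain f n" and A: "A \<in> snd (f i)"
  shows "nhd f (\<lambda>\<nu>. enat i < plength \<nu> \<and> fst (edge_at \<nu> i) = fst (f i) \<and> A \<in> snd (edge_at \<nu> i))"
proof -
  obtain Y where Y: "Y \<in> snd (f i)" "Y \<in> Iw (labels f 0 (Suc i))" using ex_Iw_member[OF f] by blast
  note e = chainD(1)[OF f order.refl, of i]
  have "inf A Y \<in> snd (f i)" using snd_edge_inf[OF e A Y(1)] .
  moreover have "inf A Y \<in> Iw (labels f 0 (Suc i))" using Iw_downward[OF Y(2)] by simp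
  moreover have "A \<in> snd (edge_at \<nu> i)" if \<nu>: "\<nu> \<in> cylinder (labels f 0 (Suc i)) (inf A Y)" for \<nu>
    using cylinder_transport[OF \<nu> order.refl, of A] snd_edge_in_I[OF e A] by simp
  ultimately show ?thesis
    unfolding nhd_def by (intro exI[of _ i] bexI[of _ "inf A Y"]) (auto simp: cylinder_labels_iff)
qed

lemma nhd_finite:
  assumes f: "\<And>n. chain f n" and fin: "finite K" and Q: "\<And>k. k \<in> K \<Longrightarrow> nhd f (Q k)"
  shows "nhd f (\<lambda>\<nu>. \<forall>k\<in>K. Q k \<nu>)"
  using fin Q
proof (induction K)
  case empty
  obtain A where "A \<in> snd (f 0)" using ex_Iw_member[OF f] by blast
  then show ?case using nhd_mono[OF nhd_edge[OF f]] by simp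
next
  case (insert k K)
  then show ?case using nhd_conj[OF f, of "Q k" "\<lambda>\<nu>. \<forall>k\<in>K. Q k \<nu>"] by simp
qed


section \<open>The topology of the boundary path space\<close>

lemma openin_En_coordinate:
  assumes V: "openin E1_top V" and k: "k < n"
  shows "openin (En_top n) {es \<in> En n. es ! k \<in> V}"
proof -
  let ?P = "product_topology (\<lambda>_. E1_top) {..<n}"
  have "openin ?P {h \<in> topspace ?P. h k \<in> V}"
  proof (rule openin_continuous_map_preimage[OF _ V])
    show "continuous_map ?P E1_top (\<lambda>h. h k)"
      using k by (intro continuous_map_product_projection) simp
  qed
  moreover have "{es \<in> En n. es ! k \<in> V} =
      (\<lambda>es. restrict ((!) es) {..<n}) -` {h \<in> topspace ?P. h k \<in> V} \<inter> En n"
    using k by (auto simp: En_def topspace_E1_top subset_eq)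
  ultimately show ?thesis
    unfolding En_top_def openin_pullback_topology by blast
qed

lemma En_top_neighborhood:
  assumes W: "openin (En_top n) W" and es: "es \<in> W"
  shows "\<exists>B. (\<forall>k<n. B k \<in> snd (es ! k)) \<and>
    (\<forall>fs\<in>En n. (\<forall>k<n. fst (fs ! k) = fst (es ! k) \<and> B k \<in> snd (fs ! k)) \<longrightarrow> fs \<in> W)"
proof -
  let ?P = "product_topology (\<lambda>_. E1_top) {..<n}"
  let ?r = "\<lambda>es::('l, 'b) edge list. restrict ((!) es) {..<n}"
  obtain O' where O': "openin ?P O'" "W = ?r -` O' \<inter> En n"
    using W unfolding En_top_def openin_pullback_topology by blast
  have "?r es \<in> O'" using O'(2) es by blast
  then obtain V where V: "\<forall>i\<in>{..<n}. openin E1_top (V i)" "?r es \<in> Pi\<^sub>E {..<n} V"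
    "Pi\<^sub>E {..<n} V \<subseteq> O'"
    using O'(1) unfolding openin_product_topology_alt by blast
  have "\<exists>B. k < n \<longrightarrow> B \<in> snd (es ! k) \<and> Z1 (fst (es ! k)) B \<subseteq> V k" for k
  proof (cases "k < n")
    case True
    then have "es ! k \<in> V k" using V(2) by (auto simp: PiE_iff)
    then show ?thesis using E1_top_neighborhood(2)[of "V k" "es ! k"] V(1) True by blast
  qed simp
  then obtain B where B: "\<And>k. k < n \<Longrightarrow> B k \<in> snd (es ! k)"
    "\<And>k. k < n \<Longrightarrow> Z1 (fst (es ! k)) (B k) \<subseteq> V k" by metis
  have "fs \<in> W"
    if fs: "fs \<in> En n" and k: "\<forall>k<n. fst (fs ! k) = fst (es ! k) \<and> B k \<in> snd (fs ! k)" for fs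
  proof -
    have "fs ! i \<in> V i" if i: "i < n" for i
    proof -
      have "fs ! i \<in> E1" using fs i by (auto simp: En_def)
      moreover from this have "fst (es ! i) \<in> L" using k i by (auto simp: E1_iff)
      ultimately have "fs ! i \<in> Z1 (fst (es ! i)) (B i)" using k i Z1_iff by blast
      then show ?thesis using B(2)[OF i] by blast
    qed
    then have "?r fs \<in> Pi\<^sub>E {..<n} V" by auto
    then show ?thesis using V(3) O'(2) fs by blast
  qed
  then show ?thesis using B(1) by (intro exI[of _ B]) blast
qed

lemma Estar_open_FinPath:
  assumes W: "openin (En_top n) W" "W \<subseteq> En n" and n: "n \<ge> 1"
  shows "openin Estar_top (FinPath ` W)"
proof -
  have F: "FinPath -` FinPath ` W \<inter> {es. length es = m} = (if m = n then W else {})" for m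
    using W(2) by (auto simp: En_def)
  have V: "Vertex -` FinPath ` W = {}" by auto
  have "FinPath ` W \<subseteq> Estar" unfolding Estar_def using W(2) n by fastforce
  then show ?thesis
    unfolding openin_Estar_top Estar_open_def F V using W(1) by simp
qed

lemma Estar_open_Vertex: "openin Estar_top (Vertex ` Z0 A)"
proof -
  have V: "Vertex -` Vertex ` Z0 A = Z0 A" "FinPath -` Vertex ` Z0 A = {}"
    by auto
  have "Vertex ` Z0 A \<subseteq> Estar" by (auto simp: Z0_def Estar_def)
  then show ?thesis
    unfolding openin_Estar_top Estar_open_def V using openin_E0_top_Z0 by simp
qed

lemma topspace_Estar_top: "topspace Estar_top = Estar"
proof
  show "topspace Estar_top \<subseteq> Estar"
    unfolding topspace_def openin_Estar_top Estar_open_def by blast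
  show "Estar \<subseteq> topspace Estar_top"
  proof
    fix q assume "q \<in> Estar"
    then consider \<xi> where "\<xi> \<in> E0" "q = Vertex \<xi>" | n es where "n \<ge> 1" "es \<in> En n" "q = FinPath es"
      by (auto simp: Estar_def)
    then show "q \<in> topspace Estar_top"
    proof cases
      case 1
      then obtain A where "A \<in> \<xi>" using E0_nonempty by blast
      then have "q \<in> Vertex ` Z0 A" using 1 by (simp add: Z0_def)
      then show ?thesis using openin_subset[OF Estar_open_Vertex] by blast
    next
      case 2
      have "openin E1_top E1" using openin_topspace[of E1_top] by (simp add: topspace_E1_top)
      then have "openin (En_top n) {es \<in> En n. es ! 0 \<in> E1}"
        using 2(1) by (intro openin_En_coordinate) auto
      then have "openin Estar_top (FinPath ` {es \<in> En n. es ! 0 \<in> E1})"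
        using 2(1) by (intro Estar_open_FinPath) auto
      moreover have "es ! 0 \<in> E1"
        using 2(1,2) nth_mem[of 0 es] unfolding En_def by (auto simp del: nth_mem)
      then have "q \<in> FinPath ` {es \<in> En n. es ! 0 \<in> E1}" using 2 by blast
      ultimately show ?thesis using openin_subset by blast
    qed
  qed
qed

lemma boundary_subset_ZZ_Estar: "boundary \<subseteq> ZZ Estar"
proof
  fix \<mu> assume \<mu>: "\<mu> \<in> boundary"
  show "\<mu> \<in> ZZ Estar"
  proof (cases "0 < plength \<mu>")
    case True
    then have le: "enat (Suc 0) \<le> plength \<mu>" by (simp add: Suc_ile_eq zero_enat_def)
    have "chain (edge_at \<mu>) 0" using boundary_chain[OF \<mu>, of 0] True by (simp add: zero_enat_def)
    then have "initial_edges (Suc 0) \<mu> \<in> En (Suc 0)"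
      using le by (simp add: En_Suc_iff initial_edges_edge_at chain_def)
    then have "FinPath (initial_edges (Suc 0) \<mu>) \<in> Estar" by (auto simp: Estar_def)
    then show ?thesis using \<mu> le unfolding ZZ_def by fastforce
  next
    case False
    then obtain \<xi> where "\<mu> = Vertex \<xi>" using plength_eq_0[OF \<mu>] by blast
    then show ?thesis using \<mu> by (auto simp: ZZ_def Estar_def boundary_Vertex E0_sg_iff)
  qed
qed

lemma openin_boundary_ZZ:
  assumes "openin Estar_top S"
  shows "openin boundary_top (ZZ S)"
proof -
  have "ZZ S \<inter> (boundary - ZZ {}) = ZZ S" by (auto simp: ZZ_def)
  moreover have "openin boundary_top (ZZ S \<inter> (boundary - ZZ {}))"
    unfolding boundary_top_def using assms by (intro topology_generated_by_Basis) auto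
  ultimately show ?thesis by simp
qed

lemma topspace_boundary_top: "topspace boundary_top = boundary"
proof
  show "topspace boundary_top \<subseteq> boundary" by (auto simp: boundary_top_def)
  have "openin Estar_top Estar" using openin_topspace[of Estar_top] by (simp add: topspace_Estar_top)
  then show "boundary \<subseteq> topspace boundary_top"
    using openin_subset[OF openin_boundary_ZZ] boundary_subset_ZZ_Estar by blast
qed

lemma openin_label: "a \<in> L \<Longrightarrow> openin E1_top {e \<in> E1. fst e = a}"
proof -
  assume a: "a \<in> L"
  have "{e \<in> E1. fst e = a} = (\<Union>B\<in>I a. Z1 a B)"
  proof (intro equalityI subsetI)
    fix e assume e: "e \<in> {e \<in> E1. fst e = a}"
    then obtain B where "B \<in> snd e" using ultrafilter_nonempty E1_iff by blast
    then show "e \<in> (\<Union>B\<in>I a. Z1 a B)" using e snd_edge_in_I Z1_iff[OF a] by blast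
  qed (use Z1_iff[OF a] in blast)
  then show ?thesis using openin_E1_top_Z1[OF a] by auto
qed

lemma openin_cylinder:
  assumes w: "w \<noteq> []" "set w \<subseteq> L" and B: "B \<in> I (last w)"
  shows "openin boundary_top (cylinder w B)"
proof -
  obtain n where n: "length w = Suc n" using w(1) by (cases w) auto
  have wk: "w ! k \<in> L" if "k < Suc n" for k using w(2) n that by (metis nth_mem subsetD)
  have lw: "last w = w ! n" using w(1) n by (simp add: last_conv_nth)
  define V where "V k = (if k = n then Z1 (w ! n) B else {e \<in> E1. fst e = w ! k})" for k
  define W where "W = (\<Inter>k\<in>{..n}. {es \<in> En (Suc n). es ! k \<in> V k})"
  have "openin E1_top (V k)" if "k \<le> n" for k
    using wk[of k] wk[of n] that B lw openin_E1_top_Z1 openin_label by (simp add: V_def)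
  then have "openin (En_top (Suc n)) W"
    unfolding W_def by (intro openin_INT2 openin_En_coordinate) auto
  moreover have Wsub: "W \<subseteq> En (Suc n)" by (auto simp: W_def)
  ultimately have "openin Estar_top (FinPath ` W)" by (intro Estar_open_FinPath) auto
  moreover have "cylinder w B = ZZ (FinPath ` W)"
  proof (intro equalityI subsetI)
    fix \<mu> assume \<mu>: "\<mu> \<in> cylinder w B"
    then have \<mu>': "\<mu> \<in> boundary" "enat (Suc n) \<le> plength \<mu>" "B \<in> snd (edge_at \<mu> n)"
      "labels (edge_at \<mu>) 0 (Suc n) = w" by (auto simp: cylinder_def n)
    then have fe: "fst (edge_at \<mu> k) = w ! k" if "k \<le> n" for k
      using that nth_labels[of k "Suc n" 0 "edge_at \<mu>"] by auto
    have c: "chain (edge_at \<mu>) n" using boundary_chain \<mu>' by (simp add: Suc_ile_eq)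
    let ?es = "initial_edges (Suc n) \<mu>"
    have es: "?es = map (edge_at \<mu>) [0..<Suc n]" using \<mu>'(2) by (rule initial_edges_edge_at)
    have "chain ((!) ?es) n"
      using c chain_cong[of n "(!) ?es" "edge_at \<mu>"] by (simp add: es del: upt_Suc)
    then have "?es \<in> En (Suc n)" by (simp add: En_Suc_iff es)
    moreover have "?es ! k \<in> V k" if "k \<le> n" for k
      using that chainD(1)[OF c that] fe[OF that] \<mu>'(3) wk[of n]
      by (auto simp: es V_def Z1_iff simp del: upt_Suc)
    ultimately have "?es \<in> W" by (auto simp: W_def)
    then show "\<mu> \<in> ZZ (FinPath ` W)" using \<mu>' unfolding ZZ_def by fastforce
  next
    fix \<mu> assume "\<mu> \<in> ZZ (FinPath ` W)"
    then obtain i where i: "\<mu> \<in> boundary" "enat i \<le> plength \<mu>" "initial_edges i \<mu> \<in> W"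
      by (auto simp: ZZ_def)
    have es: "initial_edges i \<mu> = map (edge_at \<mu>) [0..<i]" using i(2) by (rule initial_edges_edge_at)
    have "length (initial_edges i \<mu>) = Suc n" using i(3) Wsub by (auto simp: En_def)
    then have [simp]: "i = Suc n" by (simp add: es)
    have es: "initial_edges (Suc n) \<mu> = map (edge_at \<mu>) [0..<Suc n]" using es by simp
    have V: "edge_at \<mu> k \<in> V k" if "k \<le> n" for k
      using i(3) that by (auto simp: W_def es simp del: upt_Suc)
    have "fst (edge_at \<mu> k) = w ! k" if "k \<le> n" for k
      using V[OF that] wk[of n] by (auto simp: V_def Z1_iff split: if_splits)
    moreover have "B \<in> snd (edge_at \<mu> n)" using V[of n] wk[of n] by (simp add: V_def Z1_iff)
    ultimately show "\<mu> \<in> cylinder w B"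
      using i(1,2) n by (auto simp: cylinder_def labels_def intro!: nth_equalityI simp del: upt_Suc)
  qed
  ultimately show ?thesis using openin_boundary_ZZ by simp
qed

lemma path_r_in_ZZ_Vertex: "ZZ (Vertex ` Z0 A) = {\<mu> \<in> boundary. A \<in> path_r \<mu>}"
  using path_r_in_E0 by (auto simp: ZZ_def Z0_def)

lemma openin_path_r: "openin boundary_top {\<mu> \<in> boundary. A \<in> path_r \<mu>}"
  using openin_boundary_ZZ[OF Estar_open_Vertex] by (simp add: path_r_in_ZZ_Vertex)

lemma initial_edges_in_En:
  assumes "\<nu> \<in> boundary" "enat n < plength \<nu>"
  shows "initial_edges (Suc n) \<nu> \<in> En (Suc n)" "\<And>k. k \<le> n \<Longrightarrow> initial_edges (Suc n) \<nu> ! k = edge_at \<nu> k"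
proof -
  have es: "initial_edges (Suc n) \<nu> = map (edge_at \<nu>) [0..<Suc n]"
    using assms(2) by (intro initial_edges_edge_at) (simp add: Suc_ile_eq)
  show k: "initial_edges (Suc n) \<nu> ! k = edge_at \<nu> k" if "k \<le> n" for k
    using that by (simp add: es del: upt_Suc)
  have "chain ((!) (initial_edges (Suc n) \<nu>)) n"
    using boundary_chain[OF assms] chain_cong[of n "(!) (initial_edges (Suc n) \<nu>)" "edge_at \<nu>"] k by simp
  then show "initial_edges (Suc n) \<nu> \<in> En (Suc n)" by (simp add: En_Suc_iff es)
qed

text \<open>An infinite path lies in \<open>ZZ S\<close> because of a condition on its range or on finitely many of
  its first edges, and an open condition of this kind holds on a cylinder.\<close>

lemma nhd_ZZ_open:
  assumes f: "\<And>n. chain f n" and S: "openin Estar_top S" and fS: "InfPath f \<in> ZZ S"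
  shows "nhd f (\<lambda>\<nu>. \<nu> \<in> ZZ S)"
proof -
  consider "Vertex (edge_r (f 0)) \<in> S"
    | n where "FinPath (initial_edges (Suc n) (InfPath f)) \<in> S"
  proof -
    assume 1: "Vertex (edge_r (f 0)) \<in> S \<Longrightarrow> thesis"
      and 2: "\<And>n. FinPath (initial_edges (Suc n) (InfPath f)) \<in> S \<Longrightarrow> thesis"
    have "Vertex (edge_r (f 0)) \<in> S \<or> (\<exists>i\<ge>1. FinPath (initial_edges i (InfPath f)) \<in> S)"
      using fS by (auto simp: ZZ_def)
    then show thesis
    proof
      assume "\<exists>i\<ge>1. FinPath (initial_edges i (InfPath f)) \<in> S"
      then obtain i where "i \<ge> 1" "FinPath (initial_edges i (InfPath f)) \<in> S" by blast
      then show thesis using 2[of "i - 1"] by simp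
    qed (rule 1)
  qed
  then show ?thesis
  proof cases
    case 1
    have "openin E0_top (Vertex -` S)" using S by (simp add: openin_Estar_top Estar_open_def)
    then obtain A where A: "A \<in> edge_r (f 0)" "Z0 A \<subseteq> Vertex -` S"
      using E0_top_neighborhood 1 by blast
    have "\<theta> (fst (f 0)) A \<in> snd (f 0)" using A(1) by (simp add: edge_r_iff)
    then have "nhd f (\<lambda>\<nu>. enat 0 < plength \<nu> \<and> fst (edge_at \<nu> 0) = fst (f 0) \<and>
        \<theta> (fst (f 0)) A \<in> snd (edge_at \<nu> 0))" by (rule nhd_edge[OF f])
    then show ?thesis
    proof (rule nhd_mono)
      fix \<nu> assume \<nu>: "\<nu> \<in> boundary" "enat 0 < plength \<nu> \<and> fst (edge_at \<nu> 0) = fst (f 0) \<and>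
        \<theta> (fst (f 0)) A \<in> snd (edge_at \<nu> 0)"
      then have "A \<in> path_r \<nu>" by (simp add: path_r_edge_at zero_enat_def edge_r_iff)
      then have "path_r \<nu> \<in> Z0 A" using path_r_in_E0[OF \<nu>(1)] by (auto simp: Z0_def)
      then show "\<nu> \<in> ZZ S" using A(2) \<nu>(1) by (auto simp: ZZ_def)
    qed
  next
    case (2 n)
    let ?es = "initial_edges (Suc n) (InfPath f)"
    let ?W = "FinPath -` S \<inter> {es. length es = Suc n}"
    have fb: "InfPath f \<in> boundary" using f by (simp add: boundary_InfPath)
    have k: "?es ! k = f k" if "k \<le> n" for k using initial_edges_in_En(2)[OF fb, of n k] that by simp
    have "openin (En_top (Suc n)) ?W" using S by (simp add: openin_Estar_top Estar_open_def)
    moreover have "?es \<in> ?W" using 2 by simp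
    ultimately obtain B where B: "\<forall>k<Suc n. B k \<in> snd (?es ! k)"
      "\<forall>fs\<in>En (Suc n). (\<forall>k<Suc n. fst (fs ! k) = fst (?es ! k) \<and> B k \<in> snd (fs ! k)) \<longrightarrow> fs \<in> ?W"
      using En_top_neighborhood by blast
    have "nhd f (\<lambda>\<nu>. \<forall>k\<in>{..n}. enat k < plength \<nu> \<and> fst (edge_at \<nu> k) = fst (f k) \<and>
        B k \<in> snd (edge_at \<nu> k))"
    proof (rule nhd_finite[OF f])
      show "nhd f (\<lambda>\<nu>. enat k < plength \<nu> \<and> fst (edge_at \<nu> k) = fst (f k) \<and> B k \<in> snd (edge_at \<nu> k))"
        if "k \<in> {..n}" for k
        using B(1) k[of k] that by (intro nhd_edge[OF f]) (metis atMost_iff less_Suc_eq_le)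
    qed simp
    then show ?thesis
    proof (rule nhd_mono)
      fix \<nu> assume \<nu>: "\<nu> \<in> boundary" "\<forall>k\<in>{..n}. enat k < plength \<nu> \<and>
          fst (edge_at \<nu> k) = fst (f k) \<and> B k \<in> snd (edge_at \<nu> k)"
      then have len: "enat n < plength \<nu>" by simp
      have "initial_edges (Suc n) \<nu> \<in> ?W"
        using B(2)[rule_format, OF initial_edges_in_En(1)[OF \<nu>(1) len]]
          initial_edges_in_En(2)[OF \<nu>(1) len] \<nu>(2) k by (simp add: less_Suc_eq_le)
      moreover have "enat (Suc n) \<le> plength \<nu>" using len by (simp add: Suc_ile_eq)
      ultimately show "\<nu> \<in> ZZ S" using \<nu>(1) unfolding ZZ_def by fastforce
    qed
  qed
qed

text \<open>Edges are separated by their labels, or else by complementary elements of their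
  ultrafilters.\<close>

lemma nhd_avoids_edge:
  assumes f: "\<And>n. chain f n" and e: "e \<in> E1" "e \<noteq> f k"
  shows "\<exists>A\<in>snd e. nhd f (\<lambda>\<nu>. enat k < plength \<nu> \<and> edge_at \<nu> k \<notin> Z1 (fst e) A)"
proof -
  have fk: "f k \<in> E1" by (rule chainD(1)[OF f order.refl])
  have eL: "fst e \<in> L" using e(1) by (simp add: E1_iff)
  obtain X where X: "X \<in> snd (f k)" using ultrafilter_nonempty fk E1_iff by blast
  show ?thesis
  proof (cases "fst e = fst (f k)")
    case False
    obtain A where "A \<in> snd e" using ultrafilter_nonempty e(1) E1_iff by blast
    moreover have "nhd f (\<lambda>\<nu>. enat k < plength \<nu> \<and> edge_at \<nu> k \<notin> Z1 (fst e) A)"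
      by (rule nhd_mono[OF nhd_edge[OF f X]]) (use False Z1_iff[OF eL] in auto)
    ultimately show ?thesis by blast
  next
    case True
    have uf: "snd e \<in> ba_ultrafilters (I (fst e))" "snd (f k) \<in> ba_ultrafilters (I (fst e))"
      using e(1) fk True by (auto simp: E1_iff)
    have "snd e \<noteq> snd (f k)" using e(2) True by (simp add: prod_eq_iff)
    then obtain A where A: "A \<in> snd e" "A \<notin> snd (f k)"
      using ultrafilter_eq_of_subset[OF uf] by blast
    have AI: "A \<in> I (fst e)" using snd_edge_in_I[OF e(1) A(1)] .
    have "X - A \<in> snd (f k)" using snd_edge_diff[OF fk X _ A(2)] AI True by simp
    then have "nhd f (\<lambda>\<nu>. enat k < plength \<nu> \<and> fst (edge_at \<nu> k) = fst (f k) \<and> X - A \<in> snd (edge_at \<nu> k))"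
      by (rule nhd_edge[OF f])
    then have "nhd f (\<lambda>\<nu>. enat k < plength \<nu> \<and> edge_at \<nu> k \<notin> Z1 (fst e) A)"
    proof (rule nhd_mono, intro conjI notI)
      fix \<nu> assume \<nu>: "enat k < plength \<nu> \<and> fst (edge_at \<nu> k) = fst (f k) \<and> X - A \<in> snd (edge_at \<nu> k)"
        "edge_at \<nu> k \<in> Z1 (fst e) A"
      then have "inf (X - A) A \<noteq> bot"
        using ultrafilter_disjoint[OF ideal[OF eL]] Z1_iff[OF eL] E1_iff by metis
      then show False by (simp add: inf_diff_bot)
    qed simp
    then show ?thesis using A(1) by blast
  qed
qed

text \<open>Each point \<open>q\<close> of \<open>K\<close> has an open neighbourhood \<open>S\<close> such that a whole cylinder around \<open>f\<close>
  avoids \<open>ZZ S\<close>.  Finitely many such neighbourhoods cover \<open>K\<close>, and the corresponding cylinders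
  have a common refinement.  The range of \<open>f\<close> may be empty, so that it is not a vertex; the
  argument for a vertex \<open>q\<close> only uses that it is not contained in the range.\<close>

lemma nhd_not_ZZ_compact:
  assumes f: "\<And>n. chain f n" and K: "compactin Estar_top K" and fK: "InfPath f \<notin> ZZ K"
  shows "nhd f (\<lambda>\<nu>. \<nu> \<notin> ZZ K)"
proof -
  have fb: "InfPath f \<in> boundary" using f by (simp add: boundary_InfPath)
  have "\<exists>S. openin Estar_top S \<and> q \<in> S \<and> nhd f (\<lambda>\<nu>. \<nu> \<notin> ZZ S)" if q: "q \<in> K" for q
  proof -
    have qE: "q \<in> Estar" using K q compactin_subset_topspace topspace_Estar_top by blast
    have "(\<exists>\<xi>\<in>E0. q = Vertex \<xi>) \<or> (\<exists>n. \<exists>es\<in>En (Suc n). q = FinPath es)"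
    proof (cases q)
      case (FinPath es)
      then obtain n where "n \<ge> 1" "es \<in> En n" using qE by (auto simp: Estar_def)
      then have "es \<in> En (Suc (n - 1))" by simp
      then show ?thesis using FinPath by blast
    qed (use qE in \<open>auto simp: Estar_def\<close>)
    then consider \<xi> where "\<xi> \<in> E0" "q = Vertex \<xi>"
      | n es where "es \<in> En (Suc n)" "q = FinPath es" by blast
    then show ?thesis
    proof cases
      case 1
      have e0: "f 0 \<in> E1" by (rule chainD(1)[OF f order.refl])
      have aL: "fst (f 0) \<in> L" using e0 by (simp add: E1_iff)
      have "\<not> \<xi> \<subseteq> edge_r (f 0)"
      proof
        assume sub: "\<xi> \<subseteq> edge_r (f 0)"
        then have "edge_r (f 0) \<in> E0" using edge_r_in_E0[OF e0] E0_nonempty[OF 1(1)] by blast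
        then have "\<xi> = edge_r (f 0)" using E0_eq_of_subset[OF 1(1) _ sub] by blast
        then show False using fK q 1(2) fb by (auto simp: ZZ_def)
      qed
      then obtain A where A: "A \<in> \<xi>" "\<theta> (fst (f 0)) A \<notin> snd (f 0)"
        unfolding edge_r_alt by blast
      obtain X where X: "X \<in> snd (f 0)" using ultrafilter_nonempty e0 E1_iff by blast
      let ?B = "X - \<theta> (fst (f 0)) A"
      have "?B \<in> snd (f 0)" using snd_edge_diff[OF e0 X \<theta>_in_I[OF aL] A(2)] .
      then have "nhd f (\<lambda>\<nu>. enat 0 < plength \<nu> \<and> fst (edge_at \<nu> 0) = fst (f 0) \<and> ?B \<in> snd (edge_at \<nu> 0))"
        by (rule nhd_edge[OF f])
      then have "nhd f (\<lambda>\<nu>. \<nu> \<notin> ZZ (Vertex ` Z0 A))"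
      proof (rule nhd_mono, intro notI)
        fix \<nu> assume \<nu>: "\<nu> \<in> boundary" "enat 0 < plength \<nu> \<and> fst (edge_at \<nu> 0) = fst (f 0) \<and>
          ?B \<in> snd (edge_at \<nu> 0)" "\<nu> \<in> ZZ (Vertex ` Z0 A)"
        have "A \<in> edge_r (edge_at \<nu> 0)"
          using \<nu> by (simp add: path_r_in_ZZ_Vertex path_r_edge_at zero_enat_def)
        then have in2: "\<theta> (fst (f 0)) A \<in> snd (edge_at \<nu> 0)" using \<nu>(2) by (simp add: edge_r_iff)
        have "snd (edge_at \<nu> 0) \<in> ba_ultrafilters (I (fst (f 0)))"
          using chainD(1)[OF boundary_chain[OF \<nu>(1), of 0], of 0] \<nu>(2) by (simp add: E1_iff)
        then have "inf ?B (\<theta> (fst (f 0)) A) \<noteq> bot"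
          using ultrafilter_disjoint[OF ideal[OF aL] _ _ in2] \<nu>(2) by metis
        then show False by (simp add: inf_diff_bot)
      qed
      then show ?thesis using Estar_open_Vertex 1 A(1)
        by (intro exI[of _ "Vertex ` Z0 A"]) (simp add: Z0_def)
    next
      case (2 n es)
      have "es \<noteq> initial_edges (Suc n) (InfPath f)"
      proof
        assume "es = initial_edges (Suc n) (InfPath f)"
        then have "FinPath (initial_edges (Suc n) (InfPath f)) \<in> K" using q 2(2) by simp
        then have "InfPath f \<in> ZZ K" using fb unfolding ZZ_def by fastforce
        then show False using fK by simp
      qed
      moreover have "length es = Suc n" using 2(1) by (simp add: En_Suc_iff)
      ultimately have "\<exists>k\<le>n. es ! k \<noteq> f k"
        by (auto simp: list_eq_iff_nth_eq less_Suc_eq_le simp del: upt_Suc)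
      then obtain k where k: "k \<le> n" "es ! k \<noteq> f k" by blast
      have ek: "es ! k \<in> E1" using 2(1) k(1) by (auto simp: En_Suc_iff dest: chainD(1))
      then have eL: "fst (es ! k) \<in> L" by (simp add: E1_iff)
      obtain A where A: "A \<in> snd (es ! k)"
        "nhd f (\<lambda>\<nu>. enat k < plength \<nu> \<and> edge_at \<nu> k \<notin> Z1 (fst (es ! k)) A)"
        using nhd_avoids_edge[OF f ek k(2)] by blast
      let ?W = "{fs \<in> En (Suc n). fs ! k \<in> Z1 (fst (es ! k)) A}"
      have "openin E1_top (Z1 (fst (es ! k)) A)"
        using openin_E1_top_Z1[OF eL snd_edge_in_I[OF ek A(1)]] .
      then have "openin (En_top (Suc n)) ?W" using k(1) by (intro openin_En_coordinate) auto
      then have "openin Estar_top (FinPath ` ?W)" by (intro Estar_open_FinPath) auto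
      moreover have "q \<in> FinPath ` ?W" using 2 Z1_iff[OF eL] ek A(1) by blast
      moreover have "nhd f (\<lambda>\<nu>. \<nu> \<notin> ZZ (FinPath ` ?W))"
      proof (rule nhd_mono[OF A(2)], intro notI)
        fix \<nu> assume \<nu>: "\<nu> \<in> boundary" "enat k < plength \<nu> \<and> edge_at \<nu> k \<notin> Z1 (fst (es ! k)) A"
          "\<nu> \<in> ZZ (FinPath ` ?W)"
        then obtain i where i: "enat i \<le> plength \<nu>" "initial_edges i \<nu> \<in> ?W" by (auto simp: ZZ_def)
        have ie: "initial_edges i \<nu> = map (edge_at \<nu>) [0..<i]" using i(1) by (rule initial_edges_edge_at)
        have n: "i = Suc n" using i(2) by (auto simp: En_def ie)
        have "map (edge_at \<nu>) [0..<Suc n] ! k \<in> Z1 (fst (es ! k)) A"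
          using i(2) unfolding ie unfolding n by simp
        then have "edge_at \<nu> k \<in> Z1 (fst (es ! k)) A" using k(1) by (simp del: upt_Suc)
        then show False using \<nu>(2) by simp
      qed
      ultimately show ?thesis by blast
    qed
  qed
  then obtain S where S: "\<And>q. q \<in> K \<Longrightarrow> openin Estar_top (S q) \<and> q \<in> S q \<and> nhd f (\<lambda>\<nu>. \<nu> \<notin> ZZ (S q))"
    by metis
  have "\<forall>U\<in>S ` K. openin Estar_top U" "K \<subseteq> \<Union>(S ` K)" using S by auto
  then obtain \<F> where F: "finite \<F>" "\<F> \<subseteq> S ` K" "K \<subseteq> \<Union>\<F>"
    using K unfolding compactin_def by meson
  have "nhd f (\<lambda>\<nu>. \<forall>T\<in>\<F>. \<nu> \<notin> ZZ T)"
    using S F(2) by (intro nhd_finite[OF f F(1)]) auto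
  moreover have "\<nu> \<in> ZZ K \<Longrightarrow> \<exists>T\<in>\<F>. \<nu> \<in> ZZ T" for \<nu>
    using F(3) unfolding ZZ_def by blast
  ultimately show ?thesis using nhd_mono[of f "\<lambda>\<nu>. \<forall>T\<in>\<F>. \<nu> \<notin> ZZ T" "\<lambda>\<nu>. \<nu> \<notin> ZZ K"] by blast
qed

lemma boundary_top_neighborhood:
  assumes f: "\<And>n. chain f n" and W: "openin boundary_top W" and fW: "InfPath f \<in> W"
  shows "nhd f (\<lambda>\<nu>. \<nu> \<in> W)"
  using openin_topology_generated_by[OF W[unfolded boundary_top_def]] fW
proof (induction)
  case (Int a b)
  then show ?case using nhd_conj[OF f, of "\<lambda>\<nu>. \<nu> \<in> a" "\<lambda>\<nu>. \<nu> \<in> b"] by simp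
next
  case (UN K)
  then obtain k where "k \<in> K" "InfPath f \<in> k" by blast
  then show ?case using UN.IH nhd_mono[of f "\<lambda>\<nu>. \<nu> \<in> k" "\<lambda>\<nu>. \<nu> \<in> \<Union>K"] by blast
next
  case (Basis s)
  then obtain S K where SK: "s = ZZ S \<inter> (boundary - ZZ K)" "openin Estar_top S" "compactin Estar_top K"
    by blast
  have "nhd f (\<lambda>\<nu>. \<nu> \<in> ZZ S \<and> \<nu> \<notin> ZZ K)"
    using nhd_conj[OF f nhd_ZZ_open[OF f SK(2)] nhd_not_ZZ_compact[OF f SK(3)]] Basis SK(1) by simp
  then show ?case by (rule nhd_mono) (simp add: SK(1))
qed simp

end

section \<open>A free ultrafilter on the natural numbers\<close>

instance set :: (type) relative_boolean_algebra
  by standard auto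

lemma free_ultrafilter_nat:
  "\<exists>\<U>\<in>ba_ultrafilters (UNIV :: nat set set). \<forall>n. {n..} \<in> \<U>"
proof -
  have "\<exists>F\<in>ba_ultrafilters UNIV. range (atLeast :: nat \<Rightarrow> nat set) \<subseteq> F"
  proof (rule filter_base_extends_to_ultrafilter[OF ba_ideal_UNIV])
    fix A B :: "nat set" assume "A \<in> range atLeast" "B \<in> range atLeast"
    then obtain m n where "A = {m..}" "B = {n..}" by auto
    then show "\<exists>C\<in>range atLeast. C \<le> A \<and> C \<le> B"
      by (intro bexI[of _ "{max m n..}"]) auto
  qed auto
  then show ?thesis by blast
qed

context generalized_boolean_dynamical_system
begin

section \<open>Periodic cylinders come from cycles without exits\<close>

lemma prepend_eq_InfPath:
  assumes "prepend es \<mu> = InfPath f"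
  shows "\<mu> = InfPath (\<lambda>i. f (length es + i))"
proof (cases \<mu>)
  case (InfPath g)
  then have "f = (\<lambda>i. if i < length es then es ! i else g (i - length es))" using assms by simp
  then show ?thesis using InfPath by simp
qed (use assms in \<open>auto split: if_splits\<close>)

lemma prepend_eq_InfPath_nth:
  fixes es :: "('l, 'b) edge list"
  assumes "prepend es \<mu> = InfPath f" "i < length es"
  shows "f i = es ! i"
  using edge_at_prepend(1)[OF assms(2), of \<mu>] assms(1) by simp

lemma prepend_in_cylinder:
  assumes w: "w \<noteq> []" and es: "map fst es = w" "prepend es \<mu> \<in> boundary" "B \<in> snd (last es)"
  shows "prepend es \<mu> \<in> cylinder w B"
proof -
  have len: "length es = length w" using es(1) by auto
  have "labels (edge_at (prepend es \<mu>)) 0 (length w) = w"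
    using es(1) len by (auto simp: labels_def edge_at_prepend(1) intro!: nth_equalityI)
  moreover have "es \<noteq> []" using w es(1) by auto
  then have "edge_at (prepend es \<mu>) (length w - 1) = last es"
    using w len by (subst edge_at_prepend(1)) (simp_all add: last_conv_nth)
  ultimately show ?thesis using es(2,3) len by (simp add: cylinder_def plength_prepend)
qed

text \<open>Every boundary path whose range contains \<open>B\<close> can be prefixed by \<open>w\<close> and then lies in the
  cylinder, so it is infinite; as \<open>w\<close> already covers \<open>k + m\<close> positions, the path is purely periodic
  with period \<open>m\<close>, and its labels do not depend on the path.  They spell \<open>\<gamma>\<gamma>\<gamma>\<dots>\<close> for one word
  \<open>\<gamma>\<close> of length \<open>m\<close>.  Periodicity of the ultrafilters makes \<open>\<gamma>\<close> act trivially below \<open>B\<close>.  Any edge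
  that could leave the cycle would start a path, and that path has been seen to follow \<open>\<gamma>\<close>.\<close>

lemma periodic_cylinder_gives_cycle:
  assumes w: "w \<noteq> []" "set w \<subseteq> L" "B \<in> Iw w" and B0: "B \<noteq> bot"
    and km: "k + m \<le> length w" "0 < m"
    and per: "\<And>\<mu>. \<mu> \<in> cylinder w B \<Longrightarrow> \<exists>f. \<mu> = InfPath f \<and> (\<forall>i\<ge>k. f (i + m) = f i)"
  shows "\<exists>\<alpha> A. cycle \<alpha> A \<and> no_exits \<alpha> A"
proof -
  define fam where "fam g \<longleftrightarrow> InfPath g \<in> boundary \<and> B \<in> edge_r (g 0)" for g
  have inf: "\<exists>g. \<nu> = InfPath g \<and> fam g" if \<nu>: "\<nu> \<in> boundary" "B \<in> path_r \<nu>" for \<nu>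
  proof -
    obtain es where es: "map fst es = w" "prepend es \<nu> \<in> boundary" "B \<in> snd (last es)"
      using prepend_Iw_word[OF \<nu> w(2,1,3)] by blast
    then obtain f where "prepend es \<nu> = InfPath f" using per prepend_in_cylinder[OF w(1)] by blast
    then have "\<nu> = InfPath (\<lambda>i. f (length es + i))" by (rule prepend_eq_InfPath)
    then show ?thesis using \<nu> by (auto simp: fam_def)
  qed
  have tail: "\<exists>f. (\<forall>i\<ge>k. f (i + m) = f i) \<and> (\<forall>i<length w. fst (f i) = w ! i) \<and>
      (\<forall>i. g i = f (length w + i))" if g: "fam g" for g
  proof -
    have "InfPath g \<in> boundary" "B \<in> path_r (InfPath g)" using g by (simp_all add: fam_def)
    then obtain es where es: "map fst es = w" "prepend es (InfPath g) \<in> boundary" "B \<in> snd (last es)"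
      using prepend_Iw_word w by blast
    then obtain f where f: "prepend es (InfPath g) = InfPath f" "\<forall>i\<ge>k. f (i + m) = f i"
      using per prepend_in_cylinder[OF w(1)] by blast
    have len: "length es = length w" using es(1) by auto
    have "fst (f i) = w ! i" if "i < length w" for i
      using prepend_eq_InfPath_nth[OF f(1)] es(1) len that by (metis nth_map)
    moreover have "g i = f (length w + i)" for i
      using prepend_eq_InfPath[OF f(1)] len by (simp add: fun_eq_iff)
    ultimately show ?thesis using f(2) by blast
  qed
  have per': "g (i + m) = g i" if g: "fam g" for g i
  proof -
    obtain f where f: "\<forall>i\<ge>k. f (i + m) = f i" "\<forall>i. g i = f (length w + i)" using tail[OF g] by blast
    then show ?thesis using km by (simp add: add.assoc[symmetric])
  qed
  have same_labels: "fst (g i) = fst (h i)" if gh: "fam g" "fam h" for g h i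
  proof -
    obtain f where f: "\<forall>i\<ge>k. f (i + m) = f i" "\<forall>i<length w. fst (f i) = w ! i"
      "\<forall>i. g i = f (length w + i)" using tail[OF gh(1)] by blast
    obtain f' where f': "\<forall>i\<ge>k. f' (i + m) = f' i" "\<forall>i<length w. fst (f' i) = w ! i"
      "\<forall>i. h i = f' (length w + i)" using tail[OF gh(2)] by blast
    have "fst (f j) = fst (f' j)" for j
    proof (induction j rule: less_induct)
      case (less j)
      show ?case
      proof (cases "j < length w")
        case False
        then have j: "k \<le> j - m" "j - m + m = j" using km(1) by simp_all
        then have "f j = f (j - m)" "f' j = f' (j - m)"
          using f(1)[rule_format, OF j(1)] f'(1)[rule_format, OF j(1)] by simp_all
        then show ?thesis using less[of "j - m"] km False by simp
      qed (use f(2) f'(2) in simp)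
    qed
    then show ?thesis using f(3) f'(3) by simp
  qed
  obtain \<xi>0 where \<xi>0: "\<xi>0 \<in> E0" "B \<in> \<xi>0" using E0_containing[OF B0] by blast
  then obtain \<nu>0 where "\<nu>0 \<in> boundary" "path_r \<nu>0 = \<xi>0" using boundary_path_from by blast
  then obtain g0 where g0: "fam g0" using inf \<xi>0 by blast
  define \<gamma> where "\<gamma> = labels g0 0 m"
  have len\<gamma>: "length \<gamma> = m" by (simp add: \<gamma>_def)
  have \<gamma>L: "set \<gamma> \<subseteq> L"
    using g0 set_labels_subset_L[of g0 m m] by (simp add: fam_def boundary_InfPath \<gamma>_def)
  have \<gamma>labels: "labels g 0 m = \<gamma>" if "fam g" for g
    using same_labels[OF that g0] by (simp add: \<gamma>_def labels_eq_iff)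
  have up: "B \<in> path_r \<nu>" if "\<nu> \<in> boundary" "C \<in> path_r \<nu>" "C \<le> B" for \<nu> C
    using E0_up[OF path_r_in_E0[OF that(1)] that(2,3)] that(2) by blast
  have cyc: "\<theta>w \<gamma> C = C" if C: "C \<le> B" for C
    \<comment> \<open>An ultrafilter on the difference of \<open>C\<close> and \<open>\<theta>w \<gamma> C\<close>, in either order, is the range of a
      path.  In the first case the path itself returns to its range after \<open>m\<close> steps, in the second
      case the path prefixed by \<open>\<gamma>\<close> does; both contradict the choice of the ultrafilter.\<close>
  proof (rule order.antisym; rule ccontr)
    assume "\<not> C \<le> \<theta>w \<gamma> C"
    then have "C - \<theta>w \<gamma> C \<noteq> bot" by (simp add: diff_eq_bot_iff)
    then obtain \<xi> where \<xi>: "\<xi> \<in> E0" "C - \<theta>w \<gamma> C \<in> \<xi>" using E0_containing by blast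
    then obtain \<nu> where \<nu>: "\<nu> \<in> boundary" "path_r \<nu> = \<xi>" using boundary_path_from by blast
    have C\<xi>: "C \<in> \<xi>" by (rule E0_up[OF \<xi> diff_le])
    then obtain g where g: "\<nu> = InfPath g" "fam g" using inf[OF \<nu>(1) up[OF \<nu>(1)]] \<nu>(2) C by blast
    have c: "\<And>n. chain g n" using g by (simp add: fam_def boundary_InfPath)
    have m: "Suc (m - 1) = m" using km(2) by simp
    have "C \<in> edge_r (g 0)" using C\<xi> \<nu>(2) g(1) by simp
    then have "\<theta>w \<gamma> C \<in> snd (g (m - 1))"
      using edge_r_transport[OF c, of C "m - 1"] \<gamma>labels[OF g(2)] m by simp
    then have "\<theta>w \<gamma> C \<in> edge_d (g (m - 1))" by (rule snd_subset_edge_d)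
    also have "edge_d (g (m - 1)) = edge_r (g m)" using chainD(2)[OF c[of m], of "m - 1"] km(2) by simp
    also have "\<dots> = \<xi>" using per'[OF g(2), of 0] \<nu>(2) g(1) by simp
    finally have "inf (C - \<theta>w \<gamma> C) (\<theta>w \<gamma> C) \<in> \<xi>" using E0_inf[OF \<xi>] by blast
    then show False using E0_bot[OF \<xi>(1), of bot] by (simp add: inf_diff_bot)
  next
    assume "\<not> \<theta>w \<gamma> C \<le> C"
    then have "\<theta>w \<gamma> C - C \<noteq> bot" by (simp add: diff_eq_bot_iff)
    then obtain \<xi> where \<xi>: "\<xi> \<in> E0" "\<theta>w \<gamma> C - C \<in> \<xi>" using E0_containing by blast
    then obtain \<nu> where \<nu>: "\<nu> \<in> boundary" "path_r \<nu> = \<xi>" using boundary_path_from by blast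
    have "\<theta>w \<gamma> C - C \<in> path_r \<nu>" using \<xi>(2) \<nu>(2) by simp
    then obtain es where es: "map fst es = \<gamma>" "prepend es \<nu> \<in> boundary" "C \<in> path_r (prepend es \<nu>)"
      using prepend_word[OF \<nu>(1) _ \<gamma>L diff_le] by blast
    then obtain g where g: "prepend es \<nu> = InfPath g" "fam g" using inf up C by blast
    have "length es = m" using es(1) len\<gamma> by auto
    then have "\<nu> = InfPath (\<lambda>i. g (m + i))" using prepend_eq_InfPath[OF g(1)] by simp
    then have "\<nu> = prepend es \<nu>" unfolding g(1) using per'[OF g(2)] by (simp add: add.commute)
    then have "C \<in> \<xi>" using es(3) \<nu>(2) by metis
    then have "inf (\<theta>w \<gamma> C - C) C \<in> \<xi>" using E0_inf[OF \<xi>] by blast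
    then show False using E0_bot[OF \<xi>(1), of bot] by (simp add: inf_diff_bot)
  qed
  have "\<gamma> \<noteq> []" using len\<gamma> km(2) by auto
  then have "cycle \<gamma> B" using \<gamma>L B0 cyc by (simp add: cycle_def)
  moreover have "no_exits \<gamma> B"
  proof -
    have exits: "\<Delta> E = {\<gamma> ! (t mod m)}"
      if t: "t \<in> {1..m}" and E: "E \<noteq> bot" "E \<le> \<theta>w (take t \<gamma>) B" for t E
    proof -
      have \<gamma>t: "\<gamma> ! (t mod m) = fst (g0 t)"
      proof (cases "t = m")
        case True
        then show ?thesis using per'[OF g0, of 0] km(2) by (simp add: \<gamma>_def nth_labels)
      next
        case False
        then show ?thesis using t by (simp add: \<gamma>_def nth_labels)
      qed
      have first: "\<exists>h. \<nu> = InfPath h \<and> fst (h 0) = \<gamma> ! (t mod m)"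
        if \<nu>: "\<nu> \<in> boundary" "E \<in> path_r \<nu>" for \<nu>
      proof -
        have "set (take t \<gamma>) \<subseteq> L" using \<gamma>L set_take_subset by fastforce
        then obtain es where es: "map fst es = take t \<gamma>" "prepend es \<nu> \<in> boundary"
          "B \<in> path_r (prepend es \<nu>)" using prepend_word[OF \<nu> _ E(2)] by blast
        then obtain g where g: "prepend es \<nu> = InfPath g" "fam g" using inf by blast
        have "length es = length (take t \<gamma>)" using es(1) by (metis length_map)
        then have "length es = t" using t len\<gamma> by simp
        then have "\<nu> = InfPath (\<lambda>i. g (t + i))" using prepend_eq_InfPath[OF g(1)] by simp
        then show ?thesis using same_labels[OF g(2) g0, of t] \<gamma>t by simp
      qed
      show ?thesis
      proof (intro equalityI subsetI)
        fix a assume "a \<in> \<Delta> E"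
        then have a: "a \<in> L" "\<theta> a E \<noteq> bot" by (simp_all add: \<Delta>_def)
        obtain e where e: "e \<in> E1" "fst e = a" "E \<in> edge_r e" using edge_with_range_containing[OF a] by blast
        obtain \<nu> where \<nu>: "\<nu> \<in> boundary" "path_r \<nu> = edge_d e"
          using boundary_path_from[OF edge_d_in_E0[OF e(1)]] by blast
        have "prepend [e] \<nu> \<in> boundary" using prepend_edge_in_boundary \<nu> e(1) by simp
        then obtain h where h: "prepend [e] \<nu> = InfPath h" "fst (h 0) = \<gamma> ! (t mod m)"
          using first e(3) by (metis path_r_prepend)
        then show "a \<in> {\<gamma> ! (t mod m)}" using prepend_eq_InfPath_nth[OF h(1), of 0] e(2) by simp
      next
        fix a assume a: "a \<in> {\<gamma> ! (t mod m)}"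
        obtain \<xi> where \<xi>: "\<xi> \<in> E0" "E \<in> \<xi>" using E0_containing[OF E(1)] by blast
        then obtain \<nu> where \<nu>: "\<nu> \<in> boundary" "path_r \<nu> = \<xi>" using boundary_path_from by blast
        then obtain h where h: "\<nu> = InfPath h" "fst (h 0) = \<gamma> ! (t mod m)" using first \<xi>(2) by blast
        have "h 0 \<in> E1" using \<nu>(1) h(1) by (auto simp: boundary_InfPath intro: chainD(1))
        then have "fst (h 0) \<in> \<Delta> E" using edge_r_\<Delta> \<nu>(2) h(1) \<xi>(2) by simp
        then show "a \<in> \<Delta> E" using a h(2) by simp
      qed
    qed
    show ?thesis
      unfolding no_exits_def len\<gamma>
    proof (intro ballI allI impI conjI)
      fix t D assume t: "t \<in> {1..m}" and D: "D \<noteq> bot \<and> D \<le> \<theta>w (take t \<gamma>) B"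
      show "\<Delta> D = {\<gamma> ! (t mod m)}" using exits[OF t] D by blast
      show "regular D"
        unfolding regular_def
      proof (intro allI impI)
        fix E assume "E \<noteq> bot \<and> E \<le> D"
        then have "\<Delta> E = {\<gamma> ! (t mod m)}" using exits[OF t] D order.trans by metis
        then show "finite (\<Delta> E) \<and> \<Delta> E \<noteq> {}" by simp
      qed
    qed
  qed
  ultimately show ?thesis by blast
qed


section \<open>Aperiodic boundary paths are dense under Condition (L)\<close>

definition eventually_periodic :: "('l, 'b) gpath \<Rightarrow> bool" where
  "eventually_periodic \<mu> \<longleftrightarrow> (\<exists>f k m. \<mu> = InfPath f \<and> 0 < m \<and> (\<forall>i\<ge>k. f (i + m) = f i))"

text \<open>A cylinder around the infinite path \<open>f\<close>, based at its edge \<open>n\<close>, that contains no finite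
  path.\<close>

definition infinite_cylinder :: "(nat \<Rightarrow> ('l, 'b) edge) \<Rightarrow> nat \<Rightarrow> 'b \<Rightarrow> bool" where
  "infinite_cylinder f n B \<longleftrightarrow> (\<forall>i. chain f i) \<and> B \<in> snd (f n) \<and> B \<in> Iw (labels f 0 (Suc n)) \<and>
     (\<forall>\<nu>\<in>cylinder (labels f 0 (Suc n)) B. \<exists>g. \<nu> = InfPath g)"

lemma infinite_cylinder_self: "infinite_cylinder f n B \<Longrightarrow> InfPath f \<in> cylinder (labels f 0 (Suc n)) B"
  by (simp add: infinite_cylinder_def cylinder_labels_iff boundary_InfPath)

text \<open>One step of the category argument.  By Condition (L) the cylinder contains a path
  without period \<open>m\<close> from \<open>k\<close> on, say with different edges at the positions \<open>i\<close> and \<open>i + m\<close>, and the difference is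
  witnessed on a smaller cylinder.\<close>

lemma shrink_cylinder:
  assumes L: "condition_L" and fnB: "infinite_cylinder f n B" and m: "0 < m"
  shows "\<exists>g n' B'. infinite_cylinder g n' B' \<and> n < n' \<and> cylinder (labels g 0 (Suc n')) B' \<subseteq> cylinder (labels f 0 (Suc n)) B \<and>
    (\<forall>h. InfPath h \<in> cylinder (labels g 0 (Suc n')) B' \<longrightarrow> \<not> (\<forall>i\<ge>k. h (i + m) = h i))"
proof -
  have c: "chain f i" for i using fnB by (simp add: infinite_cylinder_def)
  let ?C = "cylinder (labels f 0 (Suc n)) B"
  have "nhd f (\<lambda>\<nu>. \<nu> \<in> ?C)" unfolding nhd_def using fnB by (auto simp: infinite_cylinder_def)
  then obtain N where N: "\<And>j. N \<le> j \<Longrightarrow>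
      \<exists>B\<in>snd (f j). B \<in> Iw (labels f 0 (Suc j)) \<and> (\<forall>\<nu>\<in>cylinder (labels f 0 (Suc j)) B. \<nu> \<in> ?C)"
    using nhd_later[OF c] by blast
  \<comment> \<open>The word of the cylinder must cover \<open>k + m\<close> positions before the periodicity lemma applies.\<close>
  define M where "M = max N (k + m)"
  obtain B1 where B1: "B1 \<in> snd (f M)" "B1 \<in> Iw (labels f 0 (Suc M))" "cylinder (labels f 0 (Suc M)) B1 \<subseteq> ?C"
    using N[of M] by (auto simp: M_def)
  let ?w = "labels f 0 (Suc M)"
  have fM: "f M \<in> E1" by (rule chainD(1)[OF c order.refl])
  have w: "?w \<noteq> []" "last ?w = fst (f M)" by (simp_all add: labels_Suc)
  have wL: "set ?w \<subseteq> L" by (rule set_labels_subset_L[OF c[of M] order.refl])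
  have "B1 \<noteq> bot" using B1(1) fM ultrafilter_bot unfolding E1_iff by blast
  moreover have "k + m \<le> length ?w" by (simp add: M_def)
  ultimately have "\<exists>\<mu>\<in>cylinder ?w B1. \<not> (\<exists>f. \<mu> = InfPath f \<and> (\<forall>i\<ge>k. f (i + m) = f i))"
    using periodic_cylinder_gives_cycle[OF w(1) wL B1(2) _ _ m, of k] L unfolding condition_L_def by blast
  then obtain \<mu> where \<mu>: "\<mu> \<in> cylinder ?w B1" "\<not> (\<exists>f. \<mu> = InfPath f \<and> (\<forall>i\<ge>k. f (i + m) = f i))" by blast
  then obtain g where g: "\<mu> = InfPath g" using B1(3) fnB unfolding infinite_cylinder_def by blast
  then obtain i where i: "i \<ge> k" "g (i + m) \<noteq> g i" using \<mu>(2) by blast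
  have cg: "chain g j" for j using \<mu>(1) g by (simp add: cylinder_def boundary_InfPath)
  have e: "g (i + m) \<in> E1" by (rule chainD(1)[OF cg order.refl])
  obtain A where A: "A \<in> snd (g (i + m))"
    "nhd g (\<lambda>\<nu>. enat i < plength \<nu> \<and> edge_at \<nu> i \<notin> Z1 (fst (g (i + m))) A)"
    using nhd_avoids_edge[OF cg e i(2)] by blast
  have "openin boundary_top (cylinder ?w B1)"
    using openin_cylinder[OF w(1) wL] w(2) snd_edge_in_I[OF fM B1(1)] by simp
  then have "nhd g (\<lambda>\<nu>. \<nu> \<in> cylinder ?w B1)" using boundary_top_neighborhood[OF cg] \<mu>(1) g by simp
  then have "nhd g (\<lambda>\<nu>. \<nu> \<in> cylinder ?w B1 \<and>
      (enat (i + m) < plength \<nu> \<and> fst (edge_at \<nu> (i + m)) = fst (g (i + m)) \<and> A \<in> snd (edge_at \<nu> (i + m))) \<and>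
      (enat i < plength \<nu> \<and> edge_at \<nu> i \<notin> Z1 (fst (g (i + m))) A))" (is "nhd g ?Q")
    by (intro nhd_conj[OF cg] nhd_edge[OF cg A(1)] A(2))
  then obtain N' where N': "\<And>j. N' \<le> j \<Longrightarrow>
      \<exists>B\<in>snd (g j). B \<in> Iw (labels g 0 (Suc j)) \<and> (\<forall>\<nu>\<in>cylinder (labels g 0 (Suc j)) B. ?Q \<nu>)"
    using nhd_later[OF cg] by blast
  define n' where "n' = max N' (Suc n)"
  obtain B' where B': "B' \<in> snd (g n')" "B' \<in> Iw (labels g 0 (Suc n'))"
    "\<forall>\<nu>\<in>cylinder (labels g 0 (Suc n')) B'. ?Q \<nu>" using N'[of n'] by (auto simp: n'_def)
  have sub: "cylinder (labels g 0 (Suc n')) B' \<subseteq> ?C" using B'(3) B1(3) by blast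
  have "infinite_cylinder g n' B'" using cg B'(1,2) sub fnB unfolding infinite_cylinder_def by blast
  moreover have "n < n'" by (simp add: n'_def)
  moreover have "\<not> (\<forall>i\<ge>k. h (i + m) = h i)" if h: "InfPath h \<in> cylinder (labels g 0 (Suc n')) B'" for h
  proof
    assume "\<forall>i\<ge>k. h (i + m) = h i"
    then have hi: "h (i + m) = h i" using i(1) by blast
    have q: "fst (h (i + m)) = fst (g (i + m))" "A \<in> snd (h (i + m))" "h i \<notin> Z1 (fst (g (i + m))) A"
      using B'(3) h by auto
    have "h (i + m) \<in> E1" using h by (auto simp: cylinder_def boundary_InfPath intro: chainD(1))
    moreover have "fst (g (i + m)) \<in> L" using e by (simp add: E1_iff)
    ultimately have "h (i + m) \<in> Z1 (fst (g (i + m))) A" using q Z1_iff by blast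
    then show False using q(3) hi by simp
  qed
  ultimately show ?thesis using sub by blast
qed

text \<open>At a position covered by its word, a cylinder has an element that belongs to the ultrafilters
  of all its paths.  It keeps the limits of these ultrafilters from being empty.\<close>

lemma cylinder_common_element:
  assumes c: "\<And>i. chain f i" and B: "B \<in> Iw (labels f 0 (Suc n))" and p: "p \<le> n"
  shows "\<exists>X\<in>I (fst (f p)). \<forall>\<nu>\<in>cylinder (labels f 0 (Suc n)) B. X \<in> snd (edge_at \<nu> p)"
proof -
  obtain X where X: "X \<in> I (fst (f 0))" "B \<le> \<theta>w (labels f (Suc 0) (Suc n)) X"
    using B by (auto simp: Iw_labels_iff)
  let ?X = "\<theta>w (labels f (Suc 0) (Suc p)) X"
  have XI: "?X \<in> I (fst (f p))" using \<theta>w_labels_in_I[OF c _ order.refl X(1)] by simp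
  have "labels f (Suc 0) (Suc n) = labels f (Suc 0) (Suc p) @ labels f (Suc p) (Suc n)"
    using p by (intro labels_append) simp_all
  then have le: "B \<le> \<theta>w (labels f (Suc p) (Suc n)) ?X" using X(2) by (simp add: \<theta>w_append)
  have "?X \<in> snd (edge_at \<nu> p)" if "\<nu> \<in> cylinder (labels f 0 (Suc n)) B" for \<nu>
    by (rule cylinder_transport[OF that p XI le])
  then show ?thesis using XI by blast
qed

text \<open>The cylinders are non-empty with centres \<open>f j\<close>.  At each position \<open>p\<close> the centres have a common
  label from \<open>j = p\<close> on, and the limit ultrafilter consists of the elements \<open>A\<close> that belong to the
  ultrafilter of \<open>f j\<close> at \<open>p\<close> for \<open>\<U>\<close>-almost all \<open>j\<close>, where \<open>\<U>\<close> is a free ultrafilter on the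
  natural numbers.  All conditions on a path concern at most two neighbouring edges, and they pass
  to the limit.\<close>

lemma nested_cylinders_intersect:
  fixes f :: "nat \<Rightarrow> nat \<Rightarrow> ('l, 'b) edge"
  assumes cylinder: "\<And>j. infinite_cylinder (f j) (n j) (B j)" and n: "\<And>j. j \<le> n j"
    and dec: "\<And>i j. i \<le> j \<Longrightarrow> cylinder (labels (f j) 0 (Suc (n j))) (B j) \<subseteq> cylinder (labels (f i) 0 (Suc (n i))) (B i)"
  shows "\<exists>h. \<forall>j. InfPath h \<in> cylinder (labels (f j) 0 (Suc (n j))) (B j)"
proof -
  obtain \<U> :: "nat set set" where U: "\<U> \<in> ba_ultrafilters UNIV" "\<And>n. {n..} \<in> \<U>"
    using free_ultrafilter_nat by blast
  note Ui = ba_ideal_UNIV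
  have U_up: "T \<in> \<U>" if "S \<in> \<U>" "S \<subseteq> T" for S T
    using ultrafilter_up[OF U(1) that(1) UNIV_I that(2)] .
  have U_int: "S \<inter> T \<in> \<U>" if "S \<in> \<U>" "T \<in> \<U>" for S T
    using ultrafilter_inf[OF Ui U(1) that] .
  have U_tail: "T \<in> \<U>" if "S \<in> \<U>" "\<And>j. j \<in> S \<Longrightarrow> p \<le> j \<Longrightarrow> j \<in> T" for S T p
    using U_up[OF U_int[OF that(1) U(2)[of p]], of T] that(2) by auto
  have c: "chain (f j) i" for i j using cylinder by (simp add: infinite_cylinder_def)
  have E: "f j p \<in> E1" for j p by (rule chainD(1)[OF c order.refl])
  have mem: "InfPath (f j) \<in> cylinder (labels (f i) 0 (Suc (n i))) (B i)" if "i \<le> j" for i j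
    using infinite_cylinder_self[OF cylinder] dec[OF that] by blast
  define a where "a p = fst (f p p)" for p
  have labels_eq: "fst (f j p) = fst (f i p)" if "i \<le> j" "p \<le> n i" for i j p
    using mem[OF that(1)] that(2) by (auto simp: cylinder_labels_iff)
  have a_eq: "fst (f j p) = a p" if "p \<le> j" for j p
    using labels_eq[OF that n] by (simp add: a_def)
  have aL: "a p \<in> L" for p using E[of p p] by (simp add: a_def E1_iff)
  note Ia = ideal[OF aL]
  have "\<exists>X\<in>I (a p). \<forall>j\<ge>p. X \<in> snd (f j p)" for p
  proof -
    obtain X where "X \<in> I (fst (f p p))"
      "\<forall>\<nu>\<in>cylinder (labels (f p) 0 (Suc (n p))) (B p). X \<in> snd (edge_at \<nu> p)"
      using cylinder_common_element[OF c _ n[of p]] cylinder[of p] unfolding infinite_cylinder_def by blast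
    moreover from this(2) have "\<forall>j\<ge>p. X \<in> snd (f j p)" using mem[of p] by fastforce
    ultimately show ?thesis unfolding a_def by blast
  qed
  then obtain X where X: "\<And>p. X p \<in> I (a p)" "\<And>p j. p \<le> j \<Longrightarrow> X p \<in> snd (f j p)" by metis
  define \<eta> where "\<eta> p = {A \<in> I (a p). {j. A \<in> snd (f j p)} \<in> \<U>}" for p
  define h where "h p = (a p, \<eta> p)" for p
  have hE: "h p \<in> E1" for p
  proof -
    have inf_in: "inf A C \<in> \<eta> p" if "A \<in> \<eta> p" "C \<in> \<eta> p" for A C
    proof -
      have "{j. A \<in> snd (f j p)} \<inter> {j. C \<in> snd (f j p)} \<in> \<U>" using that U_int by (simp add: \<eta>_def)
      moreover have "{j. A \<in> snd (f j p)} \<inter> {j. C \<in> snd (f j p)} \<subseteq> {j. inf A C \<in> snd (f j p)}"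
        using snd_edge_inf[OF E] by blast
      ultimately have "{j. inf A C \<in> snd (f j p)} \<in> \<U>" by (rule U_up)
      then show ?thesis using that(1) ba_ideal_inf[OF Ia] by (simp add: \<eta>_def)
    qed
    have "\<eta> p \<in> ba_ultrafilters (I (a p))"
    proof (rule prime_filter_ultrafilter[OF Ia])
      show "ba_filter (I (a p)) (\<eta> p)"
        unfolding ba_filter_def
      proof (intro conjI ballI impI)
        show "\<eta> p \<subseteq> I (a p)" by (auto simp: \<eta>_def)
        have "{j. X p \<in> snd (f j p)} \<in> \<U>" by (rule U_up[OF U(2)[of p]]) (use X(2) in auto)
        then show "\<eta> p \<noteq> {}" using X(1) by (auto simp: \<eta>_def)
        have "{j. bot \<in> snd (f j p)} = {}" using E ultrafilter_bot unfolding E1_iff by blast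
        moreover have "{} \<notin> \<U>" using ultrafilter_bot[OF U(1)] by simp
        ultimately show "bot \<notin> \<eta> p" by (simp add: \<eta>_def)
        show "\<exists>D\<in>\<eta> p. D \<le> A \<and> D \<le> C" if "A \<in> \<eta> p" "C \<in> \<eta> p" for A C
          using inf_in[OF that] by (intro bexI[of _ "inf A C"]) simp_all
        show "C \<in> \<eta> p" if A: "A \<in> \<eta> p" "C \<in> I (a p)" "A \<le> C" for A C
        proof -
          have "{j. C \<in> snd (f j p)} \<in> \<U>"
          proof (rule U_tail)
            show "{j. A \<in> snd (f j p)} \<in> \<U>" using A(1) by (simp add: \<eta>_def)
            show "j \<in> {j. C \<in> snd (f j p)}" if "j \<in> {j. A \<in> snd (f j p)}" "p \<le> j" for j
              using snd_edge_up[OF E _ A(3)] a_eq[OF that(2)] A(2) that(1) by simp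
          qed
          then show ?thesis using A(2) by (simp add: \<eta>_def)
        qed
      qed
      fix A C assume A: "A \<in> \<eta> p"
      have AI: "A \<in> I (a p)" using A by (simp add: \<eta>_def)
      let ?S = "{j. A \<in> snd (f j p)}" and ?T = "{j. inf A C \<in> snd (f j p)}"
      have "?S \<inter> ?T \<in> \<U> \<or> ?S - ?T \<in> \<U>"
        using ultrafilter_inf_or_diff[OF Ui U(1), of ?S ?T] A by (simp add: \<eta>_def)
      moreover have "?T \<in> \<U>" if "?S \<inter> ?T \<in> \<U>" using U_up[OF that] by blast
      moreover have "{j. A - C \<in> snd (f j p)} \<in> \<U>" if "?S - ?T \<in> \<U>"
      proof (rule U_up[OF that], intro subsetI)
        fix j assume j: "j \<in> ?S - ?T"
        have "fst (f j p) \<in> L" "snd (f j p) \<in> ba_ultrafilters (I (fst (f j p)))"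
          using E[of j p] by (simp_all add: E1_iff)
        then show "j \<in> {j. A - C \<in> snd (f j p)}"
          using ultrafilter_inf_or_diff[OF ideal, of "fst (f j p)" "snd (f j p)" A C] j by simp
      qed
      ultimately show "inf A C \<in> \<eta> p \<or> A - C \<in> \<eta> p"
        using ba_ideal_inf[OF Ia AI] ba_ideal_diff[OF Ia AI] by (auto simp: \<eta>_def)
    qed
    then show ?thesis using aL by (simp add: h_def E1_iff)
  qed
  have link: "edge_d (h p) = edge_r (h (Suc p))" for p
  proof -
    have sub: "edge_d (h p) \<subseteq> edge_r (h (Suc p))"
    proof
      fix C assume "C \<in> edge_d (h p)"
      then obtain A where A: "A \<in> \<eta> p" "A \<le> C" by (auto simp: h_def)
      have "{j. \<theta> (a (Suc p)) C \<in> snd (f j (Suc p))} \<in> \<U>"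
      proof (rule U_tail)
        show "{j. A \<in> snd (f j p)} \<in> \<U>" using A(1) by (simp add: \<eta>_def)
        fix j assume j: "j \<in> {j. A \<in> snd (f j p)}" "Suc p \<le> j"
        have "C \<in> edge_d (f j p)" using j(1) A(2) by (auto simp: edge_d_alt)
        also have "edge_d (f j p) = edge_r (f j (Suc p))" by (rule chainD(2)[OF c[of j "Suc p"]]) simp
        finally show "j \<in> {j. \<theta> (a (Suc p)) C \<in> snd (f j (Suc p))}"
          using a_eq[OF j(2)] by (simp add: edge_r_iff)
      qed
      then show "C \<in> edge_r (h (Suc p))" using \<theta>_in_I[OF aL] by (simp add: h_def \<eta>_def)
    qed
    have d: "edge_d (h p) \<in> E0" by (rule edge_d_in_E0[OF hE])
    then have "edge_r (h (Suc p)) \<in> E0" using edge_r_in_E0[OF hE] sub E0_nonempty[OF d] by blast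
    then show ?thesis using E0_eq_of_subset[OF d _ sub] by blast
  qed
  have hb: "InfPath h \<in> boundary" using hE link by (simp add: boundary_InfPath chain_def)
  have "InfPath h \<in> cylinder (labels (f j) 0 (Suc (n j))) (B j)" for j
  proof -
    have labels: "a i = fst (f j i)" if "i \<le> n j" for i
      using labels_eq[of j "max i j" i] a_eq[of i "max i j"] that by simp
    have BI: "B j \<in> I (a (n j))"
      using cylinder[of j] snd_edge_in_I[OF E, of "B j" j "n j"] labels[of "n j"] by (simp add: infinite_cylinder_def)
    have "{l. B j \<in> snd (f l (n j))} \<in> \<U>"
      by (rule U_up[OF U(2)[of j]]) (use mem in \<open>auto simp: cylinder_labels_iff\<close>)
    then show ?thesis using hb labels BI by (simp add: cylinder_labels_iff h_def \<eta>_def)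
  qed
  then show ?thesis by blast
qed

lemma aperiodic_boundary_paths_dense:
  assumes L: "condition_L" and W: "openin boundary_top W" "W \<noteq> {}"
  shows "\<exists>\<mu>\<in>W. \<not> eventually_periodic \<mu>"
proof (cases "\<forall>\<mu>\<in>W. \<exists>f. \<mu> = InfPath f")
  case False
  then show ?thesis by (auto simp: eventually_periodic_def)
next
  case True
  obtain \<mu>0 where "\<mu>0 \<in> W" using W(2) by blast
  then obtain f0 where f0: "InfPath f0 \<in> W" using True by metis
  have "W \<subseteq> boundary" using openin_subset[OF W(1)] by (simp add: topspace_boundary_top)
  then have c0: "chain f0 i" for i using f0 by (auto simp: boundary_InfPath)
  have "nhd f0 (\<lambda>\<nu>. \<nu> \<in> W)" by (rule boundary_top_neighborhood[OF c0 W(1) f0])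
  then obtain n0 B0 where "B0 \<in> snd (f0 n0)" "B0 \<in> Iw (labels f0 0 (Suc n0))"
    and sub0: "cylinder (labels f0 0 (Suc n0)) B0 \<subseteq> W" unfolding nhd_def by blast
  then have init: "infinite_cylinder f0 n0 B0" using c0 True unfolding infinite_cylinder_def by blast
  define C where "C s = cylinder (labels (fst s) 0 (Suc (fst (snd s)))) (snd (snd s))"
    for s :: "(nat \<Rightarrow> ('l, 'b) edge) \<times> nat \<times> 'b"
  define ok where "ok s \<longleftrightarrow> infinite_cylinder (fst s) (fst (snd s)) (snd (snd s))"
    for s :: "(nat \<Rightarrow> ('l, 'b) edge) \<times> nat \<times> 'b"
  \<comment> \<open>All pairs of a start \<open>k\<close> and a positive period \<open>m\<close> are met, one at each step.\<close>
  define k m where "k j = fst (prod_decode j)" and "m j = Suc (snd (prod_decode j))" for j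
  have "\<exists>s. \<forall>j. (ok (s j) \<and> C (s j) \<subseteq> W) \<and> (fst (snd (s j)) < fst (snd (s (Suc j))) \<and> C (s (Suc j)) \<subseteq> C (s j) \<and>
      (\<forall>h. InfPath h \<in> C (s (Suc j)) \<longrightarrow> \<not> (\<forall>i\<ge>k j. h (i + m j) = h i)))" (is "\<exists>s. ?P s")
  proof (rule dependent_nat_choice)
    show "\<exists>s. ok s \<and> C s \<subseteq> W"
      using init sub0 by (intro exI[of _ "(f0, n0, B0)"]) (simp add: ok_def C_def)
    fix s j assume s: "ok s \<and> C s \<subseteq> W"
    then have "\<exists>g n' B'. infinite_cylinder g n' B' \<and> fst (snd s) < n' \<and> cylinder (labels g 0 (Suc n')) B' \<subseteq> C s \<and>
        (\<forall>h. InfPath h \<in> cylinder (labels g 0 (Suc n')) B' \<longrightarrow> \<not> (\<forall>i\<ge>k j. h (i + m j) = h i))"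
      unfolding ok_def C_def by (intro shrink_cylinder[OF L]) (auto simp: m_def)
    then obtain g n' B' where g: "infinite_cylinder g n' B'" "fst (snd s) < n'" "cylinder (labels g 0 (Suc n')) B' \<subseteq> C s"
      "\<forall>h. InfPath h \<in> cylinder (labels g 0 (Suc n')) B' \<longrightarrow> \<not> (\<forall>i\<ge>k j. h (i + m j) = h i)" by blast
    then show "\<exists>s'. (ok s' \<and> C s' \<subseteq> W) \<and> (fst (snd s) < fst (snd s') \<and> C s' \<subseteq> C s \<and>
        (\<forall>h. InfPath h \<in> C s' \<longrightarrow> \<not> (\<forall>i\<ge>k j. h (i + m j) = h i)))"
      using s by (intro exI[of _ "(g, n', B')"]) (auto simp: ok_def C_def)
  qed
  then obtain s where s: "\<And>j. ok (s j)" "\<And>j. C (s j) \<subseteq> W" "\<And>j. fst (snd (s j)) < fst (snd (s (Suc j)))"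
    "\<And>j. C (s (Suc j)) \<subseteq> C (s j)"
    "\<And>j h. InfPath h \<in> C (s (Suc j)) \<Longrightarrow> \<not> (\<forall>i\<ge>k j. h (i + m j) = h i)"
  proof -
    assume *: "\<And>s. (\<And>j. ok (s j)) \<Longrightarrow> (\<And>j. C (s j) \<subseteq> W) \<Longrightarrow>
      (\<And>j. fst (snd (s j)) < fst (snd (s (Suc j)))) \<Longrightarrow> (\<And>j. C (s (Suc j)) \<subseteq> C (s j)) \<Longrightarrow>
      (\<And>j h. InfPath h \<in> C (s (Suc j)) \<Longrightarrow> \<not> (\<forall>i\<ge>k j. h (i + m j) = h i)) \<Longrightarrow> thesis"
    assume "\<exists>s. ?P s"
    then obtain s where s: "?P s" by (rule exE)
    show thesis
    proof (rule *[of s])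
      fix j
      note sj = spec[OF s, of j]
      show "ok (s j)" "C (s j) \<subseteq> W" "fst (snd (s j)) < fst (snd (s (Suc j)))" "C (s (Suc j)) \<subseteq> C (s j)"
        using sj by simp_all
      show "\<not> (\<forall>i\<ge>k j. h (i + m j) = h i)" if "InfPath h \<in> C (s (Suc j))" for h
        using sj that by simp
    qed
  qed
  have "strict_mono (\<lambda>j. fst (snd (s j)))" using s(3) by (simp add: strict_mono_Suc_iff)
  then have n: "j \<le> fst (snd (s j))" for j by (rule strict_mono_imp_increasing)
  have dec: "C (s j) \<subseteq> C (s i)" if "i \<le> j" for i j
    using s(4) that by (rule lift_Suc_antimono_le)
  obtain h where h: "\<And>j. InfPath h \<in> C (s j)"
    using nested_cylinders_intersect[of "\<lambda>j. fst (s j)" "\<lambda>j. fst (snd (s j))" "\<lambda>j. snd (snd (s j))"]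
      s(1) n dec unfolding ok_def C_def by blast
  have "\<not> eventually_periodic (InfPath h)"
  proof
    assume "eventually_periodic (InfPath h)"
    then obtain k' m' where km: "0 < m'" "\<forall>i\<ge>k'. h (i + m') = h i"
      by (auto simp: eventually_periodic_def)
    define j where "j = prod_encode (k', m' - 1)"
    have "k j = k'" "m j = m'" using km(1) by (simp_all add: k_def m_def j_def)
    then show False using s(5)[OF h, of j] km(2) by blast
  qed
  then show ?thesis using h[of 0] s(2) by blast
qed

end

section \<open>Transformation groupoids\<close>

locale open_partial_action =
  fixes G :: "('t, 'm) monoid_scheme" and X :: "'x topology"
    and U :: "'t \<Rightarrow> 'x set" and \<phi> :: "'t \<Rightarrow> 'x \<Rightarrow> 'x"
  assumes G: "group G" and U_one: "U \<one>\<^bsub>G\<^esub> = topspace X"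
    and \<phi>_one: "\<phi> \<one>\<^bsub>G\<^esub> x = x"
    and U_open: "t \<in> carrier G \<Longrightarrow> openin X (U t)"
begin

abbreviation "H \<equiv> transformation_groupoid G X U \<phi>"

lemma topspace_groupoid:
  "topspace (arrows_top H) = {(t, x). t \<in> carrier G \<and> x \<in> topspace X \<and> x \<in> U t}"
  by (auto simp: transformation_groupoid_def)

lemma grange_groupoid: "t \<in> carrier G \<Longrightarrow> grange H (t, x) = (\<one>\<^bsub>G\<^esub>, x)"
  using group.r_inv[OF G] by (simp add: grange_def transformation_groupoid_def)

lemma gsource_groupoid: "t \<in> carrier G \<Longrightarrow> gsource H (t, x) = (\<one>\<^bsub>G\<^esub>, \<phi> (inv\<^bsub>G\<^esub> t) x)"
  using group.l_inv[OF G] by (simp add: gsource_def transformation_groupoid_def)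

lemma one_in_G: "\<one>\<^bsub>G\<^esub> \<in> carrier G"
  using group.is_monoid[OF G] monoid.one_closed by blast

lemma gunits_groupoid: "gunits H = {\<one>\<^bsub>G\<^esub>} \<times> topspace X"
proof
  show "gunits H \<subseteq> {\<one>\<^bsub>G\<^esub>} \<times> topspace X"
    by (auto simp: gunits_def topspace_groupoid grange_groupoid)
  show "{\<one>\<^bsub>G\<^esub>} \<times> topspace X \<subseteq> gunits H"
  proof
    fix u assume "u \<in> {\<one>\<^bsub>G\<^esub>} \<times> topspace X"
    then obtain x where u: "u = (\<one>\<^bsub>G\<^esub>, x)" "x \<in> topspace X" by blast
    then have "(\<one>\<^bsub>G\<^esub>, x) \<in> topspace (arrows_top H)"
      by (simp add: topspace_groupoid one_in_G U_one)
    moreover have "grange H (\<one>\<^bsub>G\<^esub>, x) = u" using u by (simp add: grange_groupoid one_in_G)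
    ultimately show "u \<in> gunits H" unfolding gunits_def by (metis imageI)
  qed
qed

lemma gIso_groupoid:
  "(t, x) \<in> gIso H \<longleftrightarrow> t \<in> carrier G \<and> x \<in> topspace X \<and> x \<in> U t \<and> \<phi> (inv\<^bsub>G\<^esub> t) x = x"
  by (auto simp: gIso_def topspace_groupoid grange_groupoid gsource_groupoid)

text \<open>Since the \<open>U t\<close> are open, the slices \<open>{t} \<times> U t\<close> are open in the groupoid and carry the
  topology of \<open>U t\<close>.\<close>

lemma openin_slice:
  assumes W: "openin (arrows_top H) W" and t: "t \<in> carrier G"
  shows "openin X {x. (t, x) \<in> W}"
proof -
  let ?P = "prod_topology (discrete_topology (carrier G)) X"
  obtain T where T: "openin ?P T" "W = T \<inter> {(t, x). x \<in> U t}"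
    using W by (auto simp: transformation_groupoid_def openin_subtopology)
  have "continuous_map X ?P (\<lambda>x. (t, x))"
    using t by (intro continuous_map_pairedI) simp_all
  then have "openin X {x \<in> topspace X. (t, x) \<in> T}"
    using T(1) by (rule openin_continuous_map_preimage)
  then have "openin X ({x \<in> topspace X. (t, x) \<in> T} \<inter> U t)" using U_open[OF t] by (rule openin_Int)
  moreover have "{x. (t, x) \<in> W} = {x \<in> topspace X. (t, x) \<in> T} \<inter> U t"
    using T(2) openin_subset[OF U_open[OF t]] by auto
  ultimately show ?thesis by simp
qed

lemma openin_times_slice:
  assumes V: "openin X V" and t: "t \<in> carrier G" and sub: "V \<subseteq> U t"
  shows "openin (arrows_top H) ({t} \<times> V)"
proof -
  have "openin (prod_topology (discrete_topology (carrier G)) X) ({t} \<times> V)"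
    using V t by (simp add: openin_prod_Times_iff)
  moreover have "{t} \<times> V = ({t} \<times> V) \<inter> {(t, x). x \<in> U t}" using sub by auto
  ultimately show ?thesis
    unfolding transformation_groupoid_def by (simp add: openin_subtopology) blast
qed

text \<open>The range of the arrow \<open>(t, x)\<close> is \<open>x\<close> and its source is the image of \<open>x\<close> under the inverse
  of \<open>t\<close>, whence the inverse on the left.\<close>

lemma Fix_eq_slice:
  assumes t: "t \<in> carrier G"
  shows "partial_action_Fix G X U \<phi> (inv\<^bsub>G\<^esub> t) = {x. (t, x) \<in> gIso H}"
  using t group.inv_inv[OF G] by (auto simp: partial_action_Fix_def gIso_groupoid)

lemma effective_iff_topologically_free:
  "effective H \<longleftrightarrow> topologically_free G X U \<phi>"
proof
  assume eff: "effective H"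
  show "topologically_free G X U \<phi>"
    unfolding topologically_free_def
  proof
    fix t assume t: "t \<in> carrier G - {\<one>\<^bsub>G\<^esub>}"
    let ?s = "inv\<^bsub>G\<^esub> t" and ?V = "X interior_of partial_action_Fix G X U \<phi> t"
    have s: "?s \<in> carrier G" "inv\<^bsub>G\<^esub> ?s = t" using t group.inv_closed[OF G] group.inv_inv[OF G] by auto
    have V: "?V \<subseteq> {x. (?s, x) \<in> gIso H}" using Fix_eq_slice[OF s(1)] s(2) interior_of_subset by metis
    have "?V \<subseteq> U ?s" using V by (auto simp: gIso_groupoid)
    then have "openin (arrows_top H) ({?s} \<times> ?V)" by (intro openin_times_slice s(1)) simp
    moreover have "{?s} \<times> ?V \<subseteq> gIso H" using V by blast
    ultimately have "{?s} \<times> ?V \<subseteq> arrows_top H interior_of gIso H" by (rule interior_of_maximal[rotated])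
    then have sub: "{?s} \<times> ?V \<subseteq> {\<one>\<^bsub>G\<^esub>} \<times> topspace X"
      using eff by (simp add: effective_def gunits_groupoid)
    have "?s \<noteq> \<one>\<^bsub>G\<^esub>"
    proof
      assume "?s = \<one>\<^bsub>G\<^esub>"
      then have "t = \<one>\<^bsub>G\<^esub>" using s(2) group.is_monoid[OF G] monoid.inv_one by metis
      then show False using t by simp
    qed
    then show "?V = {}" using sub by auto
  qed
next
  assume tf: "topologically_free G X U \<phi>"
  show "effective H"
    unfolding effective_def gunits_groupoid
  proof
    show "{\<one>\<^bsub>G\<^esub>} \<times> topspace X \<subseteq> arrows_top H interior_of gIso H"
    proof (rule interior_of_maximal)
      have "inv\<^bsub>G\<^esub> \<one>\<^bsub>G\<^esub> = \<one>\<^bsub>G\<^esub>" using group.is_monoid[OF G] monoid.inv_one by blast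
      then show "{\<one>\<^bsub>G\<^esub>} \<times> topspace X \<subseteq> gIso H"
        by (auto simp: gIso_groupoid one_in_G U_one \<phi>_one)
      show "openin (arrows_top H) ({\<one>\<^bsub>G\<^esub>} \<times> topspace X)"
        using openin_times_slice[OF _ one_in_G] by (simp add: U_one)
    qed
    show "arrows_top H interior_of gIso H \<subseteq> {\<one>\<^bsub>G\<^esub>} \<times> topspace X"
    proof
      fix g assume g: "g \<in> arrows_top H interior_of gIso H"
      obtain t x where tx: "g = (t, x)" by (cases g)
      have gi: "(t, x) \<in> gIso H" using subsetD[OF interior_of_subset g] tx by simp
      then have t: "t \<in> carrier G" "x \<in> topspace X" by (simp_all add: gIso_groupoid)
      have "t = \<one>\<^bsub>G\<^esub>"
      proof (rule ccontr)
        assume ne: "t \<noteq> \<one>\<^bsub>G\<^esub>"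
        let ?s = "inv\<^bsub>G\<^esub> t" and ?V = "{x. (t, x) \<in> arrows_top H interior_of gIso H}"
        have s: "?s \<in> carrier G" "?s \<noteq> \<one>\<^bsub>G\<^esub>"
        proof -
          show "?s \<in> carrier G" using t(1) group.inv_closed[OF G] by blast
          show "?s \<noteq> \<one>\<^bsub>G\<^esub>"
          proof
            assume "?s = \<one>\<^bsub>G\<^esub>"
            then have "t = \<one>\<^bsub>G\<^esub>"
              using t(1) group.inv_inv[OF G] group.is_monoid[OF G] monoid.inv_one by metis
            then show False using ne by simp
          qed
        qed
        have "openin X ?V" by (rule openin_slice[OF openin_interior_of t(1)])
        moreover have "?V \<subseteq> partial_action_Fix G X U \<phi> ?s"
          unfolding Fix_eq_slice[OF t(1)]
          using interior_of_subset[of "arrows_top H" "gIso H"] by auto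
        ultimately have "?V \<subseteq> X interior_of partial_action_Fix G X U \<phi> ?s"
          by (rule interior_of_maximal[rotated])
        moreover have "x \<in> ?V" using g tx by simp
        ultimately show False using tf s unfolding topologically_free_def by blast
      qed
      then show "g \<in> {\<one>\<^bsub>G\<^esub>} \<times> topspace X" using tx t by simp
    qed
  qed
qed

lemma topologically_principal_iff:
  "topologically_principal H \<longleftrightarrow>
    (\<forall>V. openin X V \<and> V \<noteq> {} \<longrightarrow>
      (\<exists>x\<in>V. \<forall>t\<in>carrier G. x \<in> U t \<and> \<phi> (inv\<^bsub>G\<^esub> t) x = x \<longrightarrow> t = \<one>\<^bsub>G\<^esub>))"
proof -
  let ?triv = "\<lambda>x. \<forall>t\<in>carrier G. x \<in> U t \<and> \<phi> (inv\<^bsub>G\<^esub> t) x = x \<longrightarrow> t = \<one>\<^bsub>G\<^esub>"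
  let ?D = "{u \<in> gunits H. {g \<in> topspace (arrows_top H). grange H g = u \<and> gsource H g = u} = {u}}"
  have D: "(\<one>\<^bsub>G\<^esub>, x) \<in> ?D \<longleftrightarrow> ?triv x" if x: "x \<in> topspace X" for x
  proof -
    have "{g \<in> topspace (arrows_top H). grange H g = (\<one>\<^bsub>G\<^esub>, x) \<and> gsource H g = (\<one>\<^bsub>G\<^esub>, x)} =
        {(t, y). t \<in> carrier G \<and> y = x \<and> x \<in> U t \<and> \<phi> (inv\<^bsub>G\<^esub> t) x = x}"
      using x by (auto simp: topspace_groupoid grange_groupoid gsource_groupoid)
    moreover have "inv\<^bsub>G\<^esub> \<one>\<^bsub>G\<^esub> = \<one>\<^bsub>G\<^esub>" using group.is_monoid[OF G] monoid.inv_one by blast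
    then have "(\<one>\<^bsub>G\<^esub>, x) \<in> {(t, y). t \<in> carrier G \<and> y = x \<and> x \<in> U t \<and> \<phi> (inv\<^bsub>G\<^esub> t) x = x}"
      using x by (simp add: one_in_G U_one \<phi>_one)
    ultimately show ?thesis using x by (auto simp: gunits_groupoid)
  qed
  let ?T = "subtopology (arrows_top H) (gunits H)"
  have top: "topspace ?T = gunits H"
    using U_one one_in_G by (auto simp: topspace_groupoid gunits_groupoid)
  have op: "openin ?T W \<longleftrightarrow> (\<exists>V. openin X V \<and> W = {\<one>\<^bsub>G\<^esub>} \<times> V)" for W
  proof
    assume "openin ?T W"
    then obtain S where S: "openin (arrows_top H) S" "W = S \<inter> ({\<one>\<^bsub>G\<^esub>} \<times> topspace X)"
      by (auto simp: openin_subtopology gunits_groupoid)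
    have o: "openin X {x. (\<one>\<^bsub>G\<^esub>, x) \<in> S}" by (rule openin_slice[OF S(1) one_in_G])
    moreover have "W = {\<one>\<^bsub>G\<^esub>} \<times> {x. (\<one>\<^bsub>G\<^esub>, x) \<in> S}"
      using S(2) openin_subset[OF o] by auto
    ultimately show "\<exists>V. openin X V \<and> W = {\<one>\<^bsub>G\<^esub>} \<times> V" by blast
  next
    assume "\<exists>V. openin X V \<and> W = {\<one>\<^bsub>G\<^esub>} \<times> V"
    then obtain V where V: "openin X V" "W = {\<one>\<^bsub>G\<^esub>} \<times> V" by blast
    have "V \<subseteq> topspace X" using openin_subset[OF V(1)] .
    then have "openin (arrows_top H) W" "W = W \<inter> gunits H"
      using openin_times_slice[OF V(1) one_in_G] V(2) U_one by (auto simp: gunits_groupoid)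
    then show "openin ?T W" unfolding openin_subtopology by blast
  qed
  have nonempty: "(\<forall>x\<in>topspace X. \<forall>V. x \<in> V \<and> openin X V \<longrightarrow> P V) \<longleftrightarrow>
      (\<forall>V. openin X V \<and> V \<noteq> {} \<longrightarrow> P V)" for P
  proof (intro iffI allI impI ballI)
    fix V assume *: "\<forall>x\<in>topspace X. \<forall>V. x \<in> V \<and> openin X V \<longrightarrow> P V" and V: "openin X V \<and> V \<noteq> {}"
    then obtain x where "x \<in> V" by blast
    moreover from this have "x \<in> topspace X" using openin_subset[of X V] V by blast
    ultimately show "P V" using * V by blast
  qed blast
  have "topologically_principal H \<longleftrightarrow> gunits H \<subseteq> ?T closure_of ?D"
    unfolding topologically_principal_def using closure_of_subset_topspace[of ?T ?D] top by auto
  also have "\<dots> \<longleftrightarrow> (\<forall>x\<in>topspace X. \<forall>V. x \<in> V \<and> openin X V \<longrightarrow> (\<exists>y\<in>V. ?triv y))"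
  proof -
    have "(\<one>\<^bsub>G\<^esub>, x) \<in> ?T closure_of ?D \<longleftrightarrow> (\<forall>V. x \<in> V \<and> openin X V \<longrightarrow> (\<exists>y\<in>V. ?triv y))"
      if x: "x \<in> topspace X" for x
    proof -
      have "(\<one>\<^bsub>G\<^esub>, x) \<in> ?T closure_of ?D \<longleftrightarrow>
          (\<forall>W. (\<one>\<^bsub>G\<^esub>, x) \<in> W \<and> openin ?T W \<longrightarrow> (\<exists>u. u \<in> ?D \<and> u \<in> W))"
        unfolding in_closure_of top using x by (simp add: gunits_groupoid)
      also have "\<dots> \<longleftrightarrow> (\<forall>V. x \<in> V \<and> openin X V \<longrightarrow> (\<exists>u. u \<in> ?D \<and> u \<in> {\<one>\<^bsub>G\<^esub>} \<times> V))"
        unfolding op by (metis (no_types, lifting) SigmaE2 SigmaI singletonI)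
      also have "\<dots> \<longleftrightarrow> (\<forall>V. x \<in> V \<and> openin X V \<longrightarrow> (\<exists>y\<in>V. ?triv y))"
      proof -
        have "(\<exists>u. u \<in> ?D \<and> u \<in> {\<one>\<^bsub>G\<^esub>} \<times> V) \<longleftrightarrow> (\<exists>y\<in>V. ?triv y)" if "openin X V" for V
        proof -
          have "(\<exists>u. u \<in> ?D \<and> u \<in> {\<one>\<^bsub>G\<^esub>} \<times> V) \<longleftrightarrow> (\<exists>y\<in>V. (\<one>\<^bsub>G\<^esub>, y) \<in> ?D)" by blast
          also have "\<dots> \<longleftrightarrow> (\<exists>y\<in>V. ?triv y)"
            by (rule bex_cong[OF refl]) (use openin_subset[OF that] in \<open>intro D, blast\<close>)
          finally show ?thesis .
        qed
        then show ?thesis by meson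
      qed
      finally show ?thesis .
    qed
    then show ?thesis unfolding gunits_groupoid by blast
  qed
  also have "\<dots> \<longleftrightarrow> (\<forall>V. openin X V \<and> V \<noteq> {} \<longrightarrow> (\<exists>y\<in>V. ?triv y))"
    by (rule nonempty)
  finally show ?thesis .
qed

lemma topologically_principal_imp_topologically_free:
  assumes "topologically_principal H"
  shows "topologically_free G X U \<phi>"
  unfolding topologically_free_def
proof (rule ballI, rule ccontr)
  fix t assume t: "t \<in> carrier G - {\<one>\<^bsub>G\<^esub>}"
  let ?V = "X interior_of partial_action_Fix G X U \<phi> t"
  assume "?V \<noteq> {}"
  then obtain x where x: "x \<in> ?V"
    "\<forall>s\<in>carrier G. x \<in> U s \<and> \<phi> (inv\<^bsub>G\<^esub> s) x = x \<longrightarrow> s = \<one>\<^bsub>G\<^esub>"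
    using assms unfolding topologically_principal_iff by (meson openin_interior_of)
  have "x \<in> partial_action_Fix G X U \<phi> t" by (rule subsetD[OF interior_of_subset x(1)])
  moreover have "inv\<^bsub>G\<^esub> t \<in> carrier G" "inv\<^bsub>G\<^esub> (inv\<^bsub>G\<^esub> t) = t"
    using t group.inv_closed[OF G] group.inv_inv[OF G] by auto
  ultimately have "inv\<^bsub>G\<^esub> t = \<one>\<^bsub>G\<^esub>" using x(2) by (simp add: partial_action_Fix_def)
  then have "t = \<one>\<^bsub>G\<^esub>"
    using \<open>inv\<^bsub>G\<^esub> (inv\<^bsub>G\<^esub> t) = t\<close> group.is_monoid[OF G] monoid.inv_one by metis
  then show False using t by simp
qed

end


section \<open>Quotients of words in the free group\<close>

lemma inv_free_group:
  assumes w: "w \<in> carrier (free_group X)"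
  shows "inv\<^bsub>free_group X\<^esub> w = rev (map (\<lambda>(a, b). (a, \<not> b)) w)"
proof -
  let ?f = "\<lambda>(a::'a, b). (a, \<not> b)"
  let ?u = "rev (map ?f w)"
  have canc: "foldr reduced_cons (rev (map ?f v)) v = []" for v :: "'a gword"
    by (induction v) (auto simp: cancels_def)
  have "successively (\<lambda>x y. \<not> cancels x y) ?u"
    using w by (auto simp: free_group_def reduced_def successively_map cancels_def
        case_prod_beta eq_commute)
  then have "?u \<in> carrier (free_group X)"
    using w by (auto simp: free_group_def reduced_def)
  moreover have "?u \<otimes>\<^bsub>free_group X\<^esub> w = \<one>\<^bsub>free_group X\<^esub>"
    using canc[of w] by (simp add: free_group_def)
  ultimately show ?thesis using group.inv_equality[OF group_free_group] w by metis
qed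

lemma one_free_group: "\<one>\<^bsub>free_group X\<^esub> = []"
  by (simp add: free_group_def)

context generalized_boolean_dynamical_system
begin

lemma num_quot [simp]: "num (quot \<alpha> \<beta>) = \<alpha>"
proof -
  have "takeWhile snd (map (\<lambda>b. (b, False)) (rev \<beta>)) = []"
    by (cases "rev \<beta>") simp_all
  then have "takeWhile snd (quot \<alpha> \<beta>) = map (\<lambda>a. (a, True)) \<alpha>"
    unfolding quot_def by (subst takeWhile_append2) auto
  then show ?thesis by (simp add: num_def o_def)
qed

lemma den_quot [simp]: "den (quot \<alpha> \<beta>) = \<beta>"
proof -
  have "dropWhile snd (map (\<lambda>b. (b, False)) (rev \<beta>)) = map (\<lambda>b. (b, False)) (rev \<beta>)"
    by (cases "rev \<beta>") simp_all
  then have "dropWhile snd (quot \<alpha> \<beta>) = map (\<lambda>b. (b, False)) (rev \<beta>)"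
    unfolding quot_def by (subst dropWhile_append2) auto
  then show ?thesis by (simp add: den_def o_def rev_map[symmetric])
qed

lemma inv_quot:
  assumes "quot \<alpha> \<beta> \<in> carrier (free_group L)"
  shows "inv\<^bsub>free_group L\<^esub> (quot \<alpha> \<beta>) = quot \<beta> \<alpha>"
  using inv_free_group[OF assms] by (simp add: quot_def rev_map o_def)

lemma quot_self_reduced: "reduced (quot \<alpha> \<alpha>) \<Longrightarrow> \<alpha> = []"
  by (cases \<alpha> rule: rev_cases)
    (auto simp: quot_def reduced_def successively_append_iff cancels_def)


section \<open>The partial action\<close>

lemma initial_labels_eq_iff:
  "map fst (initial_edges (length \<alpha>) \<mu>) = \<alpha> \<longleftrightarrow>
    enat (length \<alpha>) \<le> plength \<mu> \<and> labels (edge_at \<mu>) 0 (length \<alpha>) = \<alpha>"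
proof
  assume l: "map fst (initial_edges (length \<alpha>) \<mu>) = \<alpha>"
  then have "length (initial_edges (length \<alpha>) \<mu>) = length \<alpha>" by (metis length_map)
  then have "enat (length \<alpha>) \<le> plength \<mu>" by (rule length_initial_edges)
  then show "enat (length \<alpha>) \<le> plength \<mu> \<and> labels (edge_at \<mu>) 0 (length \<alpha>) = \<alpha>"
    using l by (simp add: initial_edges_edge_at labels_def o_def)
qed (simp add: initial_edges_edge_at labels_def o_def)

lemma labelled_eq_Union_cylinder:
  assumes \<alpha>: "\<alpha> \<noteq> []"
  shows "{\<mu> \<in> boundary. map fst (initial_edges (length \<alpha>) \<mu>) = \<alpha> \<and>
      snd (last (initial_edges (length \<alpha>) \<mu>)) \<inter> J \<noteq> {}} = (\<Union>B\<in>J \<inter> I (last \<alpha>). cylinder \<alpha> B)" (is "?l = ?r")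
proof -
  obtain n where n: "length \<alpha> = Suc n" using \<alpha> by (cases \<alpha>) auto
  show ?thesis
  proof (intro equalityI subsetI)
    fix \<mu> assume "\<mu> \<in> ?l"
    then have \<mu>: "\<mu> \<in> boundary" "enat (Suc n) \<le> plength \<mu>" "labels (edge_at \<mu>) 0 (Suc n) = \<alpha>"
      and "snd (last (initial_edges (Suc n) \<mu>)) \<inter> J \<noteq> {}"
      using initial_labels_eq_iff[of \<alpha> \<mu>, unfolded n] n by simp_all
    then obtain B where B: "B \<in> snd (edge_at \<mu> n)" "B \<in> J"
      using last_initial_edges[OF \<mu>(2)] by auto
    have "edge_at \<mu> n \<in> E1"
      using boundary_chain[OF \<mu>(1), of n] \<mu>(2) chainD(1) by (simp add: Suc_ile_eq)
    then have "B \<in> I (fst (edge_at \<mu> n))" using B(1) by (rule snd_edge_in_I)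
    moreover have "fst (edge_at \<mu> n) = last \<alpha>" using \<mu>(3)[symmetric] by (simp add: labels_Suc)
    ultimately show "\<mu> \<in> ?r" using B \<mu> n by (auto simp: cylinder_def)
  next
    fix \<mu> assume "\<mu> \<in> ?r"
    then obtain B where B: "B \<in> J" "\<mu> \<in> cylinder \<alpha> B" by blast
    then have \<mu>: "\<mu> \<in> boundary" "enat (Suc n) \<le> plength \<mu>" "labels (edge_at \<mu>) 0 (Suc n) = \<alpha>"
      "B \<in> snd (edge_at \<mu> n)" by (auto simp: cylinder_def n)
    then have "map fst (initial_edges (Suc n) \<mu>) = \<alpha>"
      using initial_labels_eq_iff[of \<alpha> \<mu>, unfolded n] by simp
    then show "\<mu> \<in> ?l" using \<mu>(1,4) B(1) last_initial_edges[OF \<mu>(2)] n by auto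
  qed
qed

lemma openin_U:
  assumes t: "t \<in> carrier (free_group L)"
  shows "openin boundary_top (U t)"
proof -
  let ?\<alpha> = "num t" and ?\<beta> = "den t"
  consider "t = []"
    | "t \<noteq> []" "t = quot ?\<alpha> ?\<beta> \<and> ?\<alpha> \<in> Wstar \<and> ?\<beta> \<in> Wstar \<and> Iw ?\<alpha> \<inter> Iw ?\<beta> \<noteq> {bot}"
    | "t \<noteq> []" "\<not> (t = quot ?\<alpha> ?\<beta> \<and> ?\<alpha> \<in> Wstar \<and> ?\<beta> \<in> Wstar \<and> Iw ?\<alpha> \<inter> Iw ?\<beta> \<noteq> {bot})" by blast
  then show ?thesis
  proof cases
    case 1
    then have "U t = topspace boundary_top" by (simp add: U_def topspace_boundary_top)
    then show ?thesis by simp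
  next
    case 2
    show ?thesis
    proof (cases "?\<alpha> = []")
      case True
      then have "U t = {\<mu> \<in> boundary. path_r \<mu> \<inter> Iw ?\<beta> \<noteq> {}}"
        using 2 t unfolding U_def Let_def by simp
      also have "\<dots> = (\<Union>B\<in>Iw ?\<beta>. {\<mu> \<in> boundary. B \<in> path_r \<mu>})" by blast
      finally show ?thesis using openin_path_r by auto
    next
      case False
      then have "U t = {\<mu> \<in> boundary. map fst (initial_edges (length ?\<alpha>) \<mu>) = ?\<alpha> \<and>
          snd (last (initial_edges (length ?\<alpha>) \<mu>)) \<inter> Iw ?\<beta> \<noteq> {}}"
        using 2 t unfolding U_def Let_def by simp
      also have "\<dots> = (\<Union>B\<in>Iw ?\<beta> \<inter> I (last ?\<alpha>). cylinder ?\<alpha> B)" by (rule labelled_eq_Union_cylinder[OF False])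
      moreover have "set ?\<alpha> \<subseteq> L" using 2 by (simp add: Wstar_def)
      ultimately show ?thesis using openin_cylinder[OF False] by auto
    qed
  next
    case 3
    have neg: "\<not> (t \<in> carrier (free_group L) \<and> t = quot ?\<alpha> ?\<beta> \<and> ?\<alpha> \<in> Wstar \<and> ?\<beta> \<in> Wstar \<and>
        Iw ?\<alpha> \<inter> Iw ?\<beta> \<noteq> {bot})" using 3(2) by blast
    have "U t = {}" unfolding U_def Let_def if_not_P[OF 3(1)] if_not_P[OF neg] ..
    then show ?thesis by simp
  qed
qed

lemma in_U_quot:
  assumes "\<mu> \<in> U t" "t \<noteq> []"
  shows "\<exists>\<alpha> \<beta>. t = quot \<alpha> \<beta> \<and> t \<in> carrier (free_group L) \<and> enat (length \<alpha>) \<le> plength \<mu> \<and>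
    labels (edge_at \<mu>) 0 (length \<alpha>) = \<alpha>"
proof -
  have t: "t = quot (num t) (den t)" "t \<in> carrier (free_group L)"
    "num t = [] \<or> map fst (initial_edges (length (num t)) \<mu>) = num t"
    using assms unfolding U_def Let_def by (auto split: if_splits)
  then have "enat (length (num t)) \<le> plength \<mu> \<and> labels (edge_at \<mu>) 0 (length (num t)) = num t"
    using initial_labels_eq_iff[of "num t" \<mu>] by (auto simp: zero_enat_def[symmetric])
  then show ?thesis using t by blast
qed

lemma map_fst_edges_to: "map fst (edges_to \<alpha> v) = \<alpha>"
  by (induction \<alpha> v rule: edges_to.induct) (simp_all add: Let_def)

lemma plength_drop_edges: "enat n \<le> plength \<mu> \<Longrightarrow> enat n + plength (drop_edges n \<mu>) = plength \<mu>"
  by (cases \<mu>) (auto simp: zero_enat_def)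

text \<open>Let \<open>t = \<alpha>\<beta>\<^sup>-\<^sup>1\<close>.  The inverse of \<open>t\<close> replaces the prefix \<open>\<alpha>\<close> of \<open>\<mu>\<close> by \<open>\<beta>\<close>, so that \<open>\<mu>\<close>
  begins with both words.  If they had the same length they would be equal, and the reduced word
  \<open>t\<close> would be trivial.  Comparing lengths shows that \<open>\<mu>\<close> is infinite, and its shifts by the two
  lengths agree.\<close>

lemma fixed_point_eventually_periodic:
  assumes t: "t \<noteq> []" and \<mu>: "\<mu> \<in> U t" and fixed: "\<phi> (inv\<^bsub>free_group L\<^esub> t) \<mu> = \<mu>"
  shows "eventually_periodic \<mu>"
proof -
  obtain \<alpha> \<beta> where q: "t = quot \<alpha> \<beta>" "t \<in> carrier (free_group L)"
    and l: "enat (length \<alpha>) \<le> plength \<mu>" "labels (edge_at \<mu>) 0 (length \<alpha>) = \<alpha>"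
    using in_U_quot[OF \<mu> t] by blast
  have red: "reduced (quot \<alpha> \<beta>)" using q by (simp add: free_group_def)
  have ne: "\<alpha> \<noteq> \<beta>"
  proof
    assume "\<alpha> = \<beta>"
    then have "\<alpha> = []" using red quot_self_reduced by blast
    then show False using t q(1) \<open>\<alpha> = \<beta>\<close> by (simp add: quot_def)
  qed
  have inv: "inv\<^bsub>free_group L\<^esub> t = quot \<beta> \<alpha>" using inv_quot q by simp
  have "quot \<beta> \<alpha> \<noteq> []" using t q(1) by (auto simp: quot_def)
  then obtain es where es: "map fst es = \<beta>" "prepend es (drop_edges (length \<alpha>) \<mu>) = \<mu>"
    using fixed map_fst_edges_to unfolding inv \<phi>_def Let_def by auto
  have len: "length es = length \<beta>" using es(1) by auto
  have ne_len: "length \<alpha> \<noteq> length \<beta>"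
  proof
    assume eq: "length \<alpha> = length \<beta>"
    have "\<alpha> ! i = \<beta> ! i" if i: "i < length \<alpha>" for i
    proof -
      have "\<alpha> ! i = fst (edge_at \<mu> i)" using nth_labels[of i "length \<alpha>" 0 "edge_at \<mu>"] l(2) i by simp
      also have "edge_at \<mu> i = es ! i" using edge_at_prepend(1)[of i es "drop_edges (length \<alpha>) \<mu>"] es(2) len eq i by simp
      also have "fst (es ! i) = \<beta> ! i" using es(1) len eq i by (metis nth_map)
      finally show ?thesis .
    qed
    then show False using ne eq nth_equalityI by blast
  qed
  have "enat (length \<beta>) + plength (drop_edges (length \<alpha>) \<mu>) = enat (length \<alpha>) + plength (drop_edges (length \<alpha>) \<mu>)"
    by (rule trans[OF plength_prepend[of es "drop_edges (length \<alpha>) \<mu>", unfolded es(2) len, symmetric]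
        plength_drop_edges[OF l(1), symmetric]])
  then have "plength (drop_edges (length \<alpha>) \<mu>) = \<infinity>"
    using ne_len by (cases "plength (drop_edges (length \<alpha>) \<mu>)") auto
  then have "plength \<mu> = \<infinity>" using plength_drop_edges[OF l(1)] by simp
  then obtain f where f: "\<mu> = InfPath f" by (cases \<mu>) auto
  have "prepend es (InfPath (\<lambda>i. f (length \<alpha> + i))) = InfPath f" using es(2) f by simp
  then have "InfPath (\<lambda>i. f (length \<alpha> + i)) = InfPath (\<lambda>i. f (length \<beta> + i))"
    using prepend_eq_InfPath[of es] len by metis
  then have shift: "f (length \<alpha> + i) = f (length \<beta> + i)" for i by (metis gpath.inject(3))
  let ?k = "min (length \<alpha>) (length \<beta>)" and ?m = "max (length \<alpha>) (length \<beta>) - min (length \<alpha>) (length \<beta>)"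
  have "f (i + ?m) = f i" if i: "i \<ge> ?k" for i
    using shift[of "i - ?k"] i by (cases "length \<alpha> \<le> length \<beta>") (simp_all add: min_def max_def add.commute)
  moreover have "0 < ?m" using ne_len by auto
  ultimately show ?thesis unfolding eventually_periodic_def using f by blast
qed


section \<open>A cycle without exits fixes an open set of paths\<close>

fun vertex_at :: "('l, 'b) gpath \<Rightarrow> nat \<Rightarrow> 'b set" where
  "vertex_at \<mu> 0 = path_r \<mu>"
| "vertex_at \<mu> (Suc j) = edge_d (edge_at \<mu> j)"

lemma vertex_at_end:
  assumes "\<mu> \<in> boundary" "plength \<mu> = enat j"
  shows "vertex_at \<mu> j \<in> E0_sg"
proof (cases \<mu>)
  case (Vertex v)
  then show ?thesis using assms by (simp add: boundary_Vertex zero_enat_def)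
next
  case (FinPath es)
  then have "es \<noteq> []" "edge_d (last es) \<in> E0_sg" using assms(1) by (auto simp: boundary_FinPath)
  moreover obtain m where "j = Suc m" using assms(2) FinPath \<open>es \<noteq> []\<close> by (cases j) auto
  ultimately show ?thesis using assms(2) FinPath by (simp add: last_conv_nth)
qed (use assms in simp)

lemma edge_r_vertex_at:
  assumes "\<mu> \<in> boundary" "enat j < plength \<mu>"
  shows "edge_r (edge_at \<mu> j) = vertex_at \<mu> j"
proof (cases j)
  case 0
  then show ?thesis using path_r_edge_at assms by (simp add: zero_enat_def)
next
  case (Suc i)
  then show ?thesis using chainD(2)[OF boundary_chain[OF assms], of i] by simp
qed

lemma shift_chain: "(\<And>n. chain f n) \<Longrightarrow> chain (\<lambda>i. f (q + i)) n"
  unfolding chain_def by (metis add_Suc_right lessI order.refl)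

text \<open>The vertex of \<open>\<mu>\<close> at position \<open>j\<close> contains the image of \<open>A\<close> under the first \<open>j mod n\<close>
  letters of \<open>\<alpha>\<close>.  This image is regular, so \<open>\<mu>\<close> does not end there, and a single label is
  available for the next edge.  Below \<open>A\<close> the word \<open>\<alpha>\<close> acts trivially, hence the vertices at
  multiples of \<open>n\<close> coincide.  An edge is determined by its label and its domain, so this equality
  of vertices propagates to the edges before them.\<close>

lemma cycle_no_exits_path_periodic:
  assumes cyc: "cycle \<alpha> A" "no_exits \<alpha> A" and \<mu>: "\<mu> \<in> boundary" "A \<in> path_r \<mu>"
  shows "\<exists>f. \<mu> = InfPath f \<and> labels f 0 (length \<alpha>) = \<alpha> \<and> (\<forall>i. f (length \<alpha> + i) = f i)"
proof -
  let ?n = "length \<alpha>"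
  have n0: "0 < ?n" and \<alpha>L: "set \<alpha> \<subseteq> L" and A0: "A \<noteq> bot" and fixA: "\<And>B. B \<le> A \<Longrightarrow> \<theta>w \<alpha> B = B"
    using cyc(1) by (auto simp: cycle_def)
  define Aj where "Aj r = \<theta>w (take r \<alpha>) A" for r
  have nx: "regular (Aj r) \<and> \<Delta> (Aj r) = {\<alpha> ! r}" if r: "r < ?n" "Aj r \<noteq> bot" for r
  proof (cases r)
    case 0
    \<comment> \<open>The condition on exits starts at position 1; position 0 is covered by position \<open>n\<close>, as
      \<open>\<alpha>\<close> fixes \<open>A\<close>.\<close>
    have "A \<le> \<theta>w (take ?n \<alpha>) A" using fixA by simp
    then show ?thesis using cyc(2) A0 n0 0 unfolding no_exits_def Aj_def
      by (metis (no_types, lifting) One_nat_def Suc_leI \<theta>w_Nil atLeastAtMost_iff mod_self order.refl take0)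
  next
    case (Suc s)
    then have "r \<in> {1..?n}" "r mod ?n = r" using r(1) by simp_all
    then show ?thesis using cyc(2) r(2) unfolding no_exits_def Aj_def by (metis order.refl)
  qed
  have next_A: "\<theta> (\<alpha> ! (j mod ?n)) (Aj (j mod ?n)) = Aj (Suc j mod ?n)" for j
  proof -
    let ?r = "j mod ?n"
    have r: "?r < ?n" using n0 by simp
    have "\<theta> (\<alpha> ! ?r) (Aj ?r) = Aj (Suc ?r)"
      using r by (simp add: Aj_def take_Suc_conv_app_nth \<theta>w_append)
    also have "\<dots> = Aj (Suc j mod ?n)"
    proof (cases "Suc ?r = ?n")
      case True
      then show ?thesis using fixA[of A] by (simp add: mod_Suc Aj_def)
    qed (simp add: mod_Suc)
    finally show ?thesis .
  qed
  have step: "enat j < plength \<mu> \<and> fst (edge_at \<mu> j) = \<alpha> ! (j mod ?n)" if "Aj (j mod ?n) \<in> vertex_at \<mu> j"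
    "enat j \<le> plength \<mu>" for j
  proof -
    have v: "vertex_at \<mu> j \<in> E0"
    proof (cases j)
      case 0
      then show ?thesis using path_r_in_E0[OF \<mu>(1)] \<mu>(2) by auto
    next
      case (Suc i)
      then have "enat i < plength \<mu>" using that(2) by (simp add: Suc_ile_eq)
      then have "edge_at \<mu> i \<in> E1" using boundary_chain[OF \<mu>(1)] chainD(1) by blast
      then show ?thesis using Suc by (simp add: edge_d_in_E0)
    qed
    have reg: "regular (Aj (j mod ?n))" "\<Delta> (Aj (j mod ?n)) = {\<alpha> ! (j mod ?n)}"
      using nx[of "j mod ?n"] E0_bot[OF v that(1)] n0 by simp_all
    have "vertex_at \<mu> j \<notin> E0_sg"
      using regular_in_F0_rg[OF reg(1) that(1) v] by (simp add: E0_sg_iff)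
    then have lt: "enat j < plength \<mu>" using vertex_at_end[OF \<mu>(1)] that(2) by (metis order.order_iff_strict)
    have "edge_at \<mu> j \<in> E1" using boundary_chain[OF \<mu>(1) lt] chainD(1) by blast
    then have "fst (edge_at \<mu> j) \<in> \<Delta> (Aj (j mod ?n))"
      using edge_r_\<Delta> edge_r_vertex_at[OF \<mu>(1) lt] that(1) by simp
    then show ?thesis using lt reg(2) by simp
  qed
  have inv: "Aj (j mod ?n) \<in> vertex_at \<mu> j \<and> enat j \<le> plength \<mu>" for j
  proof (induction j)
    case 0
    then show ?case using \<mu>(2) by (simp add: Aj_def zero_enat_def[symmetric])
  next
    case (Suc j)
    have s: "enat j < plength \<mu>" "fst (edge_at \<mu> j) = \<alpha> ! (j mod ?n)" using step Suc by blast+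
    have "\<theta> (fst (edge_at \<mu> j)) (Aj (j mod ?n)) \<in> snd (edge_at \<mu> j)"
      using Suc edge_r_vertex_at[OF \<mu>(1) s(1)] by (simp add: edge_r_iff[symmetric])
    then have "Aj (Suc j mod ?n) \<in> snd (edge_at \<mu> j)" using s(2) next_A by simp
    then show ?case using s(1) snd_subset_edge_d by (simp add: Suc_ile_eq)
  qed
  have "plength \<mu> = \<infinity>" using inv step by (metis enat.exhaust less_irrefl)
  then obtain f where f: "\<mu> = InfPath f" by (cases \<mu>) auto
  have c: "chain f i" for i using \<mu>(1) f by (simp add: boundary_InfPath)
  have labf: "fst (f j) = \<alpha> ! (j mod ?n)" for j using step inv f by auto
  have labq: "labels f (k * ?n) (k * ?n + ?n) = \<alpha>" for k
    by (rule nth_equalityI) (simp_all add: nth_labels labf)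
  have Ar: "A \<in> edge_r (f (k * ?n))" for k
    using inv[of "k * ?n"] edge_r_vertex_at[OF \<mu>(1), of "k * ?n"] f by (simp add: Aj_def)
  have rr: "edge_r (f (k * ?n + ?n)) = edge_r (f (k * ?n))" for k
  proof -
    let ?q = "k * ?n"
    have E: "edge_r (f i) \<in> E0" if "edge_r (f i) \<noteq> {}" for i
      using edge_r_in_E0[OF chainD(1)[OF c order.refl] that] .
    have e0: "edge_r (f ?q) \<in> E0" using E Ar by blast
    have "edge_r (f ?q) \<subseteq> edge_r (f (?q + ?n))"
    proof
      fix B assume "B \<in> edge_r (f ?q)"
      then have C: "inf A B \<in> edge_r (f ?q)" using E0_inf[OF e0 Ar] by blast
      have sn: "Suc (?n - 1) = ?n" using n0 by simp
      have "labels (\<lambda>i. f (?q + i)) 0 ?n = \<alpha>"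
        using labq[of k] by (auto simp: list_eq_iff_nth_eq nth_labels)
      then have "\<theta>w \<alpha> (inf A B) \<in> snd (f (?q + (?n - 1)))"
        using edge_r_transport[OF shift_chain[OF c], of "inf A B" ?q "?n - 1"] C sn by simp
      then have "inf A B \<in> edge_d (f (?q + (?n - 1)))" using fixA snd_subset_edge_d by simp
      also have "edge_d (f (?q + (?n - 1))) = edge_r (f (?q + ?n))"
      proof -
        have "Suc (?q + (?n - 1)) = ?q + ?n" using n0 by simp
        then show ?thesis using chainD(2)[OF c[of "Suc (?q + (?n - 1))"] lessI] by metis
      qed
      finally have i: "inf A B \<in> edge_r (f (?q + ?n))" .
      then have "edge_r (f (?q + ?n)) \<in> E0" using E by blast
      then show "B \<in> edge_r (f (?q + ?n))" using i E0_inf_iff by blast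
    qed
    then show ?thesis using E0_eq_of_subset[OF e0] E E0_nonempty[OF e0] by blast
  qed
  have per: "f (?n + i) = f i" for i
  proof -
    \<comment> \<open>Equality of the ranges at \<open>q\<close> and \<open>n + q\<close> is carried down to every position \<open>j \<le> q\<close>.\<close>
    have down: "edge_r (f (?n + j)) = edge_r (f j) \<and> (\<forall>i<k. j + i < q \<longrightarrow> f (?n + (j + i)) = f (j + i))"
      if "j + k = q" "edge_r (f (?n + q)) = edge_r (f q)" for j k q
      using that
    proof (induction k arbitrary: j)
      case (Suc k)
      then have IH: "edge_r (f (?n + Suc j)) = edge_r (f (Suc j))"
        "\<forall>i<k. Suc j + i < q \<longrightarrow> f (?n + (Suc j + i)) = f (Suc j + i)" by auto
      have d: "edge_d (f i) = edge_r (f (Suc i))" and e: "f i \<in> E1" for i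
        using chainD[OF c[of "Suc i"], of i] by simp_all
      have l: "fst (f (?n + j)) = fst (f j)" by (simp add: labf)
      have "snd (f (?n + j)) = snd (f j)"
        using edge_d_Int_I[OF e, of "?n + j"] edge_d_Int_I[OF e, of j] d[of "?n + j"] d[of j] IH(1) l by simp
      then have fj: "f (?n + j) = f j" using l by (simp add: prod_eq_iff)
      have "f (?n + (j + i)) = f (j + i)" if "i < Suc k" "j + i < q" for i
        using fj IH(2) that by (cases i) auto
      then show ?case using fj by simp
    qed simp
    have "edge_r (f (?n + Suc i * ?n)) = edge_r (f (Suc i * ?n))" using rr[of "Suc i"] by (simp only: add.commute)
    moreover have lt: "i < Suc i * ?n" using n0 by (cases "?n") simp_all
    ultimately have "\<forall>d<Suc i * ?n - i. i + d < Suc i * ?n \<longrightarrow> f (?n + (i + d)) = f (i + d)"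
      using down[of i "Suc i * ?n - i" "Suc i * ?n"] by (simp del: mult_Suc)
    then show ?thesis using lt by (metis add_0_right zero_less_diff)
  qed
  have "labels f 0 ?n = \<alpha>" using labq[of 0] by simp
  then show ?thesis using f per by blast
qed

lemma topologically_free_imp_condition_L:
  assumes "\<Phi>_topologically_free"
  shows "condition_L"
  unfolding condition_L_def
proof
  assume "\<exists>\<alpha> A. cycle \<alpha> A \<and> no_exits \<alpha> A"
  then obtain \<alpha> A where cyc: "cycle \<alpha> A" "no_exits \<alpha> A" by blast
  have n0: "\<alpha> \<noteq> []" and \<alpha>L: "set \<alpha> \<subseteq> L" and A0: "A \<noteq> bot" and fixA: "\<theta>w \<alpha> A = A"
    using cyc(1) by (auto simp: cycle_def)
  let ?t = "quot [] \<alpha>" and ?s = "quot \<alpha> []"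
  have s_map: "?s = map (\<lambda>a. (a, True)) \<alpha>" by (simp add: quot_def)
  have sc: "?s \<in> carrier (free_group L)"
  proof -
    have "reduced ?s"
      unfolding s_map reduced_def successively_map by (induction \<alpha> rule: induct_list012) (simp_all add: cancels_def)
    then show ?thesis using \<alpha>L by (auto simp: free_group_def s_map)
  qed
  have inv_s: "inv\<^bsub>free_group L\<^esub> ?s = ?t" by (rule inv_quot[OF sc])
  have tc: "?t \<in> carrier (free_group L)"
    using group.inv_closed[OF group_free_group sc] inv_s by simp
  have inv_t: "inv\<^bsub>free_group L\<^esub> ?t = ?s" by (rule inv_quot[OF tc])
  have t1: "?t \<noteq> []" "?s \<noteq> []" using n0 by (auto simp: quot_def)
  obtain a v where av: "\<alpha> = a # v" using n0 by (cases \<alpha>) auto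
  have "A \<in> Iw \<alpha>"
  proof -
    have "A \<le> \<theta>w v (\<theta> a A)" using fixA av by simp
    then show ?thesis using \<theta>_in_I[of a A] \<alpha>L av by auto
  qed
  then have W: "\<alpha> \<in> Wstar" "[] \<in> Wstar" "Iw \<alpha> \<inter> Iw [] \<noteq> {bot}"
    using A0 \<alpha>L by (auto simp: Wstar_def)
  let ?V = "{\<mu> \<in> boundary. A \<in> path_r \<mu>}"
  have "?V \<subseteq> partial_action_Fix (free_group L) boundary_top U \<phi> ?t"
  proof
    fix \<mu> assume \<mu>: "\<mu> \<in> ?V"
    then obtain f where f: "\<mu> = InfPath f" "labels f 0 (length \<alpha>) = \<alpha>" "\<forall>i. f (length \<alpha> + i) = f i"
      using cycle_no_exits_path_periodic[OF cyc] by blast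
    have "labels (edge_at \<mu>) 0 (length \<alpha>) = \<alpha>" using f(1,2) by (simp add: labels_def)
    moreover have "enat (length \<alpha>) \<le> plength \<mu>" using f(1) by simp
    ultimately have "map fst (initial_edges (length \<alpha>) \<mu>) = \<alpha>"
      using initial_labels_eq_iff by blast
    moreover have "snd (last (initial_edges (length \<alpha>) \<mu>)) \<noteq> {}"
    proof -
      obtain m where m: "length \<alpha> = Suc m" using n0 by (cases \<alpha>) auto
      have "f m \<in> E1" using \<mu> f(1) by (auto simp: boundary_InfPath intro: chainD(1))
      then have "snd (f m) \<noteq> {}" using ultrafilter_nonempty unfolding E1_iff by blast
      then show ?thesis using last_initial_edges[of m \<mu>] f(1) m by simp
    qed
    ultimately have "\<mu> \<in> U ?s"
      unfolding U_def Let_def using t1 sc W n0 \<mu> by simp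
    moreover have "\<phi> ?t \<mu> = \<mu>"
      unfolding \<phi>_def Let_def using t1 f(1,3) by simp
    ultimately show "\<mu> \<in> partial_action_Fix (free_group L) boundary_top U \<phi> ?t"
      using \<mu> inv_t by (simp add: partial_action_Fix_def topspace_boundary_top)
  qed
  then have "?V \<subseteq> boundary_top interior_of partial_action_Fix (free_group L) boundary_top U \<phi> ?t"
    using openin_path_r by (rule interior_of_maximal)
  moreover have "?V \<noteq> {}"
  proof -
    obtain \<xi> where "\<xi> \<in> E0" "A \<in> \<xi>" using E0_containing[OF A0] by blast
    then show ?thesis using boundary_path_from[of \<xi>] by blast
  qed
  moreover have "?t \<in> carrier (free_group L) - {\<one>\<^bsub>free_group L\<^esub>}" using tc t1 by (simp add: one_free_group)
  ultimately show False
    using assms unfolding \<Phi>_topologically_free_def topologically_free_def by blast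
qed

interpretation \<Phi>: open_partial_action "free_group L" boundary_top U \<phi>
proof (rule open_partial_action.intro)
  show "U \<one>\<^bsub>free_group L\<^esub> = topspace boundary_top"
    by (simp add: one_free_group U_def topspace_boundary_top)
  show "\<phi> \<one>\<^bsub>free_group L\<^esub> \<mu> = \<mu>" for \<mu>
    by (simp add: one_free_group \<phi>_def Let_def)
qed (simp_all add: group_free_group openin_U)

lemma effective_iff_\<Phi>_topologically_free: "effective \<Phi>_groupoid \<longleftrightarrow> \<Phi>_topologically_free"
  unfolding \<Phi>_groupoid_def \<Phi>_topologically_free_def
  by (rule \<Phi>.effective_iff_topologically_free)

lemma principal_imp_\<Phi>_topologically_free:
  "topologically_principal \<Phi>_groupoid \<Longrightarrow> \<Phi>_topologically_free"
  unfolding \<Phi>_groupoid_def \<Phi>_topologically_free_def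
  by (rule \<Phi>.topologically_principal_imp_topologically_free)

lemma condition_L_imp_topologically_principal:
  assumes "condition_L"
  shows "topologically_principal \<Phi>_groupoid"
  unfolding \<Phi>_groupoid_def \<Phi>.topologically_principal_iff
proof (intro allI impI)
  fix V assume V: "openin boundary_top V \<and> V \<noteq> {}"
  then obtain \<mu> where \<mu>: "\<mu> \<in> V" "\<not> eventually_periodic \<mu>"
    using aperiodic_boundary_paths_dense[OF assms] by blast
  have "t = []" if "\<mu> \<in> U t" "\<phi> (inv\<^bsub>free_group L\<^esub> t) \<mu> = \<mu>" for t
    using fixed_point_eventually_periodic[OF _ that] \<mu>(2) by metis
  then show "\<exists>x\<in>V. \<forall>t\<in>carrier (free_group L). x \<in> U t \<and> \<phi> (inv\<^bsub>free_group L\<^esub> t) x = x \<longrightarrow>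
      t = \<one>\<^bsub>free_group L\<^esub>"
    using \<mu>(1) by (auto simp: one_free_group)
qed

end

theorem proposition4p8:
  fixes L :: "'l set"
    and \<theta> :: "'l \<Rightarrow> 'b::relative_boolean_algebra \<Rightarrow> 'b"
    and I :: "'l \<Rightarrow> 'b set"
  assumes "generalized_boolean_dynamical_system L \<theta> I"
  shows "(boolean_dynamical_system.condition_L L \<theta> \<longleftrightarrow>
       generalized_boolean_dynamical_system.\<Phi>_topologically_free L \<theta> I) \<and>
    (generalized_boolean_dynamical_system.\<Phi>_topologically_free L \<theta> I \<longleftrightarrow>
       topologically_principal (generalized_boolean_dynamical_system.\<Phi>_groupoid L \<theta> I)) \<and>
    (topologically_principal (generalized_boolean_dynamical_system.\<Phi>_groupoid L \<theta> I) \<longrightarrow>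
       effective (generalized_boolean_dynamical_system.\<Phi>_groupoid L \<theta> I)) \<and>
    (countable (UNIV :: 'b set) \<and> countable L \<longrightarrow>
       effective (generalized_boolean_dynamical_system.\<Phi>_groupoid L \<theta> I) \<longrightarrow>
       topologically_principal (generalized_boolean_dynamical_system.\<Phi>_groupoid L \<theta> I))"
proof -
  interpret generalized_boolean_dynamical_system L \<theta> I by (rule assms)
  have "condition_L \<Longrightarrow> topologically_principal \<Phi>_groupoid"
    by (rule condition_L_imp_topologically_principal)
  moreover have "topologically_principal \<Phi>_groupoid \<Longrightarrow> \<Phi>_topologically_free"
    by (rule principal_imp_\<Phi>_topologically_free)
  moreover have "\<Phi>_topologically_free \<Longrightarrow> condition_L"
    by (rule topologically_free_imp_condition_L)
  moreover have "effective \<Phi>_groupoid \<longleftrightarrow> \<Phi>_topologically_free"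
    by (rule effective_iff_\<Phi>_topologically_free)
  ultimately show ?thesis by blast
qed

end
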